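(* Let $I,J\subset\mathbb{R}$ be bounded closed intervals, $\Omega=I\times J$, let $a,b>0$ satisfy $\left(\frac{1-a^2-b^2}{2ab}\right)^2<1$ (equivalently, $|a-b|<1$ and $a+b>1$), and let $H\in C^3(\Omega)$ be real-valued with $H>\delta$, $|H_x|>\delta$, $|H_y|>\delta$ on $\Omega$ for some $\delta>0$, and $$a^{2}\frac{H_{xx}}{H_x^2}+(1-a^2-b^2)\frac{H_{xy}}{H_xH_y}+b^2\frac{H_{yy}}{H_y^2}\ge 0\quad\text{on }\Omega.$$ Then there exist positive constants $c=c(H)>0$ and $R_0=R_0(H)$ such that for any $R>R_0$, all $n\ge1$ and all Borel measurable $f:\mathbb{R}^n\to I$, $g:\mathbb{R}^n\to J$, $$\int_{\mathbb{R}^{n}}\left(\int_{\mathbb{R}^{n}}H^{R}\left(f\left(\tfrac{x-y}{a}\right),g\left(\tfrac{y}{b}\right)\right)d\gamma_{p,q,x}(y)\right)^{\frac{1}{R-c}}d\gamma_{n}(x)\ \ge\ H^{\frac{R}{R-c}}\left(\int_{\mathbb{R}^{n}}f\,d\gamma_n,\int_{\mathbb{R}^{n}}g\,d\gamma_n\right),$$ where $$p=\frac{4}{(1-(a-b)^{2})((a+b)^{2}-1)},\qquad q=\frac{2(a^{2}-b^{2}-1)}{(1-(a-b)^{2})((a+b)^{2}-1)}.$$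
   Context: $\gamma_n$ is the standard Gaussian measure on $\mathbb{R}^n$. For $p>0$, $q\in\mathbb{R}$, $x\in\mathbb{R}^n$, $\gamma_{p,q,x}$ is the probability measure on $\mathbb{R}^n$ given by $d\gamma_{p,q,x}(y)=\left(\frac{p}{2\pi}\right)^{n/2}e^{-\frac{|py+qx|^2}{2p}}\,dy$. $H^R(\cdot)$ means the $R$-th power of the value of $H$. The numbers $a,b$ are fixed throughout. *)

theory Defs
  imports "HOL-Analysis.Analysis"
begin

text \<open>
  The dimension \<open>n\<close> is bound inside the theorem (the constants must not depend on it), so it cannot
  be a type.  Points of \<open>n\<close>-dimensional space are the functions \<open>nat \<Rightarrow> real\<close> that are extensional
  on \<open>{..<n}\<close>, i.e. the elements of \<open>space (lborel_dim n)\<close>.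
\<close>

definition lborel_dim :: "nat \<Rightarrow> (nat \<Rightarrow> real) measure" where
  "lborel_dim n = (\<Pi>\<^sub>M i\<in>{..<n}. lborel)"

definition gauss :: "nat \<Rightarrow> (nat \<Rightarrow> real) measure" where
  "gauss n = density (lborel_dim n)
     (\<lambda>y. ennreal ((1 / (2 * pi)) powr (real n / 2) * exp (- (\<Sum>i<n. (y i)\<^sup>2) / 2)))"

definition gauss_pqx :: "nat \<Rightarrow> real \<Rightarrow> real \<Rightarrow> (nat \<Rightarrow> real) \<Rightarrow> (nat \<Rightarrow> real) measure" where
  "gauss_pqx n p q x = density (lborel_dim n)
     (\<lambda>y. ennreal ((p / (2 * pi)) powr (real n / 2)
                    * exp (- (\<Sum>i<n. (p * y i + q * x i)\<^sup>2) / (2 * p))))"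

text \<open>
  Partial derivatives of a function on a closed rectangle \<open>I \<times> J\<close>.  They are taken within the
  rectangle, hence one-sided on its boundary, and are meaningful for nondegenerate intervals only.
\<close>

definition partial_x :: "real set \<Rightarrow> (real \<Rightarrow> real \<Rightarrow> real) \<Rightarrow> real \<Rightarrow> real \<Rightarrow> real" where
  "partial_x I F x y = vector_derivative (\<lambda>t. F t y) (at x within I)"

definition partial_y :: "real set \<Rightarrow> (real \<Rightarrow> real \<Rightarrow> real) \<Rightarrow> real \<Rightarrow> real \<Rightarrow> real" where
  "partial_y J F x y = vector_derivative (\<lambda>t. F x t) (at y within J)"

text \<open>\<open>C_k_on k I J F\<close>: all iterated partial derivatives of \<open>F\<close> of order at most \<open>k\<close> exist and are
  continuous on \<open>I \<times> J\<close>.\<close>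

primrec C_k_on :: "nat \<Rightarrow> real set \<Rightarrow> real set \<Rightarrow> (real \<Rightarrow> real \<Rightarrow> real) \<Rightarrow> bool" where
  "C_k_on 0 I J F \<longleftrightarrow> continuous_on (I \<times> J) (\<lambda>(x, y). F x y)"
| "C_k_on (Suc k) I J F \<longleftrightarrow>
     continuous_on (I \<times> J) (\<lambda>(x, y). F x y) \<and>
     (\<forall>x\<in>I. \<forall>y\<in>J. (\<lambda>t. F t y) differentiable (at x within I) \<and>
                 (\<lambda>t. F x t) differentiable (at y within J)) \<and>
     C_k_on k I J (partial_x I F) \<and> C_k_on k I J (partial_y J F)"

end

theory Submission
  imports Defs "HOL-Probability.Probability"
begin

text \<open>
  Under \<open>gauss n\<close> for \<open>x\<close> and \<open>gauss_pqx n p q x\<close> for \<open>y\<close>, the vectors \<open>U = (x - y) / a\<close>, \<open>V = y / b\<close> and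
  \<open>X = x = a U + b V\<close> are standard Gaussian; coordinatewise they are linear functions, with unit
  coefficient vectors, of two independent standard normal variables.  Let \<open>W(X)\<close> be the inner integral,
  \<open>k = W powr (1 / (R - c))\<close> and \<open>N = R - c - 1\<close>.  Then the expectation of
  \<open>H(f(U), g(V))\<^sup>R k(X)\<^sup>-\<^sup>N\<close> is the expectation of \<open>k(X)\<close>, so the claim is Jensen's inequality
  \<open>E B(f(U), g(V), k(X)) \<ge> B(E f(U), E g(V), E k(X))\<close> for \<open>B(x, y, z) = H(x, y)\<^sup>R z\<^sup>-\<^sup>N\<close>.

  This Gaussian Jensen inequality holds as soon as the Hadamard product of the Hessian of \<open>B\<close> with the
  covariance matrix of \<open>(U, V, X)\<close> is positive semidefinite: for a Gaussian step of size \<open>\<epsilon>\<close> a second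
  order expansion gives it up to an error \<open>O(\<epsilon>\<^sup>3)\<close>, and composing \<open>1 / \<epsilon>\<^sup>2\<close> such steps makes the
  error vanish.  Approximation removes the regularity of the functions and integrating one coordinate
  at a time gives all dimensions with the same \<open>B\<close>.  In the direction \<open>(a, b)\<close> the quadratic form is
  nonnegative by the differential inequality for \<open>H\<close>, with a gain of order \<open>c / (R - c)\<close>; in the
  orthogonal direction it is of order \<open>R\<close>, and for large \<open>c\<close> the product of the two dominates the
  square of the mixed term.
\<close>

section \<open>Gaussian measures on the line and the plane\<close>

text \<open>The exponent \<open>N = R - c - 1\<close> is forced by homogeneity: as
  \<open>W = k powr (R - c)\<close>, the weighted quantity \<open>W * k powr (- N)\<close> collapses
  to \<open>k\<close>, and Jensen's inequality reads \<open>H powr R * K powr (- N) \<le> K\<close>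
  with \<open>K = E k\<close>, which is the claim up to a root of order \<open>R - c\<close>. The
  numbers \<open>p\<close> and \<open>q\<close> are those for which \<open>U\<close> and
  \<open>V\<close> have variance one. The three Gaussians live in one plane, so the Hadamard
  condition is a sum of two values of the Hessian, one for each axis of that plane. Two obstacles
  shape the argument. \<open>H\<close> has one-sided derivatives at the boundary of its rectangle,
  and the functions are merely Borel; so the Hessian enters through a Taylor inequality with a
  uniform constant, and the functions through bounds that Gaussian averaging preserves, which gives
  all small steps the same error constant. Moreover the range of \<open>k\<close> depends on
  \<open>R\<close>, while \<open>c\<close> and the threshold for \<open>R\<close> may not; this
  works because in logarithmic coordinates the third variable drops out of the quadratic
  form.\<close>

abbreviation std1 :: "real measure" where
  "std1 \<equiv> std_normal_distribution"

definition std2 :: "(real \<times> real) measure" where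
  "std2 = std1 \<Otimes>\<^sub>M std1"

interpretation std1: prob_space std1
  by (intro prob_space_normal_density) simp

interpretation std1_pair: pair_prob_space std1 std1 ..

interpretation std2: prob_space std2
  unfolding std2_def by (rule std1_pair.prob_space_axioms)

lemma sets_std2 [measurable_cong]: "sets std2 = sets borel"
  unfolding std2_def by (simp add: borel_prod[symmetric] cong: sets_pair_measure_cong)

lemma space_std2 [simp]: "space std2 = UNIV"
  using sets_eq_imp_space_eq[OF sets_std2] by simp

lemma integral_std2:
  fixes F :: "real \<times> real \<Rightarrow> 'b::{banach, second_countable_topology}"
  assumes "integrable std2 F"
  shows "(\<integral>z. F z \<partial>std2) = (\<integral>s. \<integral>t. F (s, t) \<partial>std1 \<partial>std1)"
  using std1_pair.integral_fst'[of F] assms unfolding std2_def by simp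

lemma bounded_integrable:
  fixes F :: "'a \<Rightarrow> 'b::{banach, second_countable_topology}"
  assumes "prob_space M" "F \<in> borel_measurable M" "\<And>x. x \<in> space M \<Longrightarrow> norm (F x) \<le> K"
  shows "integrable M F"
proof -
  interpret prob_space M by fact
  show ?thesis
    using assms by (intro integrable_const_bound[where B = K]) auto
qed

text \<open>Holds for every bounded \<open>F\<close>, integrable or not: a non-integrable function
  has integral 0 by convention, and \<open>0 \<le> K\<close> because a probability space is
  nonempty. This saves measurability proofs for iterated integrals.\<close>

lemma bounded_expectation:
  fixes F :: "'a \<Rightarrow> real"
  assumes "prob_space M" "\<And>x. x \<in> space M \<Longrightarrow> \<bar>F x\<bar> \<le> K"
  shows "\<bar>\<integral>x. F x \<partial>M\<bar> \<le> K"
proof -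
  interpret prob_space M by fact
  have "0 \<le> K" using assms(2) not_empty by force
  then have "\<bar>\<integral>x. F x \<partial>M\<bar> \<le> (\<integral>x. K \<partial>M)"
    using order_trans[OF integral_abs_bound[of M F] integral_mono'[of M "\<lambda>_. K" "\<lambda>x. \<bar>F x\<bar>"]] assms(2)
    by simp
  then show ?thesis by (simp add: prob_space)
qed

text \<open>Rotation invariance of the plane Gaussian. Both laws have the characteristic function
  \<open>exp (- ((t * norm w)\<^sup>2) / 2)\<close>, so Levy's uniqueness theorem identifies
  them.\<close>

lemma distr_inner_std2:
  "distr std2 borel (\<lambda>z. w \<bullet> z) = distr std1 borel (\<lambda>t. norm w * t)"
proof (rule Levy_uniqueness)
  show "real_distribution (distr std2 borel (\<lambda>z. w \<bullet> z))"
    by (intro std2.real_distribution_distr) simp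
  show "real_distribution (distr std1 borel (\<lambda>t. norm w * t))"
    by (intro std1.real_distribution_distr) simp
  obtain w1 w2 where w: "w = (w1, w2)" by fastforce
  have c1: "(\<integral>s. iexp (t * s) \<partial>std1) = exp (- (t\<^sup>2) / 2)" for t
    using fun_cong[OF char_std_normal_distribution, of t] by (simp add: char_def)
  show "char (distr std2 borel (\<lambda>z. w \<bullet> z)) = char (distr std1 borel (\<lambda>t. norm w * t))"
  proof
    fix t
    have "char (distr std2 borel (\<lambda>z. w \<bullet> z)) t = (\<integral>z. iexp (t * (w \<bullet> z)) \<partial>std2)"
      unfolding char_def by (subst integral_distr) auto
    also have "\<dots> = (\<integral>x. \<integral>y. iexp (t * (w \<bullet> (x, y))) \<partial>std1 \<partial>std1)"
      by (intro integral_std2 bounded_integrable[where K=1]) (auto intro: std2.prob_space_axioms)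
    also have "\<dots> = (\<integral>x. \<integral>y. iexp ((t * w1) * x) * iexp ((t * w2) * y) \<partial>std1 \<partial>std1)"
      by (simp add: w exp_add[symmetric] algebra_simps)
    also have "\<dots> = exp (- ((t * w1)\<^sup>2) / 2) * exp (- ((t * w2)\<^sup>2) / 2)"
      using c1[of "t * w1"] c1[of "t * w2"] by simp
    also have "\<dots> = exp (- ((t * norm w)\<^sup>2) / 2)"
      by (simp add: exp_add[symmetric] of_real_mult[symmetric] exp_of_real[symmetric] w norm_prod_def power_mult_distrib field_simps
        del: of_real_mult)
    also have "\<dots> = (\<integral>s. iexp ((t * norm w) * s) \<partial>std1)"
      by (rule c1[symmetric])
    also have "\<dots> = char (distr std1 borel (\<lambda>t. norm w * t)) t"
      unfolding char_def by (subst integral_distr) (auto simp: mult.assoc)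
    finally show "char (distr std2 borel (\<lambda>z. w \<bullet> z)) t = char (distr std1 borel (\<lambda>t. norm w * t)) t" .
  qed
qed

lemma integral_inner_std2:
  fixes h :: "real \<Rightarrow> real"
  assumes [measurable]: "h \<in> borel_measurable borel"
  shows "(\<integral>z. h (w \<bullet> z) \<partial>std2) = (\<integral>t. h (norm w * t) \<partial>std1)"
proof -
  have "(\<integral>z. h (w \<bullet> z) \<partial>std2) = integral\<^sup>L (distr std2 borel (\<lambda>z. w \<bullet> z)) h"
    by (subst integral_distr) auto
  also have "\<dots> = (\<integral>t. h (norm w * t) \<partial>std1)"
    unfolding distr_inner_std2 by (subst integral_distr) auto
  finally show ?thesis .
qed

lemma std1_convolution:
  fixes h :: "real \<Rightarrow> real"
  assumes [measurable]: "h \<in> borel_measurable borel" and "\<And>t. \<bar>h t\<bar> \<le> K"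
  shows "(\<integral>x. \<integral>y. h (r * x + s * y) \<partial>std1 \<partial>std1) = (\<integral>t. h (sqrt (r\<^sup>2 + s\<^sup>2) * t) \<partial>std1)"
proof -
  have "(\<integral>x. \<integral>y. h (r * x + s * y) \<partial>std1 \<partial>std1) = (\<integral>z. h ((r, s) \<bullet> z) \<partial>std2)"
    by (subst integral_std2) (auto intro!: bounded_integrable[where K=K] std2.prob_space_axioms simp: assms)
  then show ?thesis
    by (simp add: integral_inner_std2 norm_prod_def)
qed

text \<open>The Gaussian semigroup in the plane. Fubini regroups the four coordinates so that
  corresponding ones of the two vectors stand together; each pair is merged by
  \<open>std1_convolution\<close>.\<close>

lemma std2_convolution:
  fixes \<Phi> :: "real \<times> real \<Rightarrow> real"
  assumes [measurable]: "\<Phi> \<in> borel_measurable borel" and K: "\<And>z. \<bar>\<Phi> z\<bar> \<le> K"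
  shows "(\<integral>z'. \<integral>z. \<Phi> (r *\<^sub>R z' + s *\<^sub>R z) \<partial>std2 \<partial>std2) = (\<integral>z. \<Phi> (sqrt (r\<^sup>2 + s\<^sup>2) *\<^sub>R z) \<partial>std2)"
proof -
  note bi [intro!] = bounded_integrable[where K=K] 
  have ps [simp]: "prob_space std1" "prob_space std2"
    by (rule std1.prob_space_axioms std2.prob_space_axioms)+
  note be = bounded_expectation[where K=K]
  let ?\<Psi> = "\<lambda>z' z. \<Phi> (r *\<^sub>R z' + s *\<^sub>R z)"
  let ?q = "sqrt (r\<^sup>2 + s\<^sup>2)"
  have "(\<integral>z'. \<integral>z. ?\<Psi> z' z \<partial>std2 \<partial>std2)
      = (\<integral>z'. \<integral>y1. \<integral>y2. ?\<Psi> z' (y1, y2) \<partial>std1 \<partial>std1 \<partial>std2)"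
    by (intro Bochner_Integration.integral_cong refl integral_std2 bi) (auto simp: K)
  also have "\<dots> = (\<integral>x1. \<integral>x2. \<integral>y1. \<integral>y2. ?\<Psi> (x1, x2) (y1, y2) \<partial>std1 \<partial>std1 \<partial>std1 \<partial>std1)"
    by (intro integral_std2 bi) (auto simp: K intro!: be)
  also have "\<dots> = (\<integral>x1. \<integral>y1. \<integral>x2. \<integral>y2. ?\<Psi> (x1, x2) (y1, y2) \<partial>std1 \<partial>std1 \<partial>std1 \<partial>std1)"
    by (intro Bochner_Integration.integral_cong refl std1_pair.Fubini_integral bounded_integrable[where K=K] std1_pair.prob_space_axioms)
      (auto simp: K split_beta' intro!: be)
  also have "\<dots> = (\<integral>x1. \<integral>y1. \<integral>t. \<Phi> (r * x1 + s * y1, ?q * t) \<partial>std1 \<partial>std1 \<partial>std1)"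
    using std1_convolution[where K=K and h="\<lambda>t. \<Phi> (_, t)"] by (simp add: K)
  also have "\<dots> = (\<integral>x. \<integral>t. \<Phi> (?q * x, ?q * t) \<partial>std1 \<partial>std1)"
    by (rule std1_convolution[where K=K]) (auto simp: K intro!: be)
  also have "\<dots> = (\<integral>z. \<Phi> (?q *\<^sub>R z) \<partial>std2)"
    by (subst integral_std2) (auto simp: K intro!: bi)
  finally show ?thesis .
qed

section \<open>Moments and a polynomial envelope\<close>

lemma std1_moment_integrable [simp, intro]: "integrable std1 (\<lambda>x. x ^ k)"
  by (rule integrable_std_normal_distribution_moment)

lemma std1_mean: "(\<integral>x. x \<partial>std1) = 0"
  using integral_std_normal_distribution_moment_odd[of 1] by simp

lemma std1_variance: "(\<integral>x. x\<^sup>2 \<partial>std1) = 1"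
  using std_normal_distribution_even_moments(1)[of 1] by (simp add: fact_numeral)

lemma integrable_std2_product:
  fixes u v :: "real \<Rightarrow> real"
  assumes "integrable std1 u" "integrable std1 v"
  shows "integrable std2 (\<lambda>z. u (fst z) * v (snd z))"
proof -
  have "integrable (std1 \<Otimes>\<^sub>M std1) (\<lambda>(x, y). u x * v y)"
  proof (rule std1_pair.Fubini_integrable)
    have [measurable]: "u \<in> borel_measurable borel" "v \<in> borel_measurable borel"
      using assms[THEN borel_measurable_integrable] by simp_all
    show "(\<lambda>(x, y). u x * v y) \<in> borel_measurable (std1 \<Otimes>\<^sub>M std1)"
      by measurable
    show "integrable std1 (\<lambda>x. \<integral>y. norm (case (x, y) of (x, y) \<Rightarrow> u x * v y) \<partial>std1)"
      using assms by (simp add: abs_mult)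
    show "AE x in std1. integrable std1 (\<lambda>y. case (x, y) of (x, y) \<Rightarrow> u x * v y)"
      using assms by simp
  qed
  then show ?thesis
    by (simp add: std2_def split_beta')
qed

lemma integral_std2_product:
  fixes u v :: "real \<Rightarrow> real"
  assumes "integrable std1 u" "integrable std1 v"
  shows "(\<integral>z. u (fst z) * v (snd z) \<partial>std2) = (\<integral>x. u x \<partial>std1) * (\<integral>x. v x \<partial>std1)"
  using integral_std2[OF integrable_std2_product[OF assms]] by simp

lemma std2_moments:
  shows "integrable std2 (\<lambda>z. (fst z)\<^sup>2)" "(\<integral>z. (fst z)\<^sup>2 \<partial>std2) = 1"
    and "integrable std2 (\<lambda>z. (snd z)\<^sup>2)" "(\<integral>z. (snd z)\<^sup>2 \<partial>std2) = 1"
    and "integrable std2 (\<lambda>z. fst z * snd z)" "(\<integral>z. fst z * snd z \<partial>std2) = 0"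
proof -
  have c: "integrable std1 (\<lambda>x. 1)" "(\<integral>x. (1::real) \<partial>std1) = 1"
    using std1.prob_space by (simp_all only: lebesgue_integral_const std1.integrable_const) simp
  have 1: "integrable std1 (\<lambda>x. x)"
    using std1_moment_integrable[of 1] by simp
  show "integrable std2 (\<lambda>z. (fst z)\<^sup>2)" "(\<integral>z. (fst z)\<^sup>2 \<partial>std2) = 1"
    using integrable_std2_product[OF std1_moment_integrable[of 2] c(1)]
      integral_std2_product[OF std1_moment_integrable[of 2] c(1)] c(2) std1_variance by simp_all
  show "integrable std2 (\<lambda>z. (snd z)\<^sup>2)" "(\<integral>z. (snd z)\<^sup>2 \<partial>std2) = 1"
    using integrable_std2_product[OF c(1) std1_moment_integrable[of 2]]
      integral_std2_product[OF c(1) std1_moment_integrable[of 2]] c(2) std1_variance by simp_all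
  show "integrable std2 (\<lambda>z. fst z * snd z)" "(\<integral>z. fst z * snd z \<partial>std2) = 0"
    using integrable_std2_product[OF 1 1] integral_std2_product[OF 1 1] std1_mean by simp_all
qed

text \<open>A majorant of \<open>1\<close>, \<open>norm z\<close> and
  \<open>1 + (norm z)\<^sup>2\<close>. The product form splits the integral of its cube into moments
  on the line; the cube matches the third-order Taylor error.\<close>

definition envelope :: "real \<times> real \<Rightarrow> real" where
  "envelope z = (1 + (fst z)\<^sup>2) * (1 + (snd z)\<^sup>2)"

lemma integrable_envelope_cube: "integrable std2 (\<lambda>z. envelope z ^ 3)"
proof -
  have "integrable std1 (\<lambda>x. 1 + 3 * x ^ 2 + 3 * x ^ 4 + x ^ 6)"
    by (intro Bochner_Integration.integrable_add integrable_mult_right) auto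
  also have "(\<lambda>x::real. 1 + 3 * x ^ 2 + 3 * x ^ 4 + x ^ 6) = (\<lambda>x. (1 + x\<^sup>2) ^ 3)"
    by (rule ext) algebra
  finally have "integrable std1 (\<lambda>x. (1 + x\<^sup>2) ^ 3)" .
  from integrable_std2_product[OF this this] show ?thesis
    by (simp add: envelope_def power_mult_distrib)
qed

lemma envelope_ge: "1 + (norm z)\<^sup>2 \<le> envelope z"
  by (cases z) (simp add: envelope_def norm_prod_def algebra_simps)

lemma envelope_ge_1: "1 \<le> envelope z"
  using envelope_ge[of z] by (smt (verit) zero_le_power2)

lemma envelope_ge_norm: "norm z \<le> envelope z"
proof -
  have "2 * norm z \<le> 1 + (norm z)\<^sup>2"
    using sum_squares_bound[of "norm z" 1] by simp
  then show ?thesis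
    using envelope_ge[of z] norm_ge_zero[of z] by linarith
qed

text \<open>The heat semigroup generated by half the second derivative, at time
  \<open>\<epsilon>\<^sup>2\<close>. The parameter is the standard deviation, so composing two
  averages adds squares.\<close>

definition gauss_avg :: "real \<Rightarrow> (real \<Rightarrow> real) \<Rightarrow> real \<Rightarrow> real" where
  "gauss_avg \<epsilon> f x = (\<integral>t. f (x + \<epsilon> * t) \<partial>std1)"

lemma measurable_gauss_avg [measurable]:
  assumes [measurable]: "f \<in> borel_measurable borel"
  shows "gauss_avg \<epsilon> f \<in> borel_measurable borel"
  unfolding gauss_avg_def by measurable

text \<open>\<open>f'\<close> acts as the derivative of \<open>f\<close> with a uniform quadratic
  remainder, as for a function with Lipschitz derivative. One constant serves all three bounds, so
  that the class is stable under averaging.\<close>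

definition c11 :: "real \<Rightarrow> (real \<Rightarrow> real) \<Rightarrow> (real \<Rightarrow> real) \<Rightarrow> bool" where
  "c11 K f f' \<longleftrightarrow> f \<in> borel_measurable borel \<and> f' \<in> borel_measurable borel \<and>
     (\<forall>x. \<bar>f x\<bar> \<le> K) \<and> (\<forall>x. \<bar>f' x\<bar> \<le> K) \<and> (\<forall>x h. \<bar>f (x + h) - f x - f' x * h\<bar> \<le> K * h\<^sup>2)"

lemma gauss_avg_in_interval:
  assumes [measurable]: "f \<in> borel_measurable borel" and f: "\<And>x. f x \<in> {l..h}"
  shows "gauss_avg \<epsilon> f x \<in> {l..h}"
proof -
  have i: "integrable std1 (\<lambda>t. f (x + \<epsilon> * t))"
  proof (rule bounded_integrable[where K="\<bar>l\<bar> + \<bar>h\<bar>"])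
    show "norm (f (x + \<epsilon> * t)) \<le> \<bar>l\<bar> + \<bar>h\<bar>" for t
      using f[of "x + \<epsilon> * t"] by auto
  qed (auto intro: std1.prob_space_axioms)
  show ?thesis
    unfolding gauss_avg_def using f std1.integral_ge_const[OF i, of l] std1.integral_le_const[OF i, of h]
    by auto
qed

text \<open>Each bound is a convex, translation invariant condition on the pair of functions and
  therefore survives averaging. That \<open>K\<close> does not grow keeps the error of every small
  step the same.\<close>

lemma c11_gauss_avg:
  assumes "c11 K f f'"
  shows "c11 K (gauss_avg \<epsilon> f) (gauss_avg \<epsilon> f')"
proof -
  have [measurable]: "f \<in> borel_measurable borel" "f' \<in> borel_measurable borel"
    and f: "\<And>x. \<bar>f x\<bar> \<le> K" and f': "\<And>x. \<bar>f' x\<bar> \<le> K"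
    and d: "\<And>x h. \<bar>f (x + h) - f x - f' x * h\<bar> \<le> K * h\<^sup>2"
    using assms by (auto simp: c11_def)
  have int: "integrable std1 (\<lambda>t. f (x + \<epsilon> * t))" "integrable std1 (\<lambda>t. f' (x + \<epsilon> * t))" for x
    by (rule bounded_integrable[where K=K]; auto simp: f f' intro: std1.prob_space_axioms)+
  have "\<bar>gauss_avg \<epsilon> f (x + h) - gauss_avg \<epsilon> f x - gauss_avg \<epsilon> f' x * h\<bar> \<le> K * h\<^sup>2" for x h
  proof -
    have "gauss_avg \<epsilon> f (x + h) - gauss_avg \<epsilon> f x - gauss_avg \<epsilon> f' x * h
        = (\<integral>t. f (x + \<epsilon> * t + h) - f (x + \<epsilon> * t) - f' (x + \<epsilon> * t) * h \<partial>std1)"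
      using int[of x] int[of "x + h"] by (simp add: gauss_avg_def algebra_simps)
    then show ?thesis
      using bounded_expectation[OF std1.prob_space_axioms, OF d] by simp
  qed
  moreover have "\<bar>gauss_avg \<epsilon> f x\<bar> \<le> K" "\<bar>gauss_avg \<epsilon> f' x\<bar> \<le> K" for x
    using bounded_expectation[OF std1.prob_space_axioms] f f' by (simp_all add: gauss_avg_def)
  ultimately show ?thesis
    by (simp add: c11_def)
qed

lemma gauss_avg_gauss_avg:
  assumes "f \<in> borel_measurable borel" "\<And>x. \<bar>f x\<bar> \<le> K"
  shows "gauss_avg r (gauss_avg s f) x = gauss_avg (sqrt (r\<^sup>2 + s\<^sup>2)) f x"
  using std1_convolution[of "\<lambda>t. f (x + t)" K r s] assms by (simp add: gauss_avg_def add.assoc)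

lemma expectation_inner_std2:
  assumes "f \<in> borel_measurable borel" "norm w = 1"
  shows "(\<integral>z. f (x + \<epsilon> * (w \<bullet> z)) \<partial>std2) = gauss_avg \<epsilon> f x"
  using integral_inner_std2[of "\<lambda>t. f (x + \<epsilon> * t)" w] assms by (simp add: gauss_avg_def)

section \<open>The Gaussian Jensen inequality in dimension one\<close>

lemma borel_measurable_vec_lambda [measurable (raw)]:
  fixes f :: "'k::finite \<Rightarrow> 'a \<Rightarrow> real"
  assumes "\<And>i. f i \<in> borel_measurable M"
  shows "(\<lambda>x. \<chi> i. f i x) \<in> borel_measurable M"
  using assms by (subst borel_measurable_euclidean_space) (auto simp: Basis_vec_def inner_axis)

text \<open>\<open>g\<close> and \<open>\<beta>\<close> stand for gradient and Hessian, but only a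
  one-sided Taylor bound with a uniform cubic error is asked. \<open>w i\<close> is the coefficient
  vector of the i-th Gaussian on two independent normals; the sum in \<open>positive\<close> is the
  quadratic form, at \<open>\<alpha>\<close>, of the Hadamard product of the Hessian with the Gram
  matrix of \<open>w\<close>.\<close>

locale jensen_setting =
  fixes B :: "real ^ 'k \<Rightarrow> real" and l h :: "real ^ 'k"
    and g :: "real ^ 'k \<Rightarrow> real ^ 'k" and \<beta> :: "real ^ 'k \<Rightarrow> real ^ 'k \<Rightarrow> real ^ 'k \<Rightarrow> real"
    and w :: "'k \<Rightarrow> real \<times> real" and L :: real
  assumes continuous: "continuous_on UNIV B"
    and taylor: "\<And>p p'. p \<in> cbox l h \<Longrightarrow> p' \<in> cbox l h \<Longrightarrow>
      B p + g p \<bullet> (p' - p) + \<beta> p (p' - p) (p' - p) / 2 - L * norm (p' - p) ^ 3 \<le> B p'"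
    and bilinear: "\<And>p. p \<in> cbox l h \<Longrightarrow> bilinear (\<beta> p)"
    and bounded: "\<And>p d e. p \<in> cbox l h \<Longrightarrow> \<bar>\<beta> p d e\<bar> \<le> L * norm d * norm e"
    and positive: "\<And>p \<alpha>. p \<in> cbox l h \<Longrightarrow>
      0 \<le> \<beta> p (\<chi> i. \<alpha> i * fst (w i)) (\<chi> i. \<alpha> i * fst (w i)) + \<beta> p (\<chi> i. \<alpha> i * snd (w i)) (\<chi> i. \<alpha> i * snd (w i))"
    and unit: "\<And>i. norm (w i) = 1"
    and L_nonneg: "0 \<le> L"
begin

lemma B_measurable [measurable]: "B \<in> borel_measurable borel"
  using continuous by (rule borel_measurable_continuous_onI)

lemma B_bounded: obtains b where "\<And>p. p \<in> cbox l h \<Longrightarrow> \<bar>B p\<bar> \<le> b"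
proof -
  have "bounded (B ` cbox l h)"
    by (intro compact_imp_bounded compact_continuous_image continuous_on_subset[OF continuous]) auto
  then show ?thesis
    using that by (auto simp: bounded_iff)
qed

text \<open>Expanding about the mean point \<open>p\<close> makes the linear term vanish exactly in
  expectation. The displacement is \<open>\<epsilon> *\<^sub>R d z\<close> plus a remainder of order
  \<open>\<epsilon>\<^sup>2\<close>, so the only contribution of order two is the expectation of
  \<open>\<beta> p (d z) (d z)\<close>, nonnegative by \<open>positive\<close>; everything else is
  of order \<open>\<epsilon> ^ 3\<close> times a power of the envelope.\<close>

lemma small_step:
  fixes f f' :: "'k \<Rightarrow> real \<Rightarrow> real" and K :: real
  assumes c11: "\<And>i. c11 K (f i) (f' i)" and f: "\<And>i y. f i y \<in> {l $ i..h $ i}"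
    and \<epsilon>: "0 \<le> \<epsilon>" "\<epsilon> \<le> 1"
  shows "B (\<chi> i. gauss_avg \<epsilon> (f i) (x i))
       - L * (2 * (CARD('k) * K)\<^sup>2 + 8 * (CARD('k) * K) ^ 3) * (\<integral>z. envelope z ^ 3 \<partial>std2) * \<epsilon> ^ 3
    \<le> (\<integral>z. B (\<chi> i. f i (x i + \<epsilon> * (w i \<bullet> z))) \<partial>std2)"
proof -
  define M where "M = CARD('k) * K"
  define p where "p = (\<chi> i. gauss_avg \<epsilon> (f i) (x i))"
  define P where "P z = (\<chi> i. f i (x i + \<epsilon> * (w i \<bullet> z)))" for z
  define d where "d z = (\<chi> i. f' i (x i) * (w i \<bullet> z))" for z
  define r where "r z = P z - p - \<epsilon> *\<^sub>R d z" for z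
  have [measurable]: "f i \<in> borel_measurable borel" for i
    using c11[of i] by (simp add: c11_def)
  have K: "\<bar>f i y\<bar> \<le> K" "\<bar>f' i y\<bar> \<le> K" "\<bar>f i (y + t) - f i y - f' i y * t\<bar> \<le> K * t\<^sup>2" for i y t
    using c11[of i] by (auto simp: c11_def)
  have "0 \<le> K" using K(1)[of undefined undefined] by linarith
  then have "0 \<le> M" by (simp add: M_def)
  have p_box: "p \<in> cbox l h"
    using gauss_avg_in_interval[OF _ f] by (simp add: p_def mem_box_cart)
  have P_box: "P z \<in> cbox l h" for z
    using f by (simp add: P_def mem_box_cart)
  have wz: "\<bar>w i \<bullet> z\<bar> \<le> norm z" for i z
    using Cauchy_Schwarz_ineq2[of "w i" z] by (simp add: unit)
  \<comment> \<open>The mean moves by order \<open>\<epsilon>\<^sup>2\<close> only, because the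
    first-order term is odd in \<open>t\<close> and integrates to zero.\<close>
  have avg: "\<bar>gauss_avg \<epsilon> (f i) (x i) - f i (x i)\<bar> \<le> K * \<epsilon>\<^sup>2" for i
  proof -
    have i1: "integrable std1 (\<lambda>t. f i (x i + \<epsilon> * t))"
      by (rule bounded_integrable[where K=K]) (auto simp: K intro: std1.prob_space_axioms)
    have i2: "integrable std1 (\<lambda>t. f' i (x i) * (\<epsilon> * t))"
      using std1_moment_integrable[of 1] by simp
    have i3: "integrable std1 (\<lambda>t. K * (\<epsilon> * t)\<^sup>2)"
      by (simp add: power_mult_distrib)
    have "gauss_avg \<epsilon> (f i) (x i) - f i (x i) = (\<integral>t. f i (x i + \<epsilon> * t) - f i (x i) - f' i (x i) * (\<epsilon> * t) \<partial>std1)"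
      using i1 i2 std1_mean std1.prob_space by (simp add: gauss_avg_def)
    also have "\<bar>\<dots>\<bar> \<le> (\<integral>t. K * (\<epsilon> * t)\<^sup>2 \<partial>std1)"
    proof (rule integral_abs_bound_integral[OF _ i3])
      show "integrable std1 (\<lambda>t. f i (x i + \<epsilon> * t) - f i (x i) - f' i (x i) * (\<epsilon> * t))"
        using i1 i2 by (intro Bochner_Integration.integrable_diff std1.integrable_const)
    qed (rule K(3))
    also have "\<dots> = K * \<epsilon>\<^sup>2"
      by (simp add: power_mult_distrib std1_variance)
    finally show ?thesis .
  qed
  have norm_d: "norm (d z) \<le> M * envelope z" for z
  proof -
    have "norm (d z) \<le> (\<Sum>i\<in>UNIV. \<bar>d z $ i\<bar>)"
      by (rule norm_le_l1_cart)
    also have "\<dots> \<le> (\<Sum>i\<in>(UNIV::'k set). K * envelope z)"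
      using \<open>0 \<le> K\<close>
      by (intro sum_mono) (auto simp: d_def abs_mult intro!: mult_mono K(2) order_trans[OF wz envelope_ge_norm])
    finally show ?thesis by (simp add: M_def)
  qed
  have norm_r: "norm (r z) \<le> M * \<epsilon>\<^sup>2 * envelope z" for z
  proof -
    have "\<bar>r z $ i\<bar> \<le> K * \<epsilon>\<^sup>2 * envelope z" for i
    proof -
      have "\<bar>r z $ i\<bar> \<le> K * (\<epsilon> * (w i \<bullet> z))\<^sup>2 + K * \<epsilon>\<^sup>2"
        using K(3)[of i "x i" "\<epsilon> * (w i \<bullet> z)"] avg[of i]
        by (simp add: r_def P_def p_def d_def algebra_simps)
      also have "\<dots> = K * \<epsilon>\<^sup>2 * (1 + (w i \<bullet> z)\<^sup>2)"
        by (simp add: power_mult_distrib algebra_simps)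
      also have "\<dots> \<le> K * \<epsilon>\<^sup>2 * envelope z"
        using \<open>0 \<le> K\<close> envelope_ge[of z] power_mono[OF wz[of i z], of 2]
        by (intro mult_left_mono) auto
      finally show ?thesis .
    qed
    then have "norm (r z) \<le> (\<Sum>i\<in>(UNIV::'k set). K * \<epsilon>\<^sup>2 * envelope z)"
      by (intro order_trans[OF norm_le_l1_cart] sum_mono)
    then show ?thesis by (simp add: M_def)
  qed
  have eps2: "\<epsilon>\<^sup>2 \<le> \<epsilon>"
    using \<epsilon> by (simp add: power2_eq_square mult_left_le_one_le)
  have norm_\<Delta>: "norm (P z - p) \<le> 2 * M * \<epsilon> * envelope z" for z
  proof -
    have "P z - p = \<epsilon> *\<^sub>R d z + r z" by (simp add: r_def)
    then have "norm (P z - p) \<le> \<epsilon> * norm (d z) + norm (r z)"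
      using norm_triangle_ineq[of "\<epsilon> *\<^sub>R d z" "r z"] \<epsilon> by simp
    also have "\<dots> \<le> \<epsilon> * (M * envelope z) + M * \<epsilon> * envelope z"
      using norm_d[of z] norm_r[of z] \<epsilon> \<open>0 \<le> M\<close> eps2 envelope_ge_1[of z]
      by (intro add_mono mult_left_mono order_trans[OF norm_r[of z]] mult_right_mono) auto
    finally show ?thesis by simp
  qed
  let ?C = "L * (2 * M\<^sup>2 + 8 * M ^ 3)"
  have bil: "bilinear (\<beta> p)" by (rule bilinear[OF p_box])
  have pointwise: "B p + g p \<bullet> (P z - p) + \<epsilon>\<^sup>2 / 2 * \<beta> p (d z) (d z) - ?C * \<epsilon> ^ 3 * envelope z ^ 3 \<le> B (P z)" for z
  proof -
    let ?s = "envelope z" and ?D = "P z - p"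
    have s: "1 \<le> ?s" by (rule envelope_ge_1)
    have "?D = \<epsilon> *\<^sub>R d z + r z" by (simp add: r_def)
    \<comment> \<open>\<open>r z\<close> is split off in one slot and then in the other, so each
      error term contains it at least once and is of order \<open>\<epsilon> ^ 3\<close>; symmetry
      of \<open>\<beta> p\<close> does not enter.\<close>
    then have "\<beta> p ?D ?D = \<epsilon>\<^sup>2 * \<beta> p (d z) (d z) + \<beta> p (r z) ?D + \<epsilon> * \<beta> p (d z) (r z)"
      using bil by (simp add: bilinear_ladd bilinear_radd bilinear_lmul bilinear_rmul power2_eq_square algebra_simps)
    moreover have "\<bar>\<beta> p (r z) ?D\<bar> \<le> L * (2 * M\<^sup>2 * \<epsilon> ^ 3 * ?s\<^sup>2)"
    proof -
      have "\<bar>\<beta> p (r z) ?D\<bar> \<le> L * (norm (r z) * norm ?D)"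
        using bounded[OF p_box, of "r z" ?D] by (simp add: mult.assoc)
      also have "\<dots> \<le> L * ((M * \<epsilon>\<^sup>2 * ?s) * (2 * M * \<epsilon> * ?s))"
        using norm_r[of z] norm_\<Delta>[of z] L_nonneg \<open>0 \<le> M\<close> \<epsilon> s by (intro mult_left_mono mult_mono) auto
      finally show ?thesis by (simp add: power2_eq_square power3_eq_cube mult_ac)
    qed
    moreover have "\<bar>\<epsilon> * \<beta> p (d z) (r z)\<bar> \<le> L * (M\<^sup>2 * \<epsilon> ^ 3 * ?s\<^sup>2)"
    proof -
      have "\<bar>\<epsilon> * \<beta> p (d z) (r z)\<bar> \<le> \<epsilon> * (L * (norm (d z) * norm (r z)))"
        using bounded[OF p_box, of "d z" "r z"] \<epsilon> by (simp add: mult.assoc abs_mult mult_left_mono)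
      also have "\<dots> \<le> \<epsilon> * (L * ((M * ?s) * (M * \<epsilon>\<^sup>2 * ?s)))"
        using norm_r[of z] norm_d[of z] L_nonneg \<open>0 \<le> M\<close> \<epsilon> s by (intro mult_left_mono mult_mono) auto
      finally show ?thesis by (simp add: power2_eq_square power3_eq_cube mult_ac)
    qed
    moreover have "L * norm ?D ^ 3 \<le> L * (8 * M ^ 3 * \<epsilon> ^ 3 * ?s ^ 3)"
      using power_mono[OF norm_\<Delta>[of z], of 3] L_nonneg by (intro mult_left_mono) (auto simp: power_mult_distrib)
    moreover have "L * (2 * M\<^sup>2 * \<epsilon> ^ 3 * ?s\<^sup>2) \<le> L * (2 * M\<^sup>2 * \<epsilon> ^ 3 * ?s ^ 3)"
      using s \<epsilon> L_nonneg by (intro mult_left_mono power_increasing) auto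
    moreover have "0 \<le> L * (M\<^sup>2 * \<epsilon> ^ 3 * ?s\<^sup>2)"
      using \<epsilon> L_nonneg by simp
    moreover have "L * (2 * M\<^sup>2 * \<epsilon> ^ 3 * ?s\<^sup>2) = 2 * (L * (M\<^sup>2 * \<epsilon> ^ 3 * ?s\<^sup>2))" by simp
    moreover have "?C * \<epsilon> ^ 3 * ?s ^ 3 = L * (2 * M\<^sup>2 * \<epsilon> ^ 3 * ?s ^ 3) + L * (8 * M ^ 3 * \<epsilon> ^ 3 * ?s ^ 3)"
      by (simp add: algebra_simps)
    ultimately show ?thesis
      using taylor[OF p_box P_box, of z] by linarith
  qed
  define d1 where "d1 = (\<chi> i. f' i (x i) * fst (w i))"
  define d2 where "d2 = (\<chi> i. f' i (x i) * snd (w i))"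
  \<comment> \<open>The mixed moment is zero and the second moments are one, so the expectation is
    the sum over the two axis directions that occurs in \<open>positive\<close>.\<close>
  have quad: "\<beta> p (d z) (d z) = \<beta> p d1 d1 * (fst z)\<^sup>2 + (\<beta> p d1 d2 + \<beta> p d2 d1) * (fst z * snd z) + \<beta> p d2 d2 * (snd z)\<^sup>2" for z
  proof -
    have "d z = fst z *\<^sub>R d1 + snd z *\<^sub>R d2"
      by (cases z) (auto simp: d_def d1_def d2_def vec_eq_iff inner_prod_def algebra_simps)
    then show ?thesis
      using bil by (simp add: bilinear_ladd bilinear_radd bilinear_lmul bilinear_rmul power2_eq_square algebra_simps)
  qed
  have quad_int: "integrable std2 (\<lambda>z. \<beta> p (d z) (d z))"
    unfolding quad using std2_moments by (intro Bochner_Integration.integrable_add integrable_mult_right) auto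
  have quad_pos: "0 \<le> (\<integral>z. \<beta> p (d z) (d z) \<partial>std2)"
    unfolding quad using std2_moments positive[OF p_box, of "\<lambda>i. f' i (x i)"] by (simp add: d1_def d2_def)
  have f_int: "integrable std2 (\<lambda>z. f i (x i + \<epsilon> * (w i \<bullet> z)))" for i
    by (rule bounded_integrable[where K=K]) (auto simp: K intro: std2.prob_space_axioms)
  have lin: "g p \<bullet> (P z - p) = (\<Sum>i\<in>UNIV. g p $ i * (f i (x i + \<epsilon> * (w i \<bullet> z)) - p $ i))" for z
    by (simp add: inner_vec_def P_def)
  have lin_int: "integrable std2 (\<lambda>z. g p \<bullet> (P z - p))"
    unfolding lin using f_int by auto
  have lin_0: "(\<integral>z. g p \<bullet> (P z - p) \<partial>std2) = 0"
    unfolding lin using f_int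
    by (simp add: Bochner_Integration.integral_sum p_def expectation_inner_std2 unit std2.prob_space[simplified])
  have BP_int: "integrable std2 (\<lambda>z. B (P z))"
  proof -
    obtain b where "\<And>p. p \<in> cbox l h \<Longrightarrow> \<bar>B p\<bar> \<le> b"
      using B_bounded by blast
    then show ?thesis
      using P_box by (intro bounded_integrable[where K=b] std2.prob_space_axioms) (auto simp: P_def)
  qed
  have comb: "integrable std2 (\<lambda>z. c + X z + s * Y z - t * Z z)"
      "(\<integral>z. c + X z + s * Y z - t * Z z \<partial>std2) = c + integral\<^sup>L std2 X + s * integral\<^sup>L std2 Y - t * integral\<^sup>L std2 Z"
    if "integrable std2 X" "integrable std2 Y" "integrable std2 Z" for c s t and X Y Z :: "real \<times> real \<Rightarrow> real"
    using that by (simp_all add: std2.prob_space[simplified])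
  have "B p + \<epsilon>\<^sup>2 / 2 * (\<integral>z. \<beta> p (d z) (d z) \<partial>std2) - ?C * \<epsilon> ^ 3 * (\<integral>z. envelope z ^ 3 \<partial>std2)
      = (\<integral>z. B p + g p \<bullet> (P z - p) + \<epsilon>\<^sup>2 / 2 * \<beta> p (d z) (d z) - ?C * \<epsilon> ^ 3 * envelope z ^ 3 \<partial>std2)"
    unfolding comb(2)[OF lin_int quad_int integrable_envelope_cube] lin_0 by simp
  also have "\<dots> \<le> (\<integral>z. B (P z) \<partial>std2)"
    by (rule integral_mono[OF comb(1)[OF lin_int quad_int integrable_envelope_cube] BP_int pointwise])
  finally have "B p - ?C * \<epsilon> ^ 3 * (\<integral>z. envelope z ^ 3 \<partial>std2) \<le> (\<integral>z. B (P z) \<partial>std2)"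
    using mult_nonneg_nonneg[OF _ quad_pos, of "\<epsilon>\<^sup>2 / 2"] by simp
  then show ?thesis
    by (simp add: P_def p_def M_def mult_ac)
qed

lemma B_integrable:
  assumes "prob_space M" "F \<in> borel_measurable M" "\<And>x. F x \<in> cbox l h"
  shows "integrable M (\<lambda>x. B (F x))"
proof -
  obtain b where "\<And>p. p \<in> cbox l h \<Longrightarrow> \<bar>B p\<bar> \<le> b"
    using B_bounded by blast
  then show ?thesis
    using assms by (intro bounded_integrable[where K=b]) auto
qed

text \<open>The averaged functions \<open>gauss_avg \<epsilon> (f i)\<close> keep the constant
  \<open>K\<close> and the box, so the induction hypothesis applied to them covers \<open>n\<close>
  of the steps; the remaining one is \<open>small_step\<close> at the random base point reached by
  these. The two increments merge by \<open>std2_convolution\<close>, and the errors add.\<close>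

lemma many_steps:
  fixes f f' :: "'k \<Rightarrow> real \<Rightarrow> real" and K C :: real and n :: nat
  assumes "\<And>i. c11 K (f i) (f' i)" and "\<And>i y. f i y \<in> {l $ i..h $ i}"
    and \<epsilon>: "0 \<le> \<epsilon>" "\<epsilon> \<le> 1"
  defines "C \<equiv> L * (2 * (CARD('k) * K)\<^sup>2 + 8 * (CARD('k) * K) ^ 3) * (\<integral>z. envelope z ^ 3 \<partial>std2)"
  shows "B (\<chi> i. gauss_avg (sqrt n * \<epsilon>) (f i) (x i)) - n * (C * \<epsilon> ^ 3)
    \<le> (\<integral>z. B (\<chi> i. f i (x i + sqrt n * \<epsilon> * (w i \<bullet> z))) \<partial>std2)"
  using assms(1,2)
proof (induction n arbitrary: f f')
  case 0
  then show ?case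
    by (simp add: gauss_avg_def std1.prob_space[simplified] std2.prob_space[simplified])
next
  case (Suc n)
  let ?r = "sqrt n * \<epsilon>" and ?q = "sqrt (Suc n) * \<epsilon>"
  have [measurable]: "f i \<in> borel_measurable borel" for i
    using Suc.prems(1)[of i] by (simp add: c11_def)
  have q: "sqrt (?r\<^sup>2 + \<epsilon>\<^sup>2) = ?q"
    using \<epsilon> by (intro real_sqrt_unique) (auto simp: power_mult_distrib algebra_simps)
  let ?\<Phi> = "\<lambda>z. B (\<chi> i. f i (x i + w i \<bullet> z))"
  obtain b where b: "\<And>p. p \<in> cbox l h \<Longrightarrow> \<bar>B p\<bar> \<le> b"
    using B_bounded by blast
  have avg_box: "gauss_avg \<epsilon> (f i) y \<in> {l $ i..h $ i}" for i y
    using Suc.prems by (intro gauss_avg_in_interval) auto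
  have ip: "x i + ?r * (w i \<bullet> z') + \<epsilon> * (w i \<bullet> z) = x i + w i \<bullet> (?r *\<^sub>R z' + \<epsilon> *\<^sub>R z)" for i z z'
    by (simp add: inner_add_right)
  have b\<Phi>: "\<bar>?\<Phi> z\<bar> \<le> b" for z
    using Suc.prems(2) by (intro b) (simp add: mem_box_cart)
  have meas: "(\<lambda>z'. \<integral>z. ?\<Phi> (?r *\<^sub>R z' + \<epsilon> *\<^sub>R z) \<partial>std2) \<in> borel_measurable std2"
    by measurable
  have "B (\<chi> i. gauss_avg ?q (f i) (x i)) - Suc n * (C * \<epsilon> ^ 3)
      = B (\<chi> i. gauss_avg ?r (gauss_avg \<epsilon> (f i)) (x i)) - n * (C * \<epsilon> ^ 3) - C * \<epsilon> ^ 3"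
  proof -
    have "gauss_avg ?r (gauss_avg \<epsilon> (f i)) (x i) = gauss_avg ?q (f i) (x i)" for i
      using Suc.prems(1)[of i] unfolding q[symmetric] by (intro gauss_avg_gauss_avg[where K=K]) (auto simp: c11_def)
    then show ?thesis by (simp add: algebra_simps)
  qed
  also have "\<dots> \<le> (\<integral>z'. B (\<chi> i. gauss_avg \<epsilon> (f i) (x i + ?r * (w i \<bullet> z'))) \<partial>std2) - C * \<epsilon> ^ 3"
    using Suc.IH[OF c11_gauss_avg[OF Suc.prems(1)] avg_box] by simp
  also have "\<dots> = (\<integral>z'. B (\<chi> i. gauss_avg \<epsilon> (f i) (x i + ?r * (w i \<bullet> z'))) - C * \<epsilon> ^ 3 \<partial>std2)"
    using avg_box
    by (subst Bochner_Integration.integral_diff)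
      (auto intro!: B_integrable std2.prob_space_axioms simp: mem_box_cart std2.prob_space[simplified])
  also have "\<dots> \<le> (\<integral>z'. \<integral>z. ?\<Phi> (?r *\<^sub>R z' + \<epsilon> *\<^sub>R z) \<partial>std2 \<partial>std2)"
  proof (rule integral_mono)
    show "integrable std2 (\<lambda>z'. B (\<chi> i. gauss_avg \<epsilon> (f i) (x i + ?r * (w i \<bullet> z'))) - C * \<epsilon> ^ 3)"
      using avg_box
      by (intro Bochner_Integration.integrable_diff B_integrable std2.prob_space_axioms) (auto simp: mem_box_cart)
    show "integrable std2 (\<lambda>z'. \<integral>z. ?\<Phi> (?r *\<^sub>R z' + \<epsilon> *\<^sub>R z) \<partial>std2)"
      using b\<Phi> meas by (intro bounded_integrable[where K=b] std2.prob_space_axioms)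
        (auto intro!: bounded_expectation std2.prob_space_axioms)
    show "B (\<chi> i. gauss_avg \<epsilon> (f i) (x i + ?r * (w i \<bullet> z'))) - C * \<epsilon> ^ 3
        \<le> (\<integral>z. ?\<Phi> (?r *\<^sub>R z' + \<epsilon> *\<^sub>R z) \<partial>std2)" for z'
      using small_step[OF Suc.prems \<epsilon>, of "\<lambda>i. x i + ?r * (w i \<bullet> z')"]
      unfolding C_def ip by (simp add: mult.assoc)
  qed
  also have "\<dots> = (\<integral>z. ?\<Phi> (?q *\<^sub>R z) \<partial>std2)"
    unfolding q[symmetric] by (rule std2_convolution[OF _ b\<Phi>]) measurable
  finally show ?case
    by simp
qed

lemma jensen_c11:
  fixes f f' :: "'k \<Rightarrow> real \<Rightarrow> real" and K :: real
  assumes "\<And>i. c11 K (f i) (f' i)" and "\<And>i y. f i y \<in> {l $ i..h $ i}"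
  shows "B (\<chi> i. \<integral>t. f i t \<partial>std1) \<le> (\<integral>z. B (\<chi> i. f i (w i \<bullet> z)) \<partial>std2)"
proof -
  obtain C where C: "\<And>(n::nat) \<epsilon>. 0 \<le> \<epsilon> \<Longrightarrow> \<epsilon> \<le> 1 \<Longrightarrow>
      B (\<chi> i. gauss_avg (sqrt n * \<epsilon>) (f i) 0) - n * (C * \<epsilon> ^ 3)
    \<le> (\<integral>z. B (\<chi> i. f i (sqrt n * \<epsilon> * (w i \<bullet> z))) \<partial>std2)"
    using many_steps[OF assms, of _ _ "\<lambda>_. 0"] by auto
  \<comment> \<open>With \<open>\<epsilon> = 1 / sqrt n\<close> the averages at 0 are full
    expectations, while \<open>n\<close> errors of size \<open>C * \<epsilon> ^ 3\<close> add up to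
    \<open>C / sqrt n\<close>.\<close>
  have *: "B (\<chi> i. \<integral>t. f i t \<partial>std1) - C / sqrt n \<le> (\<integral>z. B (\<chi> i. f i (w i \<bullet> z)) \<partial>std2)" if "1 \<le> n" for n :: nat
  proof -
    have "sqrt n * sqrt n = n" by simp
    then have "n * (C * (1 / sqrt n) ^ 3) = C / sqrt n"
      using that by (simp add: power3_eq_cube divide_simps)
    then show ?thesis
      using C[of "1 / sqrt n" n] that by (simp add: gauss_avg_def)
  qed
  have "(\<lambda>n. B (\<chi> i. \<integral>t. f i t \<partial>std1) - C / sqrt (real n)) \<longlonglongrightarrow> B (\<chi> i. \<integral>t. f i t \<partial>std1) - 0"
    by (intro tendsto_diff tendsto_const real_tendsto_divide_at_top[OF tendsto_const]
        filterlim_compose[OF sqrt_at_top filterlim_real_sequentially])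
  then show ?thesis
    using * by (intro tendsto_upperbound[of _ "B (\<chi> i. \<integral>t. f i t \<partial>std1)"]) (auto intro!: eventually_sequentiallyI[of 1])
qed

end

section \<open>Removing the regularity of the functions\<close>

lemma continuous_antiderivative:
  fixes f :: "real \<Rightarrow> real"
  assumes "continuous_on UNIV f"
  obtains F where "\<And>x. (F has_real_derivative f x) (at x)"
  using einterval_antiderivative[of "-\<infinity>" "\<infinity>" f] assms
  by (auto simp: has_real_derivative_iff_has_vector_derivative continuous_on_eq_continuous_at)

text \<open>Averaging twice over a window of length \<open>\<delta>\<close> gains two derivatives.\<close>

lemma continuous_c11_approx:
  fixes f :: "real \<Rightarrow> real"
  assumes cont: "continuous_on UNIV f" and M: "\<And>x. \<bar>f x\<bar> \<le> M" and \<delta>: "0 < \<delta>"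
  obtains F F' K where "c11 K F F'" "\<And>x. \<exists>\<xi>\<in>{x..x + 2 * \<delta>}. F x = f \<xi>"
proof -
  obtain \<phi> where \<phi>: "\<And>x. (\<phi> has_real_derivative f x) (at x)"
    using continuous_antiderivative[OF cont] by blast
  have "continuous_on UNIV \<phi>"
    using \<phi> by (meson DERIV_isCont continuous_at_imp_continuous_on)
  then obtain \<Phi> where \<Phi>: "\<And>x. (\<Phi> has_real_derivative \<phi> x) (at x)"
    using continuous_antiderivative by blast
  define F where "F x = (\<Phi> (x + 2 * \<delta>) - 2 * \<Phi> (x + \<delta>) + \<Phi> x) / \<delta>\<^sup>2" for x
  define F' where "F' x = (\<phi> (x + 2 * \<delta>) - 2 * \<phi> (x + \<delta>) + \<phi> x) / \<delta>\<^sup>2" for x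
  define F'' where "F'' x = (f (x + 2 * \<delta>) - 2 * f (x + \<delta>) + f x) / \<delta>\<^sup>2" for x
  have shift: "((\<lambda>x. G (x + c)) has_real_derivative G' (x + c)) (at x)"
    if "\<And>x. (G has_real_derivative G' x) (at x)" for G G' :: "real \<Rightarrow> real" and c x
    using that[of "x + c"] by (simp add: DERIV_shift)
  have F: "(F has_real_derivative F' x) (at x)" for x
    unfolding F_def[abs_def] F'_def by (intro DERIV_cdivide DERIV_add DERIV_diff DERIV_cmult shift \<Phi>)
  have F': "(F' has_real_derivative F'' x) (at x)" for x
    unfolding F'_def[abs_def] F''_def by (intro DERIV_cdivide DERIV_add DERIV_diff DERIV_cmult shift \<phi>)
  have mvt\<phi>: "\<exists>\<xi>\<in>{x..x + \<delta>}. \<phi> (x + \<delta>) - \<phi> x = \<delta> * f \<xi>" for x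
    using MVT2[of x "x + \<delta>" \<phi> f] \<phi> \<delta> by fastforce
  \<comment> \<open>\<open>F\<close> is a second difference of \<open>\<Phi>\<close>, so the mean
    value theorem, used once for \<open>\<Phi>\<close> and once for \<open>\<phi>\<close>, gives a
    value of \<open>f\<close>. This keeps \<open>F\<close> in any interval that contains the range
    of \<open>f\<close>.\<close>
  have val: "\<exists>\<xi>\<in>{x..x + 2 * \<delta>}. F x = f \<xi>" for x
  proof -
    have "((\<lambda>t. \<Phi> (t + \<delta>) - \<Phi> t) has_real_derivative \<phi> (t + \<delta>) - \<phi> t) (at t)" for t
      by (intro derivative_intros shift \<Phi>)
    then obtain \<xi> where \<xi>: "x < \<xi>" "\<xi> < x + \<delta>"
      "\<Phi> (x + \<delta> + \<delta>) - \<Phi> (x + \<delta>) - (\<Phi> (x + \<delta>) - \<Phi> x) = \<delta> * (\<phi> (\<xi> + \<delta>) - \<phi> \<xi>)"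
      using MVT2[of x "x + \<delta>" "\<lambda>t. \<Phi> (t + \<delta>) - \<Phi> t" "\<lambda>t. \<phi> (t + \<delta>) - \<phi> t"] \<delta> by auto
    obtain \<eta> where \<eta>: "\<eta> \<in> {\<xi>..\<xi> + \<delta>}" "\<phi> (\<xi> + \<delta>) - \<phi> \<xi> = \<delta> * f \<eta>"
      using mvt\<phi> by blast
    have "x + 2 * \<delta> = x + \<delta> + \<delta>" by simp
    then have "F x * \<delta>\<^sup>2 = \<delta> * (\<phi> (\<xi> + \<delta>) - \<phi> \<xi>)"
      using \<xi>(3) \<delta> unfolding F_def by (simp only:) simp
    then have "F x = f \<eta>"
      using \<eta>(2) \<delta> by (simp add: power2_eq_square)
    then show ?thesis
      using \<xi> \<eta>(1) by (intro bexI[of _ \<eta>]) auto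
  qed
  have bF: "\<bar>F x\<bar> \<le> M" for x
    using val[of x] M by auto
  have bF': "\<bar>F' x\<bar> \<le> 2 * M / \<delta>" for x
  proof -
    obtain \<xi> \<eta> where "\<phi> (x + \<delta>) - \<phi> x = \<delta> * f \<xi>" "\<phi> (x + \<delta> + \<delta>) - \<phi> (x + \<delta>) = \<delta> * f \<eta>"
      using mvt\<phi>[of x] mvt\<phi>[of "x + \<delta>"] by blast
    moreover have "x + 2 * \<delta> = x + \<delta> + \<delta>" by simp
    ultimately have "F' x = (\<delta> * f \<eta> - \<delta> * f \<xi>) / \<delta>\<^sup>2"
      unfolding F'_def by (simp only:) simp
    also have "\<dots> = (f \<eta> - f \<xi>) / \<delta>"
      using \<delta> by (simp add: power2_eq_square field_simps)
    finally show ?thesis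
      using M[of \<eta>] M[of \<xi>] \<delta> by (simp add: abs_divide divide_right_mono)
  qed
  have bF'': "\<bar>F'' x\<bar> \<le> 4 * M / \<delta>\<^sup>2" for x
    using M[of x] M[of "x + \<delta>"] M[of "x + 2 * \<delta>"] \<delta> unfolding F''_def by (simp add: abs_divide divide_right_mono)
  define K where "K = Max {M, 2 * M / \<delta>, 4 * M / \<delta>\<^sup>2}"
  have K: "M \<le> K" "2 * M / \<delta> \<le> K" "4 * M / \<delta>\<^sup>2 \<le> K"
    by (simp_all add: K_def)
  have taylor: "\<bar>F (x + h) - F x - F' x * h\<bar> \<le> K * h\<^sup>2" for x h
  proof -
    let ?D = "\<lambda>i::nat. if i = 0 then F else if i = 1 then F' else F''"
    have "norm (?D 0 (x + h) - (\<Sum>i\<le>1. ?D i x * (x + h - x) ^ i / fact i)) \<le> K * norm (x + h - x) ^ Suc 1 / fact 1"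
      using F F' order_trans[OF bF'' K(3)]
      by (intro field_Taylor[where S = UNIV]) (auto simp: le_Suc_eq)
    then show ?thesis
      by (simp add: algebra_simps power2_eq_square)
  qed
  have meas: "G \<in> borel_measurable borel" if "\<And>x. (G has_real_derivative G' x) (at x)" for G G' :: "real \<Rightarrow> real"
    using that by (intro borel_measurable_continuous_onI) (meson DERIV_isCont continuous_at_imp_continuous_on)
  have "c11 K F F'"
    unfolding c11_def using meas[OF F] meas[OF F'] order_trans[OF bF K(1)] order_trans[OF bF' K(2)] taylor by blast
  then show thesis
    using val that by blast
qed

text \<open>A Lebesgue measurable function is a limit of continuous ones off a negligible set, which
  is null for \<open>std1\<close> too because \<open>std1\<close> has a density. Truncation at
  \<open>l\<close> and \<open>h\<close> forces the approximants into the range and leaves the limit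
  unchanged.\<close>

lemma borel_AE_continuous_approx:
  fixes f :: "real \<Rightarrow> real"
  assumes "f \<in> borel_measurable borel" "\<And>x. f x \<in> {l..h}"
  obtains G where "\<And>n. continuous_on UNIV (G n)" "\<And>n x. G n x \<in> {l..h}" "AE x in std1. (\<lambda>n. G n x) \<longlonglongrightarrow> f x"
proof -
  have lh: "l \<le> h" using assms(2)[of 0] by simp
  have "f measurable_on UNIV"
    using assms(1) by (intro lebesgue_measurable_imp_measurable_on measurable_completion) auto
  then obtain N G where N: "negligible N" and G: "\<And>n. continuous_on UNIV (G n)"
    and lim: "\<And>x. x \<notin> N \<Longrightarrow> (\<lambda>n. G n x) \<longlonglongrightarrow> f x"
    unfolding measurable_on_def by fastforce
  have "AE x in lebesgue. (\<lambda>n. G n x) \<longlonglongrightarrow> f x"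
    using N lim by (intro AE_I'[of N]) (auto simp: negligible_iff_null_sets)
  then have ae: "AE x in std1. (\<lambda>n. G n x) \<longlonglongrightarrow> f x"
    by (auto simp: AE_completion_iff AE_density)
  define G' where "G' n x = max l (min h (G n x))" for n x
  show thesis
  proof
    show "continuous_on UNIV (G' n)" for n
      unfolding G'_def[abs_def] by (intro continuous_intros G)
    show "G' n x \<in> {l..h}" for n x
      using lh by (auto simp: G'_def)
    show "AE x in std1. (\<lambda>n. G' n x) \<longlonglongrightarrow> f x"
      using ae
    proof eventually_elim
      case (elim x)
      then have "(\<lambda>n. G' n x) \<longlonglongrightarrow> max l (min h (f x))"
        unfolding G'_def by (intro tendsto_intros)
      then show ?case
        using assms(2)[of x] by (simp add: max_absorb2 min_absorb2)
    qed
  qed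
qed

context jensen_setting
begin

text \<open>Both sides converge by dominated convergence, since all values stay in the box, where
  \<open>B\<close> is bounded. Almost everywhere convergence passes from the line to the plane
  because \<open>w i \<bullet> z\<close> has law \<open>std1\<close>.\<close>

lemma jensen_limit:
  fixes f :: "'k \<Rightarrow> real \<Rightarrow> real"
  assumes [measurable]: "\<And>n i. F n i \<in> borel_measurable borel" "\<And>i. f i \<in> borel_measurable borel"
    and F: "\<And>n i y. F n i y \<in> {l $ i..h $ i}"
    and lim: "\<And>i. AE t in std1. (\<lambda>n. F n i t) \<longlonglongrightarrow> f i t"
    and J: "\<And>n. B (\<chi> i. \<integral>t. F n i t \<partial>std1) \<le> (\<integral>z. B (\<chi> i. F n i (w i \<bullet> z)) \<partial>std2)"
  shows "B (\<chi> i. \<integral>t. f i t \<partial>std1) \<le> (\<integral>z. B (\<chi> i. f i (w i \<bullet> z)) \<partial>std2)"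
proof (rule LIMSEQ_le)
  have cont: "isCont B p" for p
    using continuous by (simp add: continuous_on_eq_continuous_at)
  have "(\<lambda>n. \<integral>t. F n i t \<partial>std1) \<longlonglongrightarrow> (\<integral>t. f i t \<partial>std1)" for i
  proof (rule integral_dominated_convergence[where w = "\<lambda>_. \<bar>l $ i\<bar> + \<bar>h $ i\<bar>"])
    have "\<bar>F n i t\<bar> \<le> \<bar>l $ i\<bar> + \<bar>h $ i\<bar>" for n t
      using F[of n i t] by auto
    then show "AE t in std1. norm (F n i t) \<le> \<bar>l $ i\<bar> + \<bar>h $ i\<bar>" for n
      by simp
  qed (use lim in auto)
  then show "(\<lambda>n. B (\<chi> i. \<integral>t. F n i t \<partial>std1)) \<longlonglongrightarrow> B (\<chi> i. \<integral>t. f i t \<partial>std1)"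
    by (intro isCont_tendsto_compose[OF cont] vec_tendstoI) simp
  have d: "distr std2 borel (\<lambda>z. w i \<bullet> z) = std1" for i
    using distr_id2[of borel std1] unfolding distr_inner_std2 unit mult_1 by simp
  have "AE z in std2. (\<lambda>n. F n i (w i \<bullet> z)) \<longlonglongrightarrow> f i (w i \<bullet> z)" for i
    using lim[of i] unfolding d[symmetric, of i] by (rule AE_distrD[rotated]) simp
  then have "AE z in std2. \<forall>i\<in>UNIV. (\<lambda>n. F n i (w i \<bullet> z)) \<longlonglongrightarrow> f i (w i \<bullet> z)"
    by (intro AE_finite_allI) auto
  then have ae: "AE z in std2. (\<lambda>n. B (\<chi> i. F n i (w i \<bullet> z))) \<longlonglongrightarrow> B (\<chi> i. f i (w i \<bullet> z))"
    by eventually_elim (simp, intro isCont_tendsto_compose[OF cont] vec_tendstoI, simp)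
  obtain b where b: "\<And>p. p \<in> cbox l h \<Longrightarrow> \<bar>B p\<bar> \<le> b"
    using B_bounded by blast
  show "(\<lambda>n. \<integral>z. B (\<chi> i. F n i (w i \<bullet> z)) \<partial>std2) \<longlonglongrightarrow> (\<integral>z. B (\<chi> i. f i (w i \<bullet> z)) \<partial>std2)"
  proof (rule integral_dominated_convergence[where w = "\<lambda>_. b"])
    have "\<bar>B (\<chi> i. F n i (w i \<bullet> z))\<bar> \<le> b" for n z
      using F by (intro b) (simp add: mem_box_cart)
    then show "AE z in std2. norm (B (\<chi> i. F n i (w i \<bullet> z))) \<le> b" for n
      by simp
  qed (use ae in auto)
qed (use J in auto)

text \<open>The regularised functions take values of \<open>f i\<close> at nearby points: they stay
  in the box, and continuity gives pointwise convergence.\<close>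

lemma jensen_continuous:
  fixes f :: "'k \<Rightarrow> real \<Rightarrow> real"
  assumes cont: "\<And>i. continuous_on UNIV (f i)" and f: "\<And>i y. f i y \<in> {l $ i..h $ i}"
  shows "B (\<chi> i. \<integral>t. f i t \<partial>std1) \<le> (\<integral>z. B (\<chi> i. f i (w i \<bullet> z)) \<partial>std2)"
proof -
  have "\<exists>F. (\<exists>F' K. c11 K F F') \<and> (\<forall>x. \<exists>\<xi>\<in>{x..x + 2 * (1 / Suc n)}. F x = f i \<xi>)" for n i
  proof -
    have "\<bar>f i x\<bar> \<le> \<bar>l $ i\<bar> + \<bar>h $ i\<bar>" for x
      using f[of i x] by auto
    from continuous_c11_approx[OF cont this, of "1 / Suc n"] show ?thesis
      by (metis of_nat_0_less_iff zero_less_Suc zero_less_divide_1_iff)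
  qed
  then obtain F where c11: "\<And>n i. \<exists>F' K. c11 K (F n i) F'"
    and val: "\<And>n i x. \<exists>\<xi>\<in>{x..x + 2 * (1 / Suc n)}. F n i x = f i \<xi>"
    by metis
  have F_box: "F n i x \<in> {l $ i..h $ i}" for n i x
    using val[of x n i] f by auto
  have lim: "(\<lambda>n. F n i x) \<longlonglongrightarrow> f i x" for i x
  proof -
    obtain \<xi> where \<xi>: "\<And>n. \<xi> n \<in> {x..x + 2 * (1 / Suc n)}" "\<And>n. F n i x = f i (\<xi> n)"
      using val[of x _ i] by metis
    have "(\<lambda>n. x + 2 * (1 / Suc n)) \<longlonglongrightarrow> x + 2 * 0"
      by (intro tendsto_intros LIMSEQ_Suc lim_1_over_n)
    then have "\<xi> \<longlonglongrightarrow> x"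
      using \<xi>(1) by (intro tendsto_sandwich[of "\<lambda>_. x" \<xi> sequentially "\<lambda>n. x + 2 * (1 / Suc n)"]) auto
    then show ?thesis
      using cont[of i] unfolding \<xi>(2)
      by (intro isCont_tendsto_compose[of x "f i" \<xi>]) (auto simp: continuous_on_eq_continuous_at)
  qed
  show ?thesis
  proof (rule jensen_limit[where F=F])
    show "F n i \<in> borel_measurable borel" for n i
      using c11[of n i] by (auto simp: c11_def)
    show "f i \<in> borel_measurable borel" for i
      using cont by (rule borel_measurable_continuous_onI)
    show "B (\<chi> i. \<integral>t. F n i t \<partial>std1) \<le> (\<integral>z. B (\<chi> i. F n i (w i \<bullet> z)) \<partial>std2)" for n
    proof -
      obtain F' K where FK: "\<And>i. c11 (K i) (F n i) (F' i)"
        using c11[of n] by metis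
      \<comment> \<open>There are finitely many indices, so the largest of their constants serves
        all of them.\<close>
      have "c11 (Max (range K)) (F n i) (F' i)" for i
      proof -
        have *: "K i \<le> Max (range K)" by simp
        then have "K i * t\<^sup>2 \<le> Max (range K) * t\<^sup>2" for t
          by (intro mult_right_mono) auto
        then show ?thesis
          using FK[of i] order_trans[OF _ *] order_trans[of _ "K i * _"] unfolding c11_def by blast
      qed
      then show ?thesis
        using F_box by (rule jensen_c11)
    qed
  qed (use lim F_box in auto)
qed

lemma jensen_measurable:
  fixes f :: "'k \<Rightarrow> real \<Rightarrow> real"
  assumes meas: "\<And>i. f i \<in> borel_measurable borel" and f: "\<And>i y. f i y \<in> {l $ i..h $ i}"
  shows "B (\<chi> i. \<integral>t. f i t \<partial>std1) \<le> (\<integral>z. B (\<chi> i. f i (w i \<bullet> z)) \<partial>std2)"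
proof -
  have "\<exists>G. (\<forall>n. continuous_on UNIV (G n)) \<and> (\<forall>n x. G n x \<in> {l $ i..h $ i}) \<and> (AE x in std1. (\<lambda>n. G n x) \<longlonglongrightarrow> f i x)" for i
    by (rule borel_AE_continuous_approx[OF meas[of i] f]) blast
  then obtain G where G: "\<And>i n. continuous_on UNIV (G i n)" "\<And>i n x. G i n x \<in> {l $ i..h $ i}"
    "\<And>i. AE x in std1. (\<lambda>n. G i n x) \<longlonglongrightarrow> f i x"
    by metis
  show ?thesis
  proof (rule jensen_limit[where F = "\<lambda>n i. G i n"])
    show "G i n \<in> borel_measurable borel" for n i
      using G(1) by (rule borel_measurable_continuous_onI)
    show "B (\<chi> i. \<integral>t. G i n t \<partial>std1) \<le> (\<integral>z. B (\<chi> i. G i n (w i \<bullet> z)) \<partial>std2)" for n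
      using G(1,2) by (rule jensen_continuous)
  qed (rule meas G)+
qed

end

section \<open>Products of Gaussian measures\<close>

abbreviation stdP :: "nat set \<Rightarrow> (nat \<Rightarrow> real) measure" where
  "stdP A \<equiv> \<Pi>\<^sub>M j\<in>A. std1"

interpretation stdP: product_sigma_finite "\<lambda>_::nat. std1" ..

lemma prob_space_stdP: "prob_space (stdP A)"
  by (intro prob_space_PiM std1.prob_space_axioms)

lemma stdP_Fubini:
  fixes F :: "_ \<Rightarrow> _ \<Rightarrow> real"
  assumes "prob_space M" "prob_space N" "case_prod F \<in> borel_measurable (M \<Otimes>\<^sub>M N)" "\<And>x y. \<bar>F x y\<bar> \<le> b"
  shows "(\<integral>x. \<integral>y. F x y \<partial>N \<partial>M) = (\<integral>y. \<integral>x. F x y \<partial>M \<partial>N)"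
proof -
  interpret M: prob_space M by fact
  interpret N: prob_space N by fact
  interpret MN: pair_prob_space M N ..
  show ?thesis
    using assms by (intro MN.Fubini_integral[symmetric] bounded_integrable[where K=b] MN.prob_space_axioms) auto
qed

lemma measurable_fst_snd_std2 [measurable]:
  "fst \<in> borel_measurable std2" "snd \<in> borel_measurable std2"
  using measurable_fst[of std1 std1] measurable_snd[of std1 std1] by (simp_all add: std2_def)

text \<open>The vector version of \<open>u \<bullet> (s, t)\<close>; restricting to \<open>A\<close>
  makes the result a point of \<open>stdP A\<close>.\<close>

definition lin_comb :: "nat set \<Rightarrow> real \<times> real \<Rightarrow> (nat \<Rightarrow> real) \<Rightarrow> (nat \<Rightarrow> real) \<Rightarrow> nat \<Rightarrow> real" where
  "lin_comb A u x y = (\<lambda>j\<in>A. fst u * x j + snd u * y j)"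

lemma lin_comb_fun_upd:
  assumes "a \<notin> A"
  shows "lin_comb (insert a A) u (x(a := s)) (y(a := t)) = (lin_comb A u x y)(a := u \<bullet> (s, t))"
  using assms by (auto simp: lin_comb_def fun_eq_iff inner_prod_def restrict_def)

lemma lin_comb_space [simp]: "lin_comb A u x y \<in> space (stdP A)"
  by (simp add: lin_comb_def space_PiM)

lemma fun_upd_space: "v \<in> space (stdP A) \<Longrightarrow> v(a := t) \<in> space (stdP (insert a A))"
  by (simp add: space_PiM PiE_fun_upd)

lemma measurable_lin_comb [measurable (raw)]:
  assumes [measurable]: "X \<in> measurable M (stdP A)" "Y \<in> measurable M (stdP A)"
  shows "(\<lambda>\<omega>. lin_comb A u (X \<omega>) (Y \<omega>)) \<in> measurable M (stdP A)"
proof -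
  have [measurable]: "(\<lambda>\<omega>. X \<omega> j) \<in> borel_measurable M" "(\<lambda>\<omega>. Y \<omega> j) \<in> borel_measurable M" if "j \<in> A" for j
    using measurable_component_singleton'[OF assms(1) measurable_ident that]
      measurable_component_singleton'[OF assms(2) measurable_ident that] by simp_all
  show ?thesis
    unfolding lin_comb_def by (intro measurable_restrict) simp
qed

context jensen_setting
begin

text \<open>Tensorisation. With the coordinates in \<open>A\<close> frozen, the one-dimensional
  inequality applies to the sections in the new coordinate; the functions \<open>f'\<close> averaged
  over that coordinate stay in the same box, so the induction hypothesis applies to them with the
  same \<open>B\<close>. Nothing is lost in the step, hence no constant depends on the
  dimension.\<close>

theorem jensen_stdP:
  fixes f :: "'k \<Rightarrow> (nat \<Rightarrow> real) \<Rightarrow> real"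
  assumes "finite A" and "\<And>i. f i \<in> borel_measurable (stdP A)"
    and "\<And>i x. x \<in> space (stdP A) \<Longrightarrow> f i x \<in> {l $ i..h $ i}"
  shows "B (\<chi> i. \<integral>x. f i x \<partial>stdP A) \<le> (\<integral>x. \<integral>y. B (\<chi> i. f i (lin_comb A (w i) x y)) \<partial>stdP A \<partial>stdP A)"
  using assms
proof (induction A arbitrary: f)
  case empty
  \<comment> \<open>The empty product is the unit mass at the function with constant value
    \<open>undefined\<close>, and both sides coincide.\<close>
  have "lin_comb {} u x y = (\<lambda>_. undefined)" for u x y
    by (simp add: lin_comb_def fun_eq_iff)
  moreover have "(\<integral>x. F x \<partial>stdP {}) = F (\<lambda>_. undefined)" for F :: "_ \<Rightarrow> real"
    by (simp add: PiM_empty lebesgue_integral_count_space_finite)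
  ultimately show ?case by (simp only: order_refl)
next
  case (insert a A)
  note meas [measurable] = insert.prems(1)
  interpret A: prob_space "stdP A" by (rule prob_space_stdP)
  obtain b where b: "\<And>p. p \<in> cbox l h \<Longrightarrow> \<bar>B p\<bar> \<le> b"
    using B_bounded by blast
  define f' where "f' i v = (\<integral>t. f i (v(a := t)) \<partial>std1)" for i v
  define \<Psi> where "\<Psi> x y = B (\<chi> i. f i (lin_comb (insert a A) (w i) x y))" for x y
  have \<Psi>_b: "\<bar>\<Psi> x y\<bar> \<le> b" for x y
    unfolding \<Psi>_def using insert.prems(2) by (intro b) (simp add: mem_box_cart)
  have \<Psi>_meas [measurable (raw)]: "(\<lambda>\<omega>. \<Psi> (X \<omega>) (Y \<omega>)) \<in> borel_measurable M"
    if [measurable]: "X \<in> measurable M (stdP (insert a A))" "Y \<in> measurable M (stdP (insert a A))" for X Y and M :: "'m measure"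
    unfolding \<Psi>_def by measurable
  have upd [measurable]: "(\<lambda>\<omega>. (X \<omega>)(a := T \<omega>)) \<in> measurable M (stdP (insert a A))"
    if "X \<in> measurable M (stdP A)" "T \<in> borel_measurable M" for X T and M :: "'m measure"
    using measurable_compose[OF measurable_Pair[OF that(1), of T std1] measurable_add_dim[of a A "\<lambda>_. std1"]] that(2) by simp
  have f'_meas [measurable]: "f' i \<in> borel_measurable (stdP A)" for i
    unfolding f'_def[abs_def] by (intro std1.borel_measurable_lebesgue_integral) simp
  have f'_box: "f' i v \<in> {l $ i..h $ i}" if "v \<in> space (stdP A)" for i v
  proof -
    have "(\<lambda>t. f i (v(a := t))) \<in> borel_measurable borel"
      using that by (intro measurable_compose[OF upd[of "\<lambda>_. v" borel "\<lambda>t. t"] meas[of i]]) simp_all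
    \<comment> \<open>The average with deviation 1 at 0 is the plain expectation, so the interval
      bound for averages can be reused.\<close>
    then have "gauss_avg 1 (\<lambda>t. f i (v(a := t))) 0 \<in> {l $ i..h $ i}"
      by (rule gauss_avg_in_interval) (intro insert.prems(2) fun_upd_space that)
    then show ?thesis
      by (simp add: f'_def gauss_avg_def)
  qed
  have int_insert: "integral\<^sup>L (stdP (insert a A)) F = (\<integral>x. \<integral>t. F (x(a := t)) \<partial>std1 \<partial>stdP A)"
    if "F \<in> borel_measurable (stdP (insert a A))" "\<And>x. x \<in> space (stdP (insert a A)) \<Longrightarrow> \<bar>F x\<bar> \<le> c" for F and c :: real
    using that insert.hyps by (intro stdP.product_integral_insert bounded_integrable[where K=c] prob_space_stdP) auto
  have "B (\<chi> i. \<integral>x. f i x \<partial>stdP (insert a A)) = B (\<chi> i. \<integral>x. f' i x \<partial>stdP A)"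
  proof -
    have "\<bar>f i x\<bar> \<le> \<bar>l $ i\<bar> + \<bar>h $ i\<bar>" if "x \<in> space (stdP (insert a A))" for i x
      using insert.prems(2)[OF that, of i] by auto
    then have "(\<integral>x. f i x \<partial>stdP (insert a A)) = (\<integral>x. f' i x \<partial>stdP A)" for i
      unfolding f'_def by (rule int_insert[OF meas])
    then show ?thesis by simp
  qed
  also have "\<dots> \<le> (\<integral>x. \<integral>y. B (\<chi> i. f' i (lin_comb A (w i) x y)) \<partial>stdP A \<partial>stdP A)"
    by (rule insert.IH[OF f'_meas f'_box])
  also have "\<dots> \<le> (\<integral>x. \<integral>y. \<integral>s. \<integral>t. \<Psi> (x(a := s)) (y(a := t)) \<partial>std1 \<partial>std1 \<partial>stdP A \<partial>stdP A)"
  proof -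
    have pw: "B (\<chi> i. f' i (lin_comb A (w i) x y)) \<le> (\<integral>s. \<integral>t. \<Psi> (x(a := s)) (y(a := t)) \<partial>std1 \<partial>std1)"
      if xy: "x \<in> space (stdP A)" "y \<in> space (stdP A)" for x y
    proof -
      let ?v = "\<lambda>i. lin_comb A (w i) x y"
      have v: "(\<lambda>t. f i ((?v i)(a := t))) \<in> borel_measurable borel" for i
        by (intro measurable_compose[OF upd[of "\<lambda>_. ?v i" borel "\<lambda>t. t"] meas[of i]]) simp_all
      have "B (\<chi> i. f' i (?v i)) \<le> (\<integral>z. B (\<chi> i. f i ((?v i)(a := w i \<bullet> z))) \<partial>std2)"
        unfolding f'_def using v insert.prems(2) by (intro jensen_measurable) (auto simp: fun_upd_space)
      also have "\<dots> = (\<integral>z. \<Psi> (x(a := fst z)) (y(a := snd z)) \<partial>std2)"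
        using insert.hyps(2) by (simp add: \<Psi>_def lin_comb_fun_upd)
      also have "\<dots> = (\<integral>s. \<integral>t. \<Psi> (x(a := s)) (y(a := t)) \<partial>std1 \<partial>std1)"
        using xy \<Psi>_b
        by (subst integral_std2) (auto intro!: bounded_integrable[where K=b] std2.prob_space_axioms \<Psi>_meas upd measurable_fst_snd_std2)
      finally show ?thesis .
    qed
    have 1: "(\<lambda>(x, y). B (\<chi> i. f' i (lin_comb A (w i) x y))) \<in> borel_measurable (stdP A \<Otimes>\<^sub>M stdP A)"
      by measurable
    have 2: "(\<lambda>(x, y). \<integral>s. \<integral>t. \<Psi> (x(a := s)) (y(a := t)) \<partial>std1 \<partial>std1) \<in> borel_measurable (stdP A \<Otimes>\<^sub>M stdP A)"
      by measurable
    have b1: "\<bar>B (\<chi> i. f' i (lin_comb A (w i) x y))\<bar> \<le> b" for x y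
      using f'_box by (intro b) (simp add: mem_box_cart)
    have b2: "\<bar>\<integral>s. \<integral>t. \<Psi> (x(a := s)) (y(a := t)) \<partial>std1 \<partial>std1\<bar> \<le> b" for x y
      by (intro bounded_expectation std1.prob_space_axioms \<Psi>_b)
    show ?thesis
    proof (rule integral_mono)
      show "integrable (stdP A) (\<lambda>x. \<integral>y. B (\<chi> i. f' i (lin_comb A (w i) x y)) \<partial>stdP A)"
        using 1 by (intro bounded_integrable[where K=b] prob_space_stdP A.borel_measurable_lebesgue_integral)
          (auto intro!: bounded_expectation prob_space_stdP b1)
      show "integrable (stdP A) (\<lambda>x. \<integral>y. \<integral>s. \<integral>t. \<Psi> (x(a := s)) (y(a := t)) \<partial>std1 \<partial>std1 \<partial>stdP A)"
        using 2 by (intro bounded_integrable[where K=b] prob_space_stdP A.borel_measurable_lebesgue_integral)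
          (auto intro!: bounded_expectation prob_space_stdP b2 simp: split_beta')
      fix x assume x: "x \<in> space (stdP A)"
      show "(\<integral>y. B (\<chi> i. f' i (lin_comb A (w i) x y)) \<partial>stdP A)
          \<le> (\<integral>y. \<integral>s. \<integral>t. \<Psi> (x(a := s)) (y(a := t)) \<partial>std1 \<partial>std1 \<partial>stdP A)"
      proof (rule integral_mono)
        show "integrable (stdP A) (\<lambda>y. B (\<chi> i. f' i (lin_comb A (w i) x y)))"
          using measurable_compose[OF measurable_Pair1'[OF x] 1]
          by (intro bounded_integrable[where K=b] prob_space_stdP) (auto simp: b1)
        show "integrable (stdP A) (\<lambda>y. \<integral>s. \<integral>t. \<Psi> (x(a := s)) (y(a := t)) \<partial>std1 \<partial>std1)"
          using measurable_compose[OF measurable_Pair1'[OF x] 2]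
          by (intro bounded_integrable[where K=b] prob_space_stdP) (auto simp: b2)
      qed (use pw x in auto)
    qed
  qed
  \<comment> \<open>Exchanging \<open>s\<close> and \<open>y\<close> brings together the pairs
    \<open>(x, s)\<close> and \<open>(y, t)\<close>, the two points of the enlarged product.\<close>
  also have "\<dots> = (\<integral>x. \<integral>s. \<integral>y. \<integral>t. \<Psi> (x(a := s)) (y(a := t)) \<partial>std1 \<partial>stdP A \<partial>std1 \<partial>stdP A)"
  proof (rule Bochner_Integration.integral_cong[OF refl])
    fix x assume "x \<in> space (stdP A)"
    then show "(\<integral>y. \<integral>s. \<integral>t. \<Psi> (x(a := s)) (y(a := t)) \<partial>std1 \<partial>std1 \<partial>stdP A) = (\<integral>s. \<integral>y. \<integral>t. \<Psi> (x(a := s)) (y(a := t)) \<partial>std1 \<partial>stdP A \<partial>std1)"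
      by (intro stdP_Fubini[where b=b] prob_space_stdP std1.prob_space_axioms bounded_expectation \<Psi>_b) measurable
  qed
  also have "\<dots> = (\<integral>x. \<integral>s. \<integral>y. \<Psi> (x(a := s)) y \<partial>stdP (insert a A) \<partial>std1 \<partial>stdP A)"
  proof -
    have "(\<integral>y. \<integral>t. \<Psi> (x(a := s)) (y(a := t)) \<partial>std1 \<partial>stdP A) = (\<integral>y. \<Psi> (x(a := s)) y \<partial>stdP (insert a A))"
      if "x \<in> space (stdP A)" for x s
      using fun_upd_space[OF that] by (intro int_insert[symmetric, where c=b] \<Psi>_b) measurable
    then show ?thesis
      by (simp cong: Bochner_Integration.integral_cong)
  qed
  also have "\<dots> = (\<integral>x. \<integral>y. \<Psi> x y \<partial>stdP (insert a A) \<partial>stdP (insert a A))"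
  proof (rule int_insert[symmetric, where c=b])
    interpret A': prob_space "stdP (insert a A)" by (rule prob_space_stdP)
    show "(\<lambda>x. \<integral>y. \<Psi> x y \<partial>stdP (insert a A)) \<in> borel_measurable (stdP (insert a A))"
      by (intro A'.borel_measurable_lebesgue_integral) (simp add: split_beta')
  qed (intro bounded_expectation prob_space_stdP \<Psi>_b)
  finally show ?case
    by (simp add: \<Psi>_def)
qed

end

section \<open>Second order expansions\<close>

lemma taylor_order_2:
  fixes f0 f1 f2 f3 :: "real \<Rightarrow> real"
  assumes T: "convex T" "s \<in> T" "t \<in> T"
    and f0: "\<And>x. x \<in> T \<Longrightarrow> (f0 has_real_derivative f1 x) (at x within T)"
    and f1: "\<And>x. x \<in> T \<Longrightarrow> (f1 has_real_derivative f2 x) (at x within T)"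
    and f2: "\<And>x. x \<in> T \<Longrightarrow> (f2 has_real_derivative f3 x) (at x within T)"
    and K: "\<And>x. x \<in> T \<Longrightarrow> \<bar>f3 x\<bar> \<le> K"
  shows "\<bar>f0 t - f0 s - f1 s * (t - s) - f2 s * (t - s)\<^sup>2 / 2\<bar> \<le> K * \<bar>t - s\<bar> ^ 3"
proof -
  let ?f = "\<lambda>i::nat. if i = 0 then f0 else if i = 1 then f1 else if i = 2 then f2 else f3"
  have "norm (?f 0 t - (\<Sum>i\<le>2. ?f i s * (t - s) ^ i / fact i)) \<le> K * norm (t - s) ^ Suc 2 / fact 2"
    using T f0 f1 f2 K by (intro field_Taylor[where S = T]) (auto simp: le_Suc_eq numeral_2_eq_2)
  also have "\<dots> = K * \<bar>t - s\<bar> ^ 3 / 2"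
    by simp
  also have "\<dots> \<le> K * \<bar>t - s\<bar> ^ 3"
  proof -
    have "0 \<le> K * \<bar>t - s\<bar> ^ 3"
      using order_trans[OF abs_ge_zero K[OF T(2)]] by (intro mult_nonneg_nonneg) auto
    then show ?thesis by linarith
  qed
  finally show ?thesis
    by (simp add: numeral_2_eq_2 algebra_simps)
qed

lemma taylor_order_1:
  fixes f0 f1 f2 :: "real \<Rightarrow> real"
  assumes "convex T" "s \<in> T" "t \<in> T"
    and "\<And>x. x \<in> T \<Longrightarrow> (f0 has_real_derivative f1 x) (at x within T)"
    and "\<And>x. x \<in> T \<Longrightarrow> (f1 has_real_derivative f2 x) (at x within T)"
    and "\<And>x. x \<in> T \<Longrightarrow> \<bar>f2 x\<bar> \<le> K"
  shows "\<bar>f0 t - f0 s - f1 s * (t - s)\<bar> \<le> K * \<bar>t - s\<bar>\<^sup>2"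
proof -
  let ?f = "\<lambda>i::nat. if i = 0 then f0 else if i = 1 then f1 else f2"
  have "norm (?f 0 t - (\<Sum>i\<le>1. ?f i s * (t - s) ^ i / fact i)) \<le> K * norm (t - s) ^ Suc 1 / fact 1"
    using assms by (intro field_Taylor[where S = T]) (auto simp: le_Suc_eq)
  then show ?thesis
    by (simp add: algebra_simps power2_eq_square)
qed

lemma taylor_order_0:
  fixes f0 f1 :: "real \<Rightarrow> real"
  assumes "convex T" "s \<in> T" "t \<in> T"
    and "\<And>x. x \<in> T \<Longrightarrow> (f0 has_real_derivative f1 x) (at x within T)"
    and "\<And>x. x \<in> T \<Longrightarrow> \<bar>f1 x\<bar> \<le> K"
  shows "\<bar>f0 t - f0 s\<bar> \<le> K * \<bar>t - s\<bar>"
  using field_differentiable_bound[of T f0 f1 K t s] assms by simp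

section \<open>Taylor expansion on a closed rectangle\<close>

lemma C_k_on_continuous: "C_k_on k I J F \<Longrightarrow> continuous_on (I \<times> J) (\<lambda>(x, y). F x y)"
  by (cases k) simp_all

lemma C_k_on_SucD:
  assumes "C_k_on (Suc k) I J F"
  shows "C_k_on k I J (partial_x I F)" "C_k_on k I J (partial_y J F)"
  using assms by simp_all

lemma C_k_on_bounded:
  assumes "C_k_on k I J F" "compact I" "compact J"
  shows "\<exists>K. \<forall>x\<in>I. \<forall>y\<in>J. \<bar>F x y\<bar> \<le> K"
proof -
  have "bounded ((\<lambda>(x, y). F x y) ` (I \<times> J))"
    using assms by (intro compact_imp_bounded compact_continuous_image compact_Times C_k_on_continuous)
  then obtain K where "\<forall>z\<in>(\<lambda>(x, y). F x y) ` (I \<times> J). norm z \<le> K"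
    unfolding bounded_iff by blast
  then show ?thesis by (intro exI[of _ K]) auto
qed

lemma C_k_on_partial_x:
  assumes "C_k_on (Suc k) I J F" "x \<in> I" "y \<in> J"
  shows "((\<lambda>t. F t y) has_real_derivative partial_x I F x y) (at x within I)"
  using assms unfolding partial_x_def by (simp add: has_real_derivative_iff_has_vector_derivative vector_derivative_works[symmetric])

lemma C_k_on_partial_y:
  assumes "C_k_on (Suc k) I J F" "x \<in> I" "y \<in> J"
  shows "((\<lambda>t. F x t) has_real_derivative partial_y J F x y) (at y within J)"
  using assms unfolding partial_y_def by (simp add: has_real_derivative_iff_has_vector_derivative vector_derivative_works[symmetric])

text \<open>Expanding along the path \<open>(x, y) \<leadsto> (x, y') \<leadsto> (x', y')\<close> uses only the mixed derivative
  \<open>\<partial>\<^sub>y \<partial>\<^sub>x F\<close>, so that symmetry of second derivatives is not needed.\<close>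

lemma C_k_on_taylor:
  assumes F: "C_k_on 3 I J F" and IJ: "compact I" "compact J" "convex I" "convex J"
  obtains K where "\<And>x y x' y'. x \<in> I \<Longrightarrow> y \<in> J \<Longrightarrow> x' \<in> I \<Longrightarrow> y' \<in> J \<Longrightarrow>
    \<bar>F x' y' - F x y - (partial_x I F x y * (x' - x) + partial_y J F x y * (y' - y))
      - (partial_x I (partial_x I F) x y * (x' - x)\<^sup>2 + 2 * partial_y J (partial_x I F) x y * (x' - x) * (y' - y)
         + partial_y J (partial_y J F) x y * (y' - y)\<^sup>2) / 2\<bar> \<le> K * (\<bar>x' - x\<bar> + \<bar>y' - y\<bar>) ^ 3"
proof -
  let ?X = "partial_x I" and ?Y = "partial_y J"
  have C3: "C_k_on (Suc (Suc (Suc 0))) I J F"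
    using F by (simp only: numeral_3_eq_3)
  have C2: "C_k_on (Suc (Suc 0)) I J (?X F)" "C_k_on (Suc (Suc 0)) I J (?Y F)"
    by (rule C_k_on_SucD[OF C3])+
  have C1: "C_k_on (Suc 0) I J (?X (?X F))" "C_k_on (Suc 0) I J (?Y (?X F))" "C_k_on (Suc 0) I J (?Y (?Y F))"
    by (rule C2[THEN C_k_on_SucD(1)] C2[THEN C_k_on_SucD(2)])+
  have C0: "C_k_on 0 I J (?X (?X (?X F)))" "C_k_on 0 I J (?Y (?X (?X F)))" "C_k_on 0 I J (?Y (?Y (?X F)))" "C_k_on 0 I J (?Y (?Y (?Y F)))"
    by (rule C1[THEN C_k_on_SucD(1)] C1[THEN C_k_on_SucD(2)])+
  have "\<exists>K. \<forall>x\<in>I. \<forall>y\<in>J. \<bar>?X (?X (?X F)) x y\<bar> \<le> K \<and> \<bar>?Y (?X (?X F)) x y\<bar> \<le> K \<and> \<bar>?Y (?Y (?X F)) x y\<bar> \<le> K \<and> \<bar>?Y (?Y (?Y F)) x y\<bar> \<le> K"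
  proof -
    obtain K1 K2 K3 K4 where "\<forall>x\<in>I. \<forall>y\<in>J. \<bar>?X (?X (?X F)) x y\<bar> \<le> K1" "\<forall>x\<in>I. \<forall>y\<in>J. \<bar>?Y (?X (?X F)) x y\<bar> \<le> K2"
      "\<forall>x\<in>I. \<forall>y\<in>J. \<bar>?Y (?Y (?X F)) x y\<bar> \<le> K3" "\<forall>x\<in>I. \<forall>y\<in>J. \<bar>?Y (?Y (?Y F)) x y\<bar> \<le> K4"
      using C0[THEN C_k_on_bounded[OF _ IJ(1,2)]] by (elim exE) blast
    then show ?thesis
      by (intro exI[of _ "max (max K1 K2) (max K3 K4)"]) (auto simp: le_max_iff_disj)
  qed
  then obtain K where K: "\<And>x y. x \<in> I \<Longrightarrow> y \<in> J \<Longrightarrow> \<bar>?X (?X (?X F)) x y\<bar> \<le> K" "\<And>x y. x \<in> I \<Longrightarrow> y \<in> J \<Longrightarrow> \<bar>?Y (?X (?X F)) x y\<bar> \<le> K"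
    "\<And>x y. x \<in> I \<Longrightarrow> y \<in> J \<Longrightarrow> \<bar>?Y (?Y (?X F)) x y\<bar> \<le> K" "\<And>x y. x \<in> I \<Longrightarrow> y \<in> J \<Longrightarrow> \<bar>?Y (?Y (?Y F)) x y\<bar> \<le> K"
    by (elim exE) blast
  show thesis
  proof
    fix x y x' y' assume mem: "x \<in> I" "y \<in> J" "x' \<in> I" "y' \<in> J"
    let ?u = "x' - x" and ?v = "y' - y"
    have "0 \<le> K" using K(1)[OF mem(1,2)] by linarith
    \<comment> \<open>Telescoping through the corner \<open>(x, y')\<close>, whose values are
      \<open>F1\<close>, \<open>X1\<close> and \<open>XX1\<close>. Each bracket on the right is a
      Taylor remainder in one variable, of the order that its factor in \<open>u\<close> leaves to
      be gained.\<close>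
    have split: "F' - F0 - (X * u + Y * v) - (XX * u\<^sup>2 + 2 * XY * u * v + YY * v\<^sup>2) / 2
        = (F1 - F0 - Y * v - YY * v\<^sup>2 / 2) + (F' - F1 - X1 * u - XX1 * u\<^sup>2 / 2)
          + (X1 - X - XY * v) * u + (XX1 - XX) * u\<^sup>2 / 2"
      for F' F0 F1 X X1 Y XX XX1 XY YY u v :: real
      by (simp add: field_simps)
    have tri: "\<bar>T\<bar> \<le> \<alpha> + \<beta> + \<gamma> + \<delta>"
      if "T = A + B + C + D / 2" "\<bar>A\<bar> \<le> \<alpha>" "\<bar>B\<bar> \<le> \<beta>" "\<bar>C\<bar> \<le> \<gamma>" "\<bar>D\<bar> \<le> \<delta>"
      for T A B C D \<alpha> \<beta> \<gamma> \<delta> :: real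
      using that by linarith
    have cube: "v ^ 3 + u ^ 3 + v\<^sup>2 * u + v * u\<^sup>2 \<le> (u + v) ^ 3" if "0 \<le> u" "0 \<le> v" for u v :: real
    proof -
      have "0 \<le> 2 * (v\<^sup>2 * u) + 2 * (v * u\<^sup>2)" using that by simp
      moreover have "(u + v) ^ 3 = v ^ 3 + u ^ 3 + v\<^sup>2 * u + v * u\<^sup>2 + (2 * (v\<^sup>2 * u) + 2 * (v * u\<^sup>2))"
        by algebra
      ultimately show ?thesis by linarith
    qed
    have r1: "\<bar>F x y' - F x y - ?Y F x y * ?v - ?Y (?Y F) x y * ?v\<^sup>2 / 2\<bar> \<le> K * \<bar>?v\<bar> ^ 3"
      using mem K(4) C_k_on_partial_y[OF C3] C_k_on_partial_y[OF C2(2)] C_k_on_partial_y[OF C1(3)]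
      by (intro taylor_order_2[OF IJ(4), where ?f0.0 = "F x" and ?f1.0 = "?Y F x" and ?f2.0 = "?Y (?Y F) x"
            and ?f3.0 = "?Y (?Y (?Y F)) x"])
    have r2: "\<bar>F x' y' - F x y' - ?X F x y' * ?u - ?X (?X F) x y' * ?u\<^sup>2 / 2\<bar> \<le> K * \<bar>?u\<bar> ^ 3"
      using mem K(1) C_k_on_partial_x[OF C3] C_k_on_partial_x[OF C2(1)] C_k_on_partial_x[OF C1(1)]
      by (intro taylor_order_2[OF IJ(3), where ?f0.0 = "\<lambda>t. F t y'" and ?f1.0 = "\<lambda>t. ?X F t y'" and ?f2.0 = "\<lambda>t. ?X (?X F) t y'"
            and ?f3.0 = "\<lambda>t. ?X (?X (?X F)) t y'"])
    have "\<bar>?X F x y' - ?X F x y - ?Y (?X F) x y * ?v\<bar> \<le> K * \<bar>?v\<bar>\<^sup>2"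
      using mem K(3) C_k_on_partial_y[OF C2(1)] C_k_on_partial_y[OF C1(2)]
      by (intro taylor_order_1[OF IJ(4), where ?f0.0 = "?X F x" and ?f1.0 = "?Y (?X F) x" and ?f2.0 = "?Y (?Y (?X F)) x"])
    then have r3: "\<bar>(?X F x y' - ?X F x y - ?Y (?X F) x y * ?v) * ?u\<bar> \<le> K * (\<bar>?v\<bar>\<^sup>2 * \<bar>?u\<bar>)"
      unfolding abs_mult mult.assoc[symmetric] by (rule mult_right_mono) simp
    have "\<bar>?X (?X F) x y' - ?X (?X F) x y\<bar> \<le> K * \<bar>?v\<bar>"
      using mem K(2) C_k_on_partial_y[OF C1(1)]
      by (intro taylor_order_0[OF IJ(4), where ?f0.0 = "?X (?X F) x" and ?f1.0 = "?Y (?X (?X F)) x"])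
    then have "\<bar>?X (?X F) x y' - ?X (?X F) x y\<bar> * ?u\<^sup>2 \<le> K * \<bar>?v\<bar> * ?u\<^sup>2"
      by (rule mult_right_mono) simp
    then have r4: "\<bar>(?X (?X F) x y' - ?X (?X F) x y) * ?u\<^sup>2\<bar> \<le> K * (\<bar>?v\<bar> * \<bar>?u\<bar>\<^sup>2)"
      by (simp add: abs_mult mult.assoc)
    have "F x' y' - F x y - (?X F x y * ?u + ?Y F x y * ?v)
          - (?X (?X F) x y * ?u\<^sup>2 + 2 * ?Y (?X F) x y * ?u * ?v + ?Y (?Y F) x y * ?v\<^sup>2) / 2
        = (F x y' - F x y - ?Y F x y * ?v - ?Y (?Y F) x y * ?v\<^sup>2 / 2)
          + (F x' y' - F x y' - ?X F x y' * ?u - ?X (?X F) x y' * ?u\<^sup>2 / 2)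
          + (?X F x y' - ?X F x y - ?Y (?X F) x y * ?v) * ?u
          + (?X (?X F) x y' - ?X (?X F) x y) * ?u\<^sup>2 / 2"
      by (rule split)
    then have "\<bar>F x' y' - F x y - (?X F x y * ?u + ?Y F x y * ?v)
          - (?X (?X F) x y * ?u\<^sup>2 + 2 * ?Y (?X F) x y * ?u * ?v + ?Y (?Y F) x y * ?v\<^sup>2) / 2\<bar>
        \<le> K * \<bar>?v\<bar> ^ 3 + K * \<bar>?u\<bar> ^ 3 + K * (\<bar>?v\<bar>\<^sup>2 * \<bar>?u\<bar>) + K * (\<bar>?v\<bar> * \<bar>?u\<bar>\<^sup>2)"
      by (rule tri[OF _ r1 r2 r3 r4])
    also have "\<dots> \<le> K * (\<bar>?u\<bar> + \<bar>?v\<bar>) ^ 3"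
    proof -
      have "\<bar>?v\<bar> ^ 3 + \<bar>?u\<bar> ^ 3 + \<bar>?v\<bar>\<^sup>2 * \<bar>?u\<bar> + \<bar>?v\<bar> * \<bar>?u\<bar>\<^sup>2 \<le> (\<bar>?u\<bar> + \<bar>?v\<bar>) ^ 3"
        by (rule cube) simp_all
      from mult_left_mono[OF this \<open>0 \<le> K\<close>] show ?thesis
        by (simp only: distrib_left)
    qed
    finally show "\<bar>F x' y' - F x y - (?X F x y * ?u + ?Y F x y * ?v)
          - (?X (?X F) x y * ?u\<^sup>2 + 2 * ?Y (?X F) x y * ?u * ?v + ?Y (?Y F) x y * ?v\<^sup>2) / 2\<bar> \<le> K * (\<bar>?u\<bar> + \<bar>?v\<bar>) ^ 3" .
  qed
qed

section \<open>Uniform second-order expansions and their chain rule\<close>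

text \<open>\<open>l p\<close> and \<open>q p\<close> play the roles of gradient and Hessian.
  Uniform inequalities on \<open>S\<close> replace differentiability, since a closed box has
  boundary points where only one-sided derivatives exist.\<close>

definition quad_expansion :: "'a::real_normed_vector set \<Rightarrow> ('a \<Rightarrow> real) \<Rightarrow> ('a \<Rightarrow> 'a \<Rightarrow> real) \<Rightarrow> ('a \<Rightarrow> 'a \<Rightarrow> 'a \<Rightarrow> real) \<Rightarrow> bool" where
  "quad_expansion S F l q \<longleftrightarrow>
     (\<forall>p\<in>S. linear (l p) \<and> bilinear (q p)) \<and>
     (\<exists>K. (\<forall>p\<in>S. \<forall>d. \<bar>l p d\<bar> \<le> K * norm d) \<and> (\<forall>p\<in>S. \<forall>d e. \<bar>q p d e\<bar> \<le> K * norm d * norm e) \<and>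
       (\<forall>p\<in>S. \<forall>p'\<in>S. \<bar>F p' - F p - l p (p' - p) - q p (p' - p) (p' - p) / 2\<bar> \<le> K * norm (p' - p) ^ 3))"

lemma quad_expansionI:
  assumes "\<And>p. p \<in> S \<Longrightarrow> linear (l p)" "\<And>p. p \<in> S \<Longrightarrow> bilinear (q p)"
    and "\<And>p d. p \<in> S \<Longrightarrow> \<bar>l p d\<bar> \<le> K1 * norm d"
    and "\<And>p d e. p \<in> S \<Longrightarrow> \<bar>q p d e\<bar> \<le> K2 * norm d * norm e"
    and "\<And>p p'. p \<in> S \<Longrightarrow> p' \<in> S \<Longrightarrow> \<bar>F p' - F p - l p (p' - p) - q p (p' - p) (p' - p) / 2\<bar> \<le> K3 * norm (p' - p) ^ 3"
  shows "quad_expansion S F l q"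
proof -
  let ?K = "max K1 (max K2 K3)"
  have K: "K1 * x \<le> ?K * x" "K2 * x \<le> ?K * x" "K3 * x \<le> ?K * x" if "0 \<le> x" for x
    using that by (auto intro!: mult_right_mono)
  have "\<bar>l p d\<bar> \<le> ?K * norm d" if "p \<in> S" for p d
    using assms(3)[OF that] K(1)[of "norm d"] by (meson norm_ge_zero order_trans)
  moreover have "\<bar>q p d e\<bar> \<le> ?K * norm d * norm e" if "p \<in> S" for p d e
    using assms(4)[OF that, of d e] K(2)[of "norm d * norm e"] by (simp add: mult.assoc)
  moreover have "\<bar>F p' - F p - l p (p' - p) - q p (p' - p) (p' - p) / 2\<bar> \<le> ?K * norm (p' - p) ^ 3"
    if "p \<in> S" "p' \<in> S" for p p'
    using assms(5)[OF that] K(3)[of "norm (p' - p) ^ 3"] by simp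
  ultimately show ?thesis
    unfolding quad_expansion_def using assms(1,2) by blast
qed

lemma quad_expansionE:
  assumes "quad_expansion S F l q"
  obtains K where "0 \<le> K" "\<And>p. p \<in> S \<Longrightarrow> linear (l p)" "\<And>p. p \<in> S \<Longrightarrow> bilinear (q p)"
    "\<And>p d. p \<in> S \<Longrightarrow> \<bar>l p d\<bar> \<le> K * norm d"
    "\<And>p d e. p \<in> S \<Longrightarrow> \<bar>q p d e\<bar> \<le> K * norm d * norm e"
    "\<And>p p'. p \<in> S \<Longrightarrow> p' \<in> S \<Longrightarrow> \<bar>F p' - F p - l p (p' - p) - q p (p' - p) (p' - p) / 2\<bar> \<le> K * norm (p' - p) ^ 3"
proof -
  obtain K where K: "\<forall>p\<in>S. \<forall>d. \<bar>l p d\<bar> \<le> K * norm d" "\<forall>p\<in>S. \<forall>d e. \<bar>q p d e\<bar> \<le> K * norm d * norm e"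
    "\<forall>p\<in>S. \<forall>p'\<in>S. \<bar>F p' - F p - l p (p' - p) - q p (p' - p) (p' - p) / 2\<bar> \<le> K * norm (p' - p) ^ 3"
    using assms unfolding quad_expansion_def by blast
  have le: "K * x \<le> \<bar>K\<bar> * x" if "0 \<le> x" for x
    using that by (intro mult_right_mono) auto
  show thesis
  proof
    show "0 \<le> \<bar>K\<bar>" by simp
    show "\<bar>l p d\<bar> \<le> \<bar>K\<bar> * norm d" if "p \<in> S" for p d
      using K(1) that le[of "norm d"] by (meson norm_ge_zero order_trans)
    show "\<bar>q p d e\<bar> \<le> \<bar>K\<bar> * norm d * norm e" if "p \<in> S" for p d e
      using K(2)[rule_format, OF that, of d e] le[of "norm d * norm e"] by (simp add: mult.assoc)
    show "\<bar>F p' - F p - l p (p' - p) - q p (p' - p) (p' - p) / 2\<bar> \<le> \<bar>K\<bar> * norm (p' - p) ^ 3"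
      if "p \<in> S" "p' \<in> S" for p p'
      using K(3)[rule_format, OF that] le[of "norm (p' - p) ^ 3"] by simp
  qed (use assms in \<open>auto simp: quad_expansion_def\<close>)
qed

lemma linear_cmult:
  fixes f :: "'a::real_vector \<Rightarrow> real"
  shows "linear f \<Longrightarrow> linear (\<lambda>x. c * f x)"
  using linear_compose_scale_right[of f c] by simp

lemma quad_expansion_lin_comb:
  assumes "quad_expansion S F l q" "quad_expansion S G m r"
  shows "quad_expansion S (\<lambda>p. a * F p + b * G p) (\<lambda>p d. a * l p d + b * m p d) (\<lambda>p d e. a * q p d e + b * r p d e)"
proof -
  obtain K where K: "0 \<le> K" "\<And>p. p \<in> S \<Longrightarrow> linear (l p)" "\<And>p. p \<in> S \<Longrightarrow> bilinear (q p)"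
    "\<And>p d. p \<in> S \<Longrightarrow> \<bar>l p d\<bar> \<le> K * norm d"
    "\<And>p d e. p \<in> S \<Longrightarrow> \<bar>q p d e\<bar> \<le> K * norm d * norm e"
    "\<And>p p'. p \<in> S \<Longrightarrow> p' \<in> S \<Longrightarrow> \<bar>F p' - F p - l p (p' - p) - q p (p' - p) (p' - p) / 2\<bar> \<le> K * norm (p' - p) ^ 3"
    using assms(1) by (rule quad_expansionE) (rule that; assumption)
  obtain L where L: "0 \<le> L" "\<And>p. p \<in> S \<Longrightarrow> linear (m p)" "\<And>p. p \<in> S \<Longrightarrow> bilinear (r p)"
    "\<And>p d. p \<in> S \<Longrightarrow> \<bar>m p d\<bar> \<le> L * norm d"
    "\<And>p d e. p \<in> S \<Longrightarrow> \<bar>r p d e\<bar> \<le> L * norm d * norm e"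
    "\<And>p p'. p \<in> S \<Longrightarrow> p' \<in> S \<Longrightarrow> \<bar>G p' - G p - m p (p' - p) - r p (p' - p) (p' - p) / 2\<bar> \<le> L * norm (p' - p) ^ 3"
    using assms(2) by (rule quad_expansionE) (rule that; assumption)
  have comb: "\<bar>a * s + b * t\<bar> \<le> (\<bar>a\<bar> * K + \<bar>b\<bar> * L) * x" if "\<bar>s\<bar> \<le> K * x" "\<bar>t\<bar> \<le> L * x" for s t x
  proof -
    have "\<bar>a * s + b * t\<bar> \<le> \<bar>a\<bar> * \<bar>s\<bar> + \<bar>b\<bar> * \<bar>t\<bar>"
      using abs_triangle_ineq[of "a * s" "b * t"] by (simp add: abs_mult)
    also have "\<dots> \<le> \<bar>a\<bar> * (K * x) + \<bar>b\<bar> * (L * x)"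
      using that by (intro add_mono mult_left_mono) auto
    finally show ?thesis by (simp add: algebra_simps)
  qed
  show ?thesis
  proof (rule quad_expansionI)
    fix p assume p: "p \<in> S"
    show "linear (\<lambda>d. a * l p d + b * m p d)"
      by (intro linear_compose_add linear_cmult K(2) L(2) p)
    show "bilinear (\<lambda>d e. a * q p d e + b * r p d e)"
    proof -
      have "linear (\<lambda>d. a * q p d e + b * r p d e)" "linear (\<lambda>e. a * q p d e + b * r p d e)" for d e
        using K(3)[OF p] L(3)[OF p] unfolding bilinear_def
        by (auto intro!: linear_compose_add linear_cmult)
      then show ?thesis unfolding bilinear_def by blast
    qed
    show "\<bar>a * l p d + b * m p d\<bar> \<le> (\<bar>a\<bar> * K + \<bar>b\<bar> * L) * norm d" for d
      by (rule comb[OF K(4)[OF p] L(4)[OF p]])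
    show "\<bar>a * q p d e + b * r p d e\<bar> \<le> (\<bar>a\<bar> * K + \<bar>b\<bar> * L) * norm d * norm e" for d e
      using comb[of "q p d e" "norm d * norm e" "r p d e"] K(5)[OF p, of d e] L(5)[OF p, of d e] by (simp add: mult.assoc)
    fix p' assume p': "p' \<in> S"
    have "a * F p' + b * G p' - (a * F p + b * G p) - (a * l p (p' - p) + b * m p (p' - p)) - (a * q p (p' - p) (p' - p) + b * r p (p' - p) (p' - p)) / 2
      = a * (F p' - F p - l p (p' - p) - q p (p' - p) (p' - p) / 2) + b * (G p' - G p - m p (p' - p) - r p (p' - p) (p' - p) / 2)"
      by (simp add: field_simps)
    then show "\<bar>a * F p' + b * G p' - (a * F p + b * G p) - (a * l p (p' - p) + b * m p (p' - p)) - (a * q p (p' - p) (p' - p) + b * r p (p' - p) (p' - p)) / 2\<bar>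
      \<le> (\<bar>a\<bar> * K + \<bar>b\<bar> * L) * norm (p' - p) ^ 3"
      using comb[OF K(6)[OF p p'] L(6)[OF p p']] by simp
  qed
qed

text \<open>The second-order chain rule. Replacing the increment \<open>?\<Delta>\<close> by
  \<open>l p ?d\<close> in the quadratic term costs a difference of squares, whose two factors are
  of second and of first order. The diameter bound \<open>D\<close> turns surplus powers of the
  displacement into constants.\<close>

lemma quad_expansion_compose:
  fixes \<phi> \<phi>1 \<phi>2 :: "real \<Rightarrow> real"
  assumes F: "quad_expansion S F l q" and D: "\<And>p p'. p \<in> S \<Longrightarrow> p' \<in> S \<Longrightarrow> norm (p' - p) \<le> D"
    and \<phi>1: "\<And>p. p \<in> S \<Longrightarrow> \<bar>\<phi>1 (F p)\<bar> \<le> M" and \<phi>2: "\<And>p. p \<in> S \<Longrightarrow> \<bar>\<phi>2 (F p)\<bar> \<le> M"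
    and \<phi>: "\<And>p p'. p \<in> S \<Longrightarrow> p' \<in> S \<Longrightarrow>
      \<bar>\<phi> (F p') - \<phi> (F p) - \<phi>1 (F p) * (F p' - F p) - \<phi>2 (F p) * (F p' - F p)\<^sup>2 / 2\<bar> \<le> M * \<bar>F p' - F p\<bar> ^ 3"
  shows "quad_expansion S (\<lambda>p. \<phi> (F p)) (\<lambda>p d. \<phi>1 (F p) * l p d)
    (\<lambda>p d e. \<phi>2 (F p) * (l p d * l p e) + \<phi>1 (F p) * q p d e)"
proof (cases "S = {}")
  case False
  obtain K where K: "0 \<le> K" "\<And>p. p \<in> S \<Longrightarrow> linear (l p)" "\<And>p. p \<in> S \<Longrightarrow> bilinear (q p)"
    "\<And>p d. p \<in> S \<Longrightarrow> \<bar>l p d\<bar> \<le> K * norm d"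
    "\<And>p d e. p \<in> S \<Longrightarrow> \<bar>q p d e\<bar> \<le> K * norm d * norm e"
    "\<And>p p'. p \<in> S \<Longrightarrow> p' \<in> S \<Longrightarrow> \<bar>F p' - F p - l p (p' - p) - q p (p' - p) (p' - p) / 2\<bar> \<le> K * norm (p' - p) ^ 3"
    using F by (rule quad_expansionE) (rule that; assumption)
  have "0 \<le> D" "0 \<le> M"
    using False D \<phi>1 by (meson ex_in_conv norm_ge_zero abs_ge_zero order_trans)+
  let ?E = "K * (1 + D)"
  have "0 \<le> ?E" using K(1) \<open>0 \<le> D\<close> by simp
  show ?thesis
  proof (rule quad_expansionI)
    fix p assume p: "p \<in> S"
    show "linear (\<lambda>d. \<phi>1 (F p) * l p d)"
      by (intro linear_cmult K(2) p)
    show "bilinear (\<lambda>d e. \<phi>2 (F p) * (l p d * l p e) + \<phi>1 (F p) * q p d e)"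
    proof -
      have a: "l p (x + y) = l p x + l p y" "l p (c *\<^sub>R x) = c * l p x" for c x y
        using linear_add[OF K(2)[OF p]] linear_scale[OF K(2)[OF p]] by simp_all
      show ?thesis
        unfolding bilinear_def
        using K(3)[OF p] by (auto intro!: linearI simp: a bilinear_ladd bilinear_radd bilinear_lmul bilinear_rmul algebra_simps)
    qed
    show "\<bar>\<phi>1 (F p) * l p d\<bar> \<le> M * K * norm d" for d
      using mult_mono[OF \<phi>1[OF p] K(4)[OF p, of d]] \<open>0 \<le> M\<close> by (simp add: abs_mult mult.assoc)
    show "\<bar>\<phi>2 (F p) * (l p d * l p e) + \<phi>1 (F p) * q p d e\<bar> \<le> (M * K\<^sup>2 + M * K) * norm d * norm e" for d e
    proof -
      have "\<bar>\<phi>2 (F p) * (l p d * l p e)\<bar> \<le> M * ((K * norm d) * (K * norm e))"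
        unfolding abs_mult using p K(1) \<open>0 \<le> M\<close> by (intro mult_mono \<phi>2 K(4)) auto
      moreover have "\<bar>\<phi>1 (F p) * q p d e\<bar> \<le> M * (K * norm d * norm e)"
        unfolding abs_mult[of "\<phi>1 (F p)"] using p K(1) \<open>0 \<le> M\<close> by (intro mult_mono \<phi>1 K(5)) auto
      ultimately have "\<bar>\<phi>2 (F p) * (l p d * l p e) + \<phi>1 (F p) * q p d e\<bar> \<le> M * ((K * norm d) * (K * norm e)) + M * (K * norm d * norm e)"
        by linarith
      then show ?thesis by (simp add: algebra_simps power2_eq_square)
    qed
    fix p' assume p': "p' \<in> S"
    let ?d = "p' - p" and ?\<Delta> = "F p' - F p"
    let ?n = "norm ?d"
    have n: "?n \<le> D" by (rule D[OF p p'])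
    have lin: "\<bar>?\<Delta> - l p ?d\<bar> \<le> ?E * ?n\<^sup>2"
    proof -
      have "\<bar>?\<Delta> - l p ?d\<bar> \<le> K * ?n ^ 3 + K * ?n * ?n / 2"
        using K(6)[OF p p'] K(5)[OF p, of ?d ?d] by linarith
      also have "K * ?n ^ 3 \<le> K * D * ?n\<^sup>2"
        using mult_left_mono[OF mult_right_mono[OF n, of "?n\<^sup>2"] K(1)] by (simp add: power3_eq_cube power2_eq_square mult.assoc)
      also have "K * ?n * ?n / 2 \<le> K * ?n\<^sup>2"
        using K(1) by (simp add: power2_eq_square mult.assoc)
      finally show ?thesis by (simp add: algebra_simps)
    qed
    have \<Delta>: "\<bar>?\<Delta>\<bar> \<le> (?E * D + K) * ?n"
    proof -
      have "\<bar>?\<Delta>\<bar> \<le> ?E * ?n\<^sup>2 + K * ?n"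
        using lin K(4)[OF p, of ?d] by linarith
      also have "?E * ?n\<^sup>2 \<le> ?E * D * ?n"
        using mult_left_mono[OF mult_right_mono[OF n, of "?n"] \<open>0 \<le> ?E\<close>] by (simp add: power2_eq_square mult.assoc)
      finally show ?thesis by (simp add: algebra_simps)
    qed
    let ?G = "?E * D + K"
    have "0 \<le> ?G" using K(1) \<open>0 \<le> D\<close> by simp
    have e1: "\<bar>\<phi> (F p') - \<phi> (F p) - \<phi>1 (F p) * ?\<Delta> - \<phi>2 (F p) * ?\<Delta>\<^sup>2 / 2\<bar> \<le> M * (?G ^ 3 * ?n ^ 3)"
      using \<phi>[OF p p'] mult_left_mono[OF power_mono[OF \<Delta>, of 3] \<open>0 \<le> M\<close>] by (simp only: power_mult_distrib) linarith
    have e2: "\<bar>\<phi>1 (F p) * (?\<Delta> - l p ?d - q p ?d ?d / 2)\<bar> \<le> M * (K * ?n ^ 3)"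
      unfolding abs_mult using p p' K(1) \<open>0 \<le> M\<close> by (intro mult_mono \<phi>1 K(6)) auto
    have "\<bar>?\<Delta> + l p ?d\<bar> \<le> (?G + K) * ?n"
      using \<Delta> K(4)[OF p, of ?d] abs_triangle_ineq[of ?\<Delta> "l p ?d"] by (simp add: algebra_simps)
    then have "\<bar>\<phi>2 (F p) * ((?\<Delta> - l p ?d) * (?\<Delta> + l p ?d))\<bar> \<le> M * ((?E * ?n\<^sup>2) * ((?G + K) * ?n))"
      unfolding abs_mult using p K(1) lin \<open>0 \<le> M\<close> \<open>0 \<le> ?E\<close> \<open>0 \<le> ?G\<close> by (intro mult_mono \<phi>2) auto
    then have e3: "\<bar>\<phi>2 (F p) * ((?\<Delta> - l p ?d) * (?\<Delta> + l p ?d))\<bar> \<le> M * (?E * (?G + K)) * ?n ^ 3"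
      by (simp only: power3_eq_cube power2_eq_square mult_ac)
    have "\<phi> (F p') - \<phi> (F p) - \<phi>1 (F p) * l p ?d - (\<phi>2 (F p) * (l p ?d * l p ?d) + \<phi>1 (F p) * q p ?d ?d) / 2
      = (\<phi> (F p') - \<phi> (F p) - \<phi>1 (F p) * ?\<Delta> - \<phi>2 (F p) * ?\<Delta>\<^sup>2 / 2) + \<phi>1 (F p) * (?\<Delta> - l p ?d - q p ?d ?d / 2)
        + \<phi>2 (F p) * ((?\<Delta> - l p ?d) * (?\<Delta> + l p ?d)) / 2"
      by (simp add: field_simps power2_eq_square)
    then have "\<bar>\<phi> (F p') - \<phi> (F p) - \<phi>1 (F p) * l p ?d - (\<phi>2 (F p) * (l p ?d * l p ?d) + \<phi>1 (F p) * q p ?d ?d) / 2\<bar>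
      \<le> M * (?G ^ 3 * ?n ^ 3) + M * (K * ?n ^ 3) + M * (?E * (?G + K)) * ?n ^ 3"
      using e1 e2 e3 by linarith
    then show "\<bar>\<phi> (F p') - \<phi> (F p) - \<phi>1 (F p) * l p ?d - (\<phi>2 (F p) * (l p ?d * l p ?d) + \<phi>1 (F p) * q p ?d ?d) / 2\<bar>
      \<le> (M * ?G ^ 3 + M * K + M * (?E * (?G + K))) * ?n ^ 3"
      by (simp only: distrib_right mult.assoc)
  qed
qed (simp add: quad_expansion_def)

text \<open>\<open>s\<close>, \<open>t\<close>, \<open>r\<close> are a test vector scaled by
  logarithmic derivatives, and \<open>A\<close>, \<open>M\<close>, \<open>C\<close> are second
  derivatives of \<open>H\<close> scaled accordingly. Completing the square in \<open>r\<close>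
  leaves \<open>R\<close> times \<open>(c / \<kappa>) * X\<^sup>2 + (R - 1) * Y\<^sup>2 + h\<close>,
  where \<open>\<kappa> = R - c\<close>. In \<open>h\<close> the \<open>X\<^sup>2\<close> part is
  nonnegative by hypothesis; the rest is at least
  \<open>- (2 * K1 * \<bar>X * Y\<bar>) - K1 * Y\<^sup>2\<close> and is absorbed by the two
  gains.\<close>

lemma quadratic_form_nonneg:
  fixes a b u1 u2 v1 v2 K0 :: real
  assumes ab: "0 < a" "0 < b" and uv: "a * u1 + b * v1 = 1" "a * u2 + b * v2 = 0"
    and unit: "u1\<^sup>2 + u2\<^sup>2 = 1" "v1\<^sup>2 + v2\<^sup>2 = 1" and u2: "u2 \<noteq> 0" and K0: "0 \<le> K0"
  shows "\<exists>c>0. \<exists>R0>c + 1. \<forall>R>R0. \<forall>A M C s t r. \<bar>A\<bar> \<le> K0 \<longrightarrow> \<bar>M\<bar> \<le> K0 \<longrightarrow> \<bar>C\<bar> \<le> K0 \<longrightarrow>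
    0 \<le> a\<^sup>2 * A + (1 - a\<^sup>2 - b\<^sup>2) * M + b\<^sup>2 * C \<longrightarrow>
    0 \<le> (R * (s * u1 + t * v1) - (R - c - 1) * r)\<^sup>2 - R * (s * u1 + t * v1)\<^sup>2 + (R - c - 1) * r\<^sup>2
      + (R\<^sup>2 - R) * (s * u2 + t * v2)\<^sup>2 + R * (s\<^sup>2 * A + 2 * (u1 * v1 + u2 * v2) * (s * t) * M + t\<^sup>2 * C)"
proof -
  define \<rho> where "\<rho> = u1 * v1 + u2 * v2"
  \<comment> \<open>\<open>e\<close> and \<open>f\<close> solve
    \<open>(s, t) = X (a, b) + Y (e, f)\<close>, where \<open>X\<close> and \<open>Y\<close> are the
    two components of \<open>s u + t v\<close>.\<close>
  define e where "e = b * v1 / u2"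
  define f where "f = - b * u1 / u2"
  \<comment> \<open>One bound for both coefficients \<open>m\<close> and \<open>g\<close> that
    \<open>h\<close> has on \<open>2 * (X * Y)\<close> and on \<open>Y\<^sup>2\<close>.\<close>
  define K1 where "K1 = K0 * (\<bar>a * e\<bar> + \<bar>\<rho> * (a * f + b * e)\<bar> + \<bar>b * f\<bar> + e\<^sup>2 + \<bar>2 * \<rho> * (e * f)\<bar> + f\<^sup>2)"
  \<comment> \<open>Absorbing the mixed term costs \<open>K1\<^sup>2 * \<kappa> / c\<close> in front
    of \<open>Y\<^sup>2\<close>. This must grow more slowly than \<open>R\<close>, so
    \<open>c\<close> has to exceed \<open>K1\<^sup>2\<close>.\<close>
  define c where "c = K1\<^sup>2 + 1"
  \<comment> \<open>The summand \<open>c * (1 + K1)\<close> lets the gain \<open>R - 1\<close> cover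
    that cost together with \<open>K1\<close>; the summand \<open>c + 2\<close> gives
    \<open>c + 1 < R0\<close>.\<close>
  define R0 where "R0 = c * (1 + K1) + c + 2"
  have "0 \<le> K1" using K0 by (simp add: K1_def)
  have "0 < c" by (simp add: c_def add_nonneg_pos)
  have "c + 1 < R0" using \<open>0 < c\<close> \<open>0 \<le> K1\<close> by (simp add: R0_def add_pos_nonneg)
  \<comment> \<open>The squared length of \<open>a u + b v = (1, 0)\<close> fixes the correlation
    \<open>\<rho>\<close> of \<open>U\<close> and \<open>V\<close>. This is how the middle
    coefficient of the differential inequality arises.\<close>
  have \<rho>: "2 * a * b * \<rho> = 1 - a\<^sup>2 - b\<^sup>2"
  proof -
    have "(a * u1 + b * v1)\<^sup>2 + (a * u2 + b * v2)\<^sup>2 = a\<^sup>2 * (u1\<^sup>2 + u2\<^sup>2) + b\<^sup>2 * (v1\<^sup>2 + v2\<^sup>2) + 2 * a * b * \<rho>"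
      by (simp add: \<rho>_def power2_eq_square algebra_simps)
    then show ?thesis using uv unit by simp
  qed
  show ?thesis
  proof (rule exI[of _ c], rule conjI[OF \<open>0 < c\<close>], rule exI[of _ R0], rule conjI[OF \<open>c + 1 < R0\<close>], intro allI impI)
    fix R A M C s t r
    assume R: "R0 < R" and bounds: "\<bar>A\<bar> \<le> K0" "\<bar>M\<bar> \<le> K0" "\<bar>C\<bar> \<le> K0"
      and pos: "0 \<le> a\<^sup>2 * A + (1 - a\<^sup>2 - b\<^sup>2) * M + b\<^sup>2 * C"
    define X where "X = s * u1 + t * v1"
    define Y where "Y = s * u2 + t * v2"
    define \<kappa> where "\<kappa> = R - c"
    have \<kappa>: "1 < \<kappa>" "\<kappa> < R" using R \<open>c + 1 < R0\<close> \<open>0 < c\<close> by (simp_all add: \<kappa>_def)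
    define h where "h = s\<^sup>2 * A + 2 * \<rho> * (s * t) * M + t\<^sup>2 * C"
    have v2: "v2 = - a * u2 / b" using uv(2) ab by (simp add: field_simps)
    have Y: "b * Y = u2 * (b * s - a * t)"
      using ab by (simp add: Y_def v2 field_simps)
    have "s * (a * u1 + b * v1) = s" "t * (a * u1 + b * v1) = t" using uv(1) by simp_all
    then have s: "s = a * X + v1 * (b * s - a * t)" and t: "t = b * X - u1 * (b * s - a * t)"
      by (simp_all add: X_def algebra_simps)
    have bY: "b * s - a * t = b * Y / u2" using Y u2 by simp
    have s': "s = a * X + e * Y" and t': "t = b * X + f * Y"
      using s t unfolding bY e_def f_def by (simp_all add: algebra_simps)
    define m where "m = a * e * A + \<rho> * (a * f + b * e) * M + b * f * C"
    define g where "g = e\<^sup>2 * A + 2 * \<rho> * (e * f) * M + f\<^sup>2 * C"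
    have h: "h = X\<^sup>2 * (a\<^sup>2 * A + (1 - a\<^sup>2 - b\<^sup>2) * M + b\<^sup>2 * C) + 2 * (X * Y) * m + Y\<^sup>2 * g"
      unfolding h_def \<rho>[symmetric] m_def g_def unfolding s' t' by (simp add: power2_eq_square algebra_simps)
    have tri: "\<bar>x + y + z\<bar> \<le> k + l + n \<and> 0 \<le> k + l + n"
      if "\<bar>x\<bar> \<le> k" "\<bar>y\<bar> \<le> l" "\<bar>z\<bar> \<le> n" for x y z k l n :: real
      using that abs_triangle_ineq[of "x + y" z] abs_triangle_ineq[of x y] abs_ge_zero[of "x + y + z"] by linarith
    have gen: "\<bar>x + y + z\<bar> \<le> T \<and> \<bar>x' + y' + z'\<bar> \<le> T"
      if "\<bar>x\<bar> \<le> k" "\<bar>y\<bar> \<le> l" "\<bar>z\<bar> \<le> n" "\<bar>x'\<bar> \<le> k'" "\<bar>y'\<bar> \<le> l'" "\<bar>z'\<bar> \<le> n'" "T = k + l + n + k' + l' + n'"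
      for x y z x' y' z' k l n k' l' n' T :: real
      using tri[OF that(1-3)] tri[OF that(4-6)] that(7) by auto
    have b: "\<bar>a * e * A\<bar> \<le> \<bar>a * e\<bar> * K0" "\<bar>\<rho> * (a * f + b * e) * M\<bar> \<le> \<bar>\<rho> * (a * f + b * e)\<bar> * K0" "\<bar>b * f * C\<bar> \<le> \<bar>b * f\<bar> * K0"
      "\<bar>e\<^sup>2 * A\<bar> \<le> e\<^sup>2 * K0" "\<bar>2 * \<rho> * (e * f) * M\<bar> \<le> \<bar>2 * \<rho> * (e * f)\<bar> * K0" "\<bar>f\<^sup>2 * C\<bar> \<le> f\<^sup>2 * K0"
      using bounds by (simp_all only: abs_mult[of _ A] abs_mult[of _ M] abs_mult[of _ C] abs_power2 mult_left_mono abs_ge_zero zero_le_power2)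
    have K1: "K1 = \<bar>a * e\<bar> * K0 + \<bar>\<rho> * (a * f + b * e)\<bar> * K0 + \<bar>b * f\<bar> * K0 + e\<^sup>2 * K0 + \<bar>2 * \<rho> * (e * f)\<bar> * K0 + f\<^sup>2 * K0"
      unfolding K1_def by (simp only: algebra_simps)
    have m: "\<bar>m\<bar> \<le> K1" and g: "\<bar>g\<bar> \<le> K1"
      using gen[OF b K1] unfolding m_def g_def by blast+
    have "- (K1 * \<bar>X * Y\<bar>) \<le> (X * Y) * m"
      using mult_left_mono[OF m abs_ge_zero[of "X * Y"]] abs_ge_minus_self[of "X * Y * m"] by (simp add: abs_mult mult.commute)
    moreover have "- (K1 * Y\<^sup>2) \<le> Y\<^sup>2 * g"
      using mult_left_mono[OF g zero_le_power2[of Y]] abs_ge_minus_self[of "Y\<^sup>2 * g"] by (simp add: abs_mult mult.commute)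
    moreover have "0 \<le> X\<^sup>2 * (a\<^sup>2 * A + (1 - a\<^sup>2 - b\<^sup>2) * M + b\<^sup>2 * C)"
      using pos by simp
    ultimately have h_ge: "- (2 * K1 * \<bar>X * Y\<bar>) - K1 * Y\<^sup>2 \<le> h"
      unfolding h by linarith
    have sq: "0 \<le> (c / \<kappa>) * X\<^sup>2 + (R - 1) * Y\<^sup>2 + h"
    proof -
      have complete: "d * (x - K1 * d' * y)\<^sup>2 = d * x\<^sup>2 - 2 * K1 * (x * y) + K1\<^sup>2 * d' * y\<^sup>2" if "d * d' = 1" for d d' x y :: real
        using that by algebra
      have "0 \<le> (c / \<kappa>) * (\<bar>X\<bar> - K1 * (\<kappa> / c) * \<bar>Y\<bar>)\<^sup>2"
        using \<kappa> \<open>0 < c\<close> by simp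
      also have "\<dots> = (c / \<kappa>) * X\<^sup>2 - 2 * K1 * \<bar>X * Y\<bar> + K1\<^sup>2 * \<kappa> / c * Y\<^sup>2"
        using complete[of "c / \<kappa>" "\<kappa> / c" "\<bar>X\<bar>" "\<bar>Y\<bar>"] \<kappa> \<open>0 < c\<close> by (simp add: abs_mult)
      also have "\<dots> \<le> (c / \<kappa>) * X\<^sup>2 - 2 * K1 * \<bar>X * Y\<bar> + (R - 1 - K1) * Y\<^sup>2"
      proof -
        have "c * (1 + K1) \<le> R * 1" using R \<open>0 < c\<close> by (simp add: R0_def)
        moreover have "0 \<le> K1\<^sup>2 * c" using \<open>0 < c\<close> by simp
        moreover have "R * c = R * K1\<^sup>2 + R" unfolding c_def by (simp add: algebra_simps)
        ultimately have "K1\<^sup>2 * \<kappa> \<le> c * (R - 1 - K1)"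
          unfolding \<kappa>_def by (simp add: algebra_simps)
        then have "K1\<^sup>2 * \<kappa> / c \<le> R - 1 - K1"
          using \<open>0 < c\<close> by (simp add: pos_divide_le_eq mult.commute)
        then show ?thesis by (intro add_left_mono mult_right_mono) auto
      qed
      also have "\<dots> = (c / \<kappa>) * X\<^sup>2 + (R - 1) * Y\<^sup>2 + (- (2 * K1 * \<bar>X * Y\<bar>) - K1 * Y\<^sup>2)"
        by (simp add: algebra_simps)
      also have "\<dots> \<le> (c / \<kappa>) * X\<^sup>2 + (R - 1) * Y\<^sup>2 + h"
        using h_ge by simp
      finally show ?thesis .
    qed
    have N: "R - c - 1 = \<kappa> - 1" by (simp add: \<kappa>_def)
    have c: "c = R - \<kappa>" by (simp add: \<kappa>_def)
    \<comment> \<open>In \<open>r\<close> the minimum is at \<open>R * X / \<kappa>\<close>, and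
      \<open>R\<^sup>2 / \<kappa> - R = R * c / \<kappa>\<close> is what survives in front of
      \<open>X\<^sup>2\<close>. This is the gain that a positive \<open>c\<close> buys.\<close>
    have "(R * X - (R - c - 1) * r)\<^sup>2 - R * X\<^sup>2 + (R - c - 1) * r\<^sup>2 + (R\<^sup>2 - R) * Y\<^sup>2 + R * h
      = R * ((c / \<kappa>) * X\<^sup>2 + (R - 1) * Y\<^sup>2 + h) + (\<kappa> - 1) * \<kappa> * (r - R * X / \<kappa>)\<^sup>2"
    proof -
      have "\<kappa> * (1 / \<kappa>) = 1" using \<kappa> by simp
      then have "(R * X - (\<kappa> - 1) * r)\<^sup>2 - R * X\<^sup>2 + (\<kappa> - 1) * r\<^sup>2 + (R\<^sup>2 - R) * Y\<^sup>2 + R * h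
        = R * ((R - \<kappa>) * (1 / \<kappa>) * X\<^sup>2 + (R - 1) * Y\<^sup>2 + h) + (\<kappa> - 1) * \<kappa> * (r - R * X * (1 / \<kappa>))\<^sup>2"
        by algebra
      then show ?thesis
        unfolding N c[symmetric] by simp
    qed
    moreover have "0 \<le> R * ((c / \<kappa>) * X\<^sup>2 + (R - 1) * Y\<^sup>2 + h)"
      using sq \<kappa> by (intro mult_nonneg_nonneg) auto
    moreover have "0 \<le> (\<kappa> - 1) * \<kappa> * (r - R * X / \<kappa>)\<^sup>2"
      using \<kappa> by simp
    ultimately show "0 \<le> (R * (s * u1 + t * v1) - (R - c - 1) * r)\<^sup>2 - R * (s * u1 + t * v1)\<^sup>2 + (R - c - 1) * r\<^sup>2
      + (R\<^sup>2 - R) * (s * u2 + t * v2)\<^sup>2 + R * (s\<^sup>2 * A + 2 * (u1 * v1 + u2 * v2) * (s * t) * M + t\<^sup>2 * C)"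
      unfolding X_def[symmetric] Y_def[symmetric] \<rho>_def[symmetric] h_def[symmetric] by linarith
  qed
qed

section \<open>The power function\<close>

text \<open>Writing \<open>B\<close> as \<open>exp (R * ln H - N * ln z)\<close> takes only linear
  combinations and compositions with \<open>ln\<close> and \<open>exp\<close>, and presents its
  Hessian as \<open>B\<close> times a form in logarithmic derivatives. The bound
  \<open>\<mu>\<close> keeps the derivatives of \<open>ln\<close> bounded.\<close>

lemma quad_expansion_ln:
  assumes F: "quad_expansion S F l q" and D: "\<And>p p'. p \<in> S \<Longrightarrow> p' \<in> S \<Longrightarrow> norm (p' - p) \<le> D"
    and \<mu>: "0 < \<mu>" "\<And>p. p \<in> S \<Longrightarrow> \<mu> \<le> F p"
  shows "quad_expansion S (\<lambda>p. ln (F p)) (\<lambda>p d. 1 / F p * l p d)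
    (\<lambda>p d e. - 1 / (F p)\<^sup>2 * (l p d * l p e) + 1 / F p * q p d e)"
proof (rule quad_expansion_compose[where \<phi> = ln and ?\<phi>1.0 = "\<lambda>t. 1 / t" and ?\<phi>2.0 = "\<lambda>t. - 1 / t\<^sup>2", OF F D])
  let ?M = "1 / \<mu> + 1 / \<mu>\<^sup>2 + 2 / \<mu> ^ 3"
  have M: "1 / \<mu> \<le> ?M" "1 / \<mu>\<^sup>2 \<le> ?M" "2 / \<mu> ^ 3 \<le> ?M"
    using \<mu>(1) by simp_all
  fix p assume p: "p \<in> S"
  have Fp: "\<mu> \<le> F p" "0 < F p" using \<mu> p by force+
  have "1 / F p \<le> 1 / \<mu>" using Fp \<mu>(1) by (intro divide_left_mono) auto
  then show "\<bar>1 / F p\<bar> \<le> ?M" using Fp M by simp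
  have "1 / (F p)\<^sup>2 \<le> 1 / \<mu>\<^sup>2" using Fp \<mu>(1) by (intro divide_left_mono power_mono) auto
  then show "\<bar>- 1 / (F p)\<^sup>2\<bar> \<le> ?M" using Fp M by simp
  fix p' assume p': "p' \<in> S"
  have "\<bar>ln (F p') - ln (F p) - 1 / F p * (F p' - F p) - - 1 / (F p)\<^sup>2 * (F p' - F p)\<^sup>2 / 2\<bar> \<le> ?M * \<bar>F p' - F p\<bar> ^ 3"
  proof (rule taylor_order_2[where T = "{\<mu>..}" and ?f1.0 = "\<lambda>t. 1 / t" and ?f2.0 = "\<lambda>t. - 1 / t\<^sup>2" and ?f3.0 = "\<lambda>t. 2 / t ^ 3"])
    fix x assume "x \<in> {\<mu>..}"
    then have x: "\<mu> \<le> x" "0 < x" using \<mu>(1) by auto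
    show "(ln has_real_derivative 1 / x) (at x within {\<mu>..})"
      using x by (auto intro!: derivative_eq_intros)
    show "((\<lambda>t. 1 / t) has_real_derivative - 1 / x\<^sup>2) (at x within {\<mu>..})"
      using x by (auto intro!: derivative_eq_intros simp: power2_eq_square)
    show "((\<lambda>t. - 1 / t\<^sup>2) has_real_derivative 2 / x ^ 3) (at x within {\<mu>..})"
      using x by (auto intro!: derivative_eq_intros simp: power2_eq_square power3_eq_cube field_simps)
    have "2 / x ^ 3 \<le> 2 / \<mu> ^ 3" using x \<mu>(1) by (intro divide_left_mono power_mono) auto
    then show "\<bar>2 / x ^ 3\<bar> \<le> ?M" using x M by simp
  qed (use p p' \<mu> in auto)
  then show "\<bar>ln (F p') - ln (F p) - 1 / F p * (F p' - F p) - - 1 / (F p)\<^sup>2 * (F p' - F p)\<^sup>2 / 2\<bar> \<le> ?M * \<bar>F p' - F p\<bar> ^ 3" .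
qed

lemma quad_expansion_exp:
  assumes F: "quad_expansion S F l q" and D: "\<And>p p'. p \<in> S \<Longrightarrow> p' \<in> S \<Longrightarrow> norm (p' - p) \<le> D"
    and \<nu>: "\<And>p. p \<in> S \<Longrightarrow> F p \<le> \<nu>"
  shows "quad_expansion S (\<lambda>p. exp (F p)) (\<lambda>p d. exp (F p) * l p d)
    (\<lambda>p d e. exp (F p) * (l p d * l p e) + exp (F p) * q p d e)"
proof (rule quad_expansion_compose[where \<phi> = exp and ?\<phi>1.0 = exp and ?\<phi>2.0 = exp and M = "exp \<nu>", OF F D])
  fix p p' assume "p \<in> S" "p' \<in> S"
  then show "\<bar>exp (F p') - exp (F p) - exp (F p) * (F p' - F p) - exp (F p) * (F p' - F p)\<^sup>2 / 2\<bar> \<le> exp \<nu> * \<bar>F p' - F p\<bar> ^ 3"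
    using \<nu> by (intro taylor_order_2[where T = "{..\<nu>}" and ?f3.0 = exp]) (auto intro!: derivative_eq_intros)
qed (use \<nu> in auto)

section \<open>The extended function and the Hessian of its weighted power\<close>

definition clip :: "real \<Rightarrow> real \<Rightarrow> real \<Rightarrow> real" where
  "clip l h x = max l (min h x)"

lemma clip_id [simp]: "l \<le> x \<Longrightarrow> x \<le> h \<Longrightarrow> clip l h x = x"
  by (simp add: clip_def)

lemma clip_mem: "l \<le> h \<Longrightarrow> clip l h x \<in> {l..h}"
  by (simp add: clip_def)

lemma continuous_on_clip [continuous_intros]: "continuous_on S f \<Longrightarrow> continuous_on S (\<lambda>x. clip l h (f x))"
  unfolding clip_def by (intro continuous_intros)

text \<open>\<open>(u1, u2)\<close> and \<open>(v1, v2)\<close> are the coefficient vectors of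
  \<open>U\<close> and \<open>V\<close> in two independent normals of which one is \<open>X\<close>;
  hence \<open>a u + b v = (1, 0)\<close>. The condition \<open>u2 \<noteq> 0\<close> says that
  \<open>U\<close> is not determined by \<open>X\<close>, which reflects the strict inequality
  assumed for \<open>a\<close> and \<open>b\<close>.\<close>

locale hessian_setting =
  fixes H :: "real \<Rightarrow> real \<Rightarrow> real" and i0 i1 j0 j1 \<delta> a b u1 u2 v1 v2 :: real
  assumes i: "i0 \<le> i1" and j: "j0 \<le> j1" and \<delta>: "0 < \<delta>"
    and C3: "C_k_on 3 {i0..i1} {j0..j1} H"
    and H_gt: "\<And>x y. x \<in> {i0..i1} \<Longrightarrow> y \<in> {j0..j1} \<Longrightarrow> \<delta> < H x y"
    and Hx_gt: "\<And>x y. x \<in> {i0..i1} \<Longrightarrow> y \<in> {j0..j1} \<Longrightarrow> \<delta> < \<bar>partial_x {i0..i1} H x y\<bar>"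
    and Hy_gt: "\<And>x y. x \<in> {i0..i1} \<Longrightarrow> y \<in> {j0..j1} \<Longrightarrow> \<delta> < \<bar>partial_y {j0..j1} H x y\<bar>"
    and pde: "\<And>x y. x \<in> {i0..i1} \<Longrightarrow> y \<in> {j0..j1} \<Longrightarrow>
           a\<^sup>2 * (partial_x {i0..i1} (partial_x {i0..i1} H) x y / (partial_x {i0..i1} H x y)\<^sup>2)
         + (1 - a\<^sup>2 - b\<^sup>2) * (partial_y {j0..j1} (partial_x {i0..i1} H) x y / (partial_x {i0..i1} H x y * partial_y {j0..j1} H x y))
         + b\<^sup>2 * (partial_y {j0..j1} (partial_y {j0..j1} H) x y / (partial_y {j0..j1} H x y)\<^sup>2) \<ge> 0"
    and ab: "0 < a" "0 < b"
    and uv: "a * u1 + b * v1 = 1" "a * u2 + b * v2 = 0" and unit: "u1\<^sup>2 + u2\<^sup>2 = 1" "v1\<^sup>2 + v2\<^sup>2 = 1" and u2: "u2 \<noteq> 0"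
begin

abbreviation "Hx \<equiv> partial_x {i0..i1} H"
abbreviation "Hy \<equiv> partial_y {j0..j1} H"
abbreviation "Hxx \<equiv> partial_x {i0..i1} Hx"
abbreviation "Hxy \<equiv> partial_y {j0..j1} Hx"
abbreviation "Hyy \<equiv> partial_y {j0..j1} Hy"

text \<open>Constant continuation beyond the rectangle gives the global continuity that
  \<open>jensen_setting\<close> asks for and preserves the lower bound
  \<open>\<delta>\<close>.\<close>

definition ext :: "real \<Rightarrow> real \<Rightarrow> real" where
  "ext x y = H (clip i0 i1 x) (clip j0 j1 y)"

lemma ext_eq: "x \<in> {i0..i1} \<Longrightarrow> y \<in> {j0..j1} \<Longrightarrow> ext x y = H x y"
  by (simp add: ext_def)

lemma ext_gt: "\<delta> < ext x y"
  unfolding ext_def using clip_mem[OF i] clip_mem[OF j] by (intro H_gt)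

lemma continuous_ext: "continuous_on UNIV (\<lambda>(x, y). ext x y)"
proof -
  have "continuous_on UNIV ((\<lambda>(x, y). H x y) \<circ> (\<lambda>z. (clip i0 i1 (fst z), clip j0 j1 (snd z))))"
    using clip_mem[OF i] clip_mem[OF j]
    by (intro continuous_on_compose continuous_on_subset[OF C_k_on_continuous[OF C3]] continuous_intros) auto
  then show ?thesis
    by (simp add: ext_def o_def split_beta')
qed

lemma derivatives_bounded:
  obtains K where "\<And>x y. x \<in> {i0..i1} \<Longrightarrow> y \<in> {j0..j1} \<Longrightarrow> \<bar>H x y\<bar> \<le> K \<and> \<bar>Hx x y\<bar> \<le> K \<and> \<bar>Hy x y\<bar> \<le> K
    \<and> \<bar>Hxx x y\<bar> \<le> K \<and> \<bar>Hxy x y\<bar> \<le> K \<and> \<bar>Hyy x y\<bar> \<le> K"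
proof -
  have C: "C_k_on (Suc (Suc (Suc 0))) {i0..i1} {j0..j1} H"
    using C3 by (simp only: numeral_3_eq_3)
  note C' = C_k_on_SucD[OF C]
  note bd = C_k_on_bounded[OF _ compact_Icc compact_Icc]
  obtain K1 K2 K3 K4 K5 K6 where K:
    "\<forall>x\<in>{i0..i1}. \<forall>y\<in>{j0..j1}. \<bar>H x y\<bar> \<le> K1" "\<forall>x\<in>{i0..i1}. \<forall>y\<in>{j0..j1}. \<bar>Hx x y\<bar> \<le> K2"
    "\<forall>x\<in>{i0..i1}. \<forall>y\<in>{j0..j1}. \<bar>Hy x y\<bar> \<le> K3" "\<forall>x\<in>{i0..i1}. \<forall>y\<in>{j0..j1}. \<bar>Hxx x y\<bar> \<le> K4"
    "\<forall>x\<in>{i0..i1}. \<forall>y\<in>{j0..j1}. \<bar>Hxy x y\<bar> \<le> K5" "\<forall>x\<in>{i0..i1}. \<forall>y\<in>{j0..j1}. \<bar>Hyy x y\<bar> \<le> K6"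
    using bd[OF C] bd[OF C'(1)] bd[OF C'(2)] bd[OF C_k_on_SucD(1)[OF C'(1)]] bd[OF C_k_on_SucD(2)[OF C'(1)]] bd[OF C_k_on_SucD(2)[OF C'(2)]]
    by (elim exE) blast
  show thesis
    using K by (intro that[of "max (max (max K1 K2) (max K3 K4)) (max K5 K6)"]) (auto simp: le_max_iff_disj)
qed

text \<open>\<open>max m\<close> removes the singularity at 0; on the box the third coordinate is at
  least \<open>m\<close>, and there it changes nothing.\<close>

definition power_fun :: "real \<Rightarrow> real \<Rightarrow> real \<Rightarrow> real ^ 3 \<Rightarrow> real" where
  "power_fun R N m p = ext (p $ 1) (p $ 2) powr R * max m (p $ 3) powr (- N)"

definition dir :: "3 \<Rightarrow> real \<times> real" where
  "dir k = (if k = 1 then (u1, u2) else if k = 2 then (v1, v2) else (1, 0))"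

lemma H_expansion:
  fixes l h :: "real ^ 3"
  assumes "l $ 1 = i0" "h $ 1 = i1" "l $ 2 = j0" "h $ 2 = j1"
  shows "quad_expansion (cbox l h) (\<lambda>p. H (p $ 1) (p $ 2))
    (\<lambda>p d. Hx (p $ 1) (p $ 2) * d $ 1 + Hy (p $ 1) (p $ 2) * d $ 2)
    (\<lambda>p d e. Hxx (p $ 1) (p $ 2) * (d $ 1 * e $ 1) + Hxy (p $ 1) (p $ 2) * (d $ 1 * e $ 2 + d $ 2 * e $ 1) + Hyy (p $ 1) (p $ 2) * (d $ 2 * e $ 2))"
proof -
  obtain K where K: "\<And>x y. x \<in> {i0..i1} \<Longrightarrow> y \<in> {j0..j1} \<Longrightarrow> \<bar>H x y\<bar> \<le> K \<and> \<bar>Hx x y\<bar> \<le> K \<and> \<bar>Hy x y\<bar> \<le> K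
    \<and> \<bar>Hxx x y\<bar> \<le> K \<and> \<bar>Hxy x y\<bar> \<le> K \<and> \<bar>Hyy x y\<bar> \<le> K"
    by (rule derivatives_bounded) blast
  obtain T where T: "\<And>x y x' y'. x \<in> {i0..i1} \<Longrightarrow> y \<in> {j0..j1} \<Longrightarrow> x' \<in> {i0..i1} \<Longrightarrow> y' \<in> {j0..j1} \<Longrightarrow>
    \<bar>H x' y' - H x y - (Hx x y * (x' - x) + Hy x y * (y' - y))
      - (Hxx x y * (x' - x)\<^sup>2 + 2 * Hxy x y * (x' - x) * (y' - y) + Hyy x y * (y' - y)\<^sup>2) / 2\<bar> \<le> T * (\<bar>x' - x\<bar> + \<bar>y' - y\<bar>) ^ 3"
    by (rule C_k_on_taylor[OF C3 compact_Icc compact_Icc convex_closed_interval convex_closed_interval]) blast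
  have mem: "p $ 1 \<in> {i0..i1}" "p $ 2 \<in> {j0..j1}" if "p \<in> cbox l h" for p
    using that assms by (auto simp: mem_box_cart forall_3)
  have prod: "\<bar>x * (s * t)\<bar> \<le> K * (n * n')" if "\<bar>x\<bar> \<le> K" "\<bar>s\<bar> \<le> n" "\<bar>t\<bar> \<le> n'" for x s t n n'
    unfolding abs_mult using that by (intro mult_mono) auto
  show ?thesis
  proof (rule quad_expansionI)
    fix p assume "p \<in> cbox l h"
    note p = mem[OF this] and Kp = K[OF mem[OF this]]
    show "linear (\<lambda>d. Hx (p $ 1) (p $ 2) * d $ 1 + Hy (p $ 1) (p $ 2) * d $ 2)"
      by (auto intro!: linearI simp: algebra_simps)
    show "bilinear (\<lambda>d e. Hxx (p $ 1) (p $ 2) * (d $ 1 * e $ 1) + Hxy (p $ 1) (p $ 2) * (d $ 1 * e $ 2 + d $ 2 * e $ 1) + Hyy (p $ 1) (p $ 2) * (d $ 2 * e $ 2))"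
      unfolding bilinear_def by (auto intro!: linearI simp: algebra_simps)
    show "\<bar>Hx (p $ 1) (p $ 2) * d $ 1 + Hy (p $ 1) (p $ 2) * d $ 2\<bar> \<le> (2 * K) * norm d" for d
    proof -
      have "\<bar>Hx (p $ 1) (p $ 2)\<bar> \<le> K" "\<bar>Hy (p $ 1) (p $ 2)\<bar> \<le> K"
        using Kp by simp_all
      from this[THEN prod[OF _ component_le_norm_cart], of 1 1 d 1] this[THEN prod[OF _ component_le_norm_cart], of 1 1 d 2]
      have "\<bar>Hx (p $ 1) (p $ 2) * (d $ 1 * 1)\<bar> \<le> K * (norm d * 1)" "\<bar>Hy (p $ 1) (p $ 2) * (d $ 2 * 1)\<bar> \<le> K * (norm d * 1)"
        by simp_all
      then show ?thesis by simp
    qed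
    show "\<bar>Hxx (p $ 1) (p $ 2) * (d $ 1 * e $ 1) + Hxy (p $ 1) (p $ 2) * (d $ 1 * e $ 2 + d $ 2 * e $ 1) + Hyy (p $ 1) (p $ 2) * (d $ 2 * e $ 2)\<bar>
      \<le> (4 * K) * norm d * norm e" for d e
    proof -
      have *: "\<bar>x * (d $ k * e $ k')\<bar> \<le> K * (norm d * norm e)" if "\<bar>x\<bar> \<le> K" for x k k'
        by (intro prod that component_le_norm_cart)
      have xx: "\<bar>Hxx (p $ 1) (p $ 2)\<bar> \<le> K" and xy: "\<bar>Hxy (p $ 1) (p $ 2)\<bar> \<le> K" and yy: "\<bar>Hyy (p $ 1) (p $ 2)\<bar> \<le> K"
        using Kp by simp_all
      show ?thesis
        using *[OF xx, of 1 1] *[OF xy, of 1 2] *[OF xy, of 2 1] *[OF yy, of 2 2] by (simp only: distrib_left mult.assoc)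
    qed
    fix p' assume "p' \<in> cbox l h"
    note p' = mem[OF this]
    let ?n = "norm (p' - p)"
    have n: "\<bar>p' $ 1 - p $ 1\<bar> \<le> ?n" "\<bar>p' $ 2 - p $ 2\<bar> \<le> ?n"
      using component_le_norm_cart[of "p' - p"] by (metis vector_minus_component)+
    have "(\<bar>p' $ 1 - p $ 1\<bar> + \<bar>p' $ 2 - p $ 2\<bar>) ^ 3 \<le> (2 * ?n) ^ 3"
      using n by (intro power_mono) auto
    then have "\<bar>T\<bar> * (\<bar>p' $ 1 - p $ 1\<bar> + \<bar>p' $ 2 - p $ 2\<bar>) ^ 3 \<le> \<bar>T\<bar> * (2 * ?n) ^ 3"
      by (rule mult_left_mono) simp
    moreover have "T * (\<bar>p' $ 1 - p $ 1\<bar> + \<bar>p' $ 2 - p $ 2\<bar>) ^ 3 \<le> \<bar>T\<bar> * (\<bar>p' $ 1 - p $ 1\<bar> + \<bar>p' $ 2 - p $ 2\<bar>) ^ 3"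
      by (intro mult_right_mono) auto
    ultimately have "T * (\<bar>p' $ 1 - p $ 1\<bar> + \<bar>p' $ 2 - p $ 2\<bar>) ^ 3 \<le> (8 * \<bar>T\<bar>) * ?n ^ 3"
      by (simp add: power_mult_distrib)
    from order_trans[OF T[OF p p'] this]
    show "\<bar>H (p' $ 1) (p' $ 2) - H (p $ 1) (p $ 2) - (Hx (p $ 1) (p $ 2) * (p' - p) $ 1 + Hy (p $ 1) (p $ 2) * (p' - p) $ 2)
      - (Hxx (p $ 1) (p $ 2) * ((p' - p) $ 1 * (p' - p) $ 1) + Hxy (p $ 1) (p $ 2) * ((p' - p) $ 1 * (p' - p) $ 2 + (p' - p) $ 2 * (p' - p) $ 1)
         + Hyy (p $ 1) (p $ 2) * ((p' - p) $ 2 * (p' - p) $ 2)) / 2\<bar> \<le> (8 * \<bar>T\<bar>) * ?n ^ 3"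
    proof -
      have e: "X * (u * u) + Y * (u * v + v * u) + Z * (v * v) = X * u\<^sup>2 + 2 * Y * u * v + Z * v\<^sup>2" for X Y Z u v :: real
        by (simp add: power2_eq_square algebra_simps)
      show ?thesis
        unfolding e vector_minus_component by fact
    qed
  qed
qed

text \<open>\<open>l'\<close> and \<open>q'\<close> are gradient and Hessian of the logarithm of the
  function, which explains the common factor \<open>power_fun R N m p\<close>.\<close>

lemma power_fun_expansion:
  fixes l h :: "real ^ 3" and R N :: real
  assumes lh: "l $ 1 = i0" "h $ 1 = i1" "l $ 2 = j0" "h $ 2 = j1" "l $ 3 = m" and m: "0 < m"
  defines "h1 \<equiv> \<lambda>p d. (Hx (p $ 1) (p $ 2) * d $ 1 + Hy (p $ 1) (p $ 2) * d $ 2)"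
    and "h2 \<equiv> \<lambda>p d e. (Hxx (p $ 1) (p $ 2) * (d $ 1 * e $ 1) + Hxy (p $ 1) (p $ 2) * (d $ 1 * e $ 2 + d $ 2 * e $ 1) + Hyy (p $ 1) (p $ 2) * (d $ 2 * e $ 2))"
  defines "l' \<equiv> \<lambda>p d. R * (1 / H (p $ 1) (p $ 2) * h1 p d) + (- N) * (1 / p $ 3 * d $ 3)"
    and "q' \<equiv> \<lambda>p d e. R * (- 1 / (H (p $ 1) (p $ 2))\<^sup>2 * (h1 p d * h1 p e) + 1 / H (p $ 1) (p $ 2) * h2 p d e)
          + (- N) * (- 1 / (p $ 3)\<^sup>2 * (d $ 3 * e $ 3) + 1 / p $ 3 * 0)"
  shows "quad_expansion (cbox l h) (power_fun R N m)
    (\<lambda>p d. power_fun R N m p * l' p d) (\<lambda>p d e. power_fun R N m p * (l' p d * l' p e) + power_fun R N m p * q' p d e)"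
proof -
  let ?S = "cbox l h"
  let ?F = "\<lambda>p. R * ln (H (p $ 1) (p $ 2)) + (- N) * ln (p $ 3)"
  have mem: "p $ 1 \<in> {i0..i1}" "p $ 2 \<in> {j0..j1}" "m \<le> p $ 3" "p $ 3 \<le> h $ 3" if "p \<in> ?S" for p
    using that lh by (auto simp: mem_box_cart forall_3)
  have D: "norm (p' - p) \<le> diameter ?S" if "p \<in> ?S" "p' \<in> ?S" for p p'
    using diameter_bounded_bound[OF bounded_cbox that(2,1)] by (simp add: dist_norm)
  have ln1: "quad_expansion ?S (\<lambda>p. ln (H (p $ 1) (p $ 2))) (\<lambda>p d. 1 / H (p $ 1) (p $ 2) * h1 p d)
    (\<lambda>p d e. - 1 / (H (p $ 1) (p $ 2))\<^sup>2 * (h1 p d * h1 p e) + 1 / H (p $ 1) (p $ 2) * h2 p d e)"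
    unfolding h1_def h2_def using H_gt mem(1,2) less_imp_le
    by (intro quad_expansion_ln[OF H_expansion[OF lh(1-4)] D \<delta>]) blast+
  have "quad_expansion ?S (\<lambda>p. p $ 3) (\<lambda>p d. d $ 3) (\<lambda>p d e. 0)"
    by (intro quad_expansionI[where ?K1.0 = 1 and ?K2.0 = 0 and ?K3.0 = 0])
      (auto intro!: linearI simp: bilinear_def component_le_norm_cart)
  then have ln2: "quad_expansion ?S (\<lambda>p. ln (p $ 3)) (\<lambda>p d. 1 / p $ 3 * d $ 3) (\<lambda>p d e. - 1 / (p $ 3)\<^sup>2 * (d $ 3 * e $ 3) + 1 / p $ 3 * 0)"
    using mem(3) by (intro quad_expansion_ln[OF _ D m]) blast+
  obtain K where K: "\<And>x y. x \<in> {i0..i1} \<Longrightarrow> y \<in> {j0..j1} \<Longrightarrow> \<bar>H x y\<bar> \<le> K \<and> \<bar>Hx x y\<bar> \<le> K \<and> \<bar>Hy x y\<bar> \<le> K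
    \<and> \<bar>Hxx x y\<bar> \<le> K \<and> \<bar>Hxy x y\<bar> \<le> K \<and> \<bar>Hyy x y\<bar> \<le> K"
    by (rule derivatives_bounded) blast
  have lnb: "\<bar>ln x\<bar> \<le> \<bar>ln \<mu>\<bar> + \<bar>ln M\<bar>" if "0 < \<mu>" "\<mu> \<le> x" "x \<le> M" for x \<mu> M :: real
  proof -
    have "ln \<mu> \<le> ln x" "ln x \<le> ln M" using that by auto
    then show ?thesis by linarith
  qed
  have F_le: "?F p \<le> \<bar>R\<bar> * (\<bar>ln \<delta>\<bar> + \<bar>ln K\<bar>) + \<bar>N\<bar> * (\<bar>ln m\<bar> + \<bar>ln (h $ 3)\<bar>)" if p: "p \<in> ?S" for p
  proof -
    have "\<bar>ln (H (p $ 1) (p $ 2))\<bar> \<le> \<bar>ln \<delta>\<bar> + \<bar>ln K\<bar>"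
      using H_gt[OF mem(1,2)[OF p]] K[OF mem(1,2)[OF p]] \<delta> by (intro lnb) auto
    moreover have "\<bar>ln (p $ 3)\<bar> \<le> \<bar>ln m\<bar> + \<bar>ln (h $ 3)\<bar>"
      using mem(3,4)[OF p] m by (intro lnb) auto
    ultimately have "\<bar>R * ln (H (p $ 1) (p $ 2))\<bar> \<le> \<bar>R\<bar> * (\<bar>ln \<delta>\<bar> + \<bar>ln K\<bar>)" "\<bar>(- N) * ln (p $ 3)\<bar> \<le> \<bar>N\<bar> * (\<bar>ln m\<bar> + \<bar>ln (h $ 3)\<bar>)"
      unfolding abs_mult by (auto intro: mult_left_mono)
    then show ?thesis by linarith
  qed
  have "quad_expansion ?S (\<lambda>p. exp (?F p)) (\<lambda>p d. exp (?F p) * l' p d) (\<lambda>p d e. exp (?F p) * (l' p d * l' p e) + exp (?F p) * q' p d e)"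
    unfolding l'_def q'_def by (rule quad_expansion_exp[OF quad_expansion_lin_comb[OF ln1 ln2] D F_le])
  moreover have "power_fun R N m p = exp (?F p)" if p: "p \<in> ?S" for p
    using H_gt[OF mem(1,2)[OF p]] mem(3)[OF p] m \<delta>
    by (simp add: power_fun_def ext_eq[OF mem(1,2)[OF p]] powr_def exp_add[symmetric] exp_diff exp_minus field_simps)
  ultimately show ?thesis
    unfolding quad_expansion_def by simp
qed

end

context hessian_setting
begin

lemma norm_dir: "norm (dir k) = 1"
  using unit by (auto simp: dir_def norm_prod_def)

lemma continuous_power_fun: "0 < m \<Longrightarrow> continuous_on UNIV (power_fun R N m)"
proof -
  assume m: "0 < m"
  have "continuous_on UNIV ((\<lambda>(x, y). ext x y) \<circ> (\<lambda>p :: real ^ 3. (p $ 1, p $ 2)))"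
    by (intro continuous_on_compose continuous_on_subset[OF continuous_ext] continuous_intros) auto
  then have "continuous_on UNIV (\<lambda>p :: real ^ 3. ext (p $ 1) (p $ 2))"
    by (simp add: o_def)
  then show ?thesis
    unfolding power_fun_def using ext_gt \<delta> m
    by (intro continuous_intros) (auto simp: max_def less_le_not_le split: if_splits dest: less_trans, metis less_asym less_trans)
qed

text \<open>\<open>c\<close> and \<open>R0\<close> come before \<open>m\<close> and
  \<open>M\<close>, which will depend on \<open>R\<close>. This order is possible because scaling
  the third component of the test vector by \<open>p $ 3\<close> removes that coordinate from the
  form, and only bounds on \<open>H\<close> and its derivatives remain.\<close>

lemma jensen_setting_power_fun:
  "\<exists>c>0. \<exists>R0>c + 1. \<forall>R>R0. \<forall>m M. 0 < m \<longrightarrow>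
    (\<exists>g \<beta> L. jensen_setting (power_fun R (R - c - 1) m) (vector [i0, j0, m]) (vector [i1, j1, M]) g \<beta> dir L)"
proof -
  obtain K where K: "\<And>x y. x \<in> {i0..i1} \<Longrightarrow> y \<in> {j0..j1} \<Longrightarrow> \<bar>H x y\<bar> \<le> K \<and> \<bar>Hx x y\<bar> \<le> K \<and> \<bar>Hy x y\<bar> \<le> K
    \<and> \<bar>Hxx x y\<bar> \<le> K \<and> \<bar>Hxy x y\<bar> \<le> K \<and> \<bar>Hyy x y\<bar> \<le> K"
    by (rule derivatives_bounded) blast
  \<comment> \<open>This bounds \<open>H * Hxx / Hx\<^sup>2\<close> and its two analogues: each
    factor above is at most \<open>K\<close>, each one below exceeds \<open>\<delta>\<close> in
    absolute value.\<close>
  have "0 \<le> K\<^sup>2 / \<delta>\<^sup>2" by simp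
  from quadratic_form_nonneg[OF ab uv unit u2 this]
  obtain c R0 where c: "0 < c" "c + 1 < R0" and form: "\<And>R A M C s t r. R0 < R \<Longrightarrow>
    \<bar>A\<bar> \<le> K\<^sup>2 / \<delta>\<^sup>2 \<Longrightarrow> \<bar>M\<bar> \<le> K\<^sup>2 / \<delta>\<^sup>2 \<Longrightarrow> \<bar>C\<bar> \<le> K\<^sup>2 / \<delta>\<^sup>2 \<Longrightarrow>
    0 \<le> a\<^sup>2 * A + (1 - a\<^sup>2 - b\<^sup>2) * M + b\<^sup>2 * C \<Longrightarrow>
    0 \<le> (R * (s * u1 + t * v1) - (R - c - 1) * r)\<^sup>2 - R * (s * u1 + t * v1)\<^sup>2 + (R - c - 1) * r\<^sup>2
      + (R\<^sup>2 - R) * (s * u2 + t * v2)\<^sup>2 + R * (s\<^sup>2 * A + 2 * (u1 * v1 + u2 * v2) * (s * t) * M + t\<^sup>2 * C)"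
    by blast
  have "\<exists>g \<beta> L. jensen_setting (power_fun R (R - c - 1) m) (vector [i0, j0, m]) (vector [i1, j1, M]) g \<beta> dir L"
    if R: "R0 < R" and m: "0 < m" for R m M
  proof -
    define N where "N = R - c - 1"
    define l h :: "real ^ 3" where "l = vector [i0, j0, m]" and "h = vector [i1, j1, M]"
    have lh: "l $ 1 = i0" "h $ 1 = i1" "l $ 2 = j0" "h $ 2 = j1" "l $ 3 = m" "h $ 3 = M"
      by (simp_all add: l_def h_def)
    define h1 where "h1 = (\<lambda>(p::real^3) (d::real^3). (Hx (p $ 1) (p $ 2) * d $ 1 + Hy (p $ 1) (p $ 2) * d $ 2))"
    define h2 where "h2 = (\<lambda>(p::real^3) (d::real^3) (e::real^3). (Hxx (p $ 1) (p $ 2) * (d $ 1 * e $ 1) + Hxy (p $ 1) (p $ 2) * (d $ 1 * e $ 2 + d $ 2 * e $ 1) + Hyy (p $ 1) (p $ 2) * (d $ 2 * e $ 2)))"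
    define l' where "l' = (\<lambda>(p::real^3) (d::real^3). R * (1 / H (p $ 1) (p $ 2) * h1 p d) + (- N) * (1 / p $ 3 * d $ 3))"
    define q' where "q' = (\<lambda>(p::real^3) (d::real^3) (e::real^3). R * (- 1 / (H (p $ 1) (p $ 2))\<^sup>2 * (h1 p d * h1 p e) + 1 / H (p $ 1) (p $ 2) * h2 p d e)
          + (- N) * (- 1 / (p $ 3)\<^sup>2 * (d $ 3 * e $ 3) + 1 / p $ 3 * 0))"
    let ?B = "power_fun R N m"
    have "quad_expansion (cbox l h) ?B (\<lambda>p d. ?B p * l' p d) (\<lambda>p d e. ?B p * (l' p d * l' p e) + ?B p * q' p d e)"
      unfolding l'_def q'_def h1_def h2_def by (rule power_fun_expansion[OF lh(1-5) m])
    then obtain L where L: "0 \<le> L" "\<And>p. p \<in> cbox l h \<Longrightarrow> linear (\<lambda>d. ?B p * l' p d)"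
      "\<And>p. p \<in> cbox l h \<Longrightarrow> bilinear (\<lambda>d e. ?B p * (l' p d * l' p e) + ?B p * q' p d e)"
      "\<And>p d e. p \<in> cbox l h \<Longrightarrow> \<bar>?B p * (l' p d * l' p e) + ?B p * q' p d e\<bar> \<le> L * norm d * norm e"
      "\<And>p p'. p \<in> cbox l h \<Longrightarrow> p' \<in> cbox l h \<Longrightarrow> \<bar>?B p' - ?B p - ?B p * l' p (p' - p)
        - (?B p * (l' p (p' - p) * l' p (p' - p)) + ?B p * q' p (p' - p) (p' - p)) / 2\<bar> \<le> L * norm (p' - p) ^ 3"
      by (rule quad_expansionE) blast
    \<comment> \<open>The vector representing the linear form \<open>?B p * l' p d\<close> through
      the inner product.\<close>
    define g where "g p = adjoint (\<lambda>d. ?B p * l' p d) 1" for p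
    have g: "g p \<bullet> d = ?B p * l' p d" if "p \<in> cbox l h" for p d
      using adjoint_works[OF L(2)[OF that], of d 1] by (simp add: g_def inner_commute)
    have positive: "0 \<le> ?B p * (l' p d1 * l' p d1) + ?B p * q' p d1 d1 + (?B p * (l' p d2 * l' p d2) + ?B p * q' p d2 d2)"
      if p: "p \<in> cbox l h" and d: "d1 = (\<chi> i. \<alpha> i * fst (dir i))" "d2 = (\<chi> i. \<alpha> i * snd (dir i))" for p d1 d2 \<alpha>
    proof -
      have mem: "p $ 1 \<in> {i0..i1}" "p $ 2 \<in> {j0..j1}" "m \<le> p $ 3"
        using p lh by (auto simp: mem_box_cart forall_3)
      define G X Y XX XY YY z where "G = H (p $ 1) (p $ 2)" and "X = Hx (p $ 1) (p $ 2)" and "Y = Hy (p $ 1) (p $ 2)"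
        and "XX = Hxx (p $ 1) (p $ 2)" and "XY = Hxy (p $ 1) (p $ 2)" and "YY = Hyy (p $ 1) (p $ 2)" and "z = p $ 3"
      note defs = this
      have G: "0 < G" "\<bar>G\<bar> \<le> K" and X: "\<delta> < \<bar>X\<bar>" and Y: "\<delta> < \<bar>Y\<bar>" and z: "0 < z"
        and XX: "\<bar>XX\<bar> \<le> K" and XY: "\<bar>XY\<bar> \<le> K" and YY: "\<bar>YY\<bar> \<le> K"
        using H_gt[OF mem(1,2)] Hx_gt[OF mem(1,2)] Hy_gt[OF mem(1,2)] K[OF mem(1,2)] \<delta> m mem(3) by (auto simp: defs)
      have nz: "X \<noteq> 0" "Y \<noteq> 0" "G \<noteq> 0" "z \<noteq> 0" using X Y G z \<delta> by auto
      \<comment> \<open>In these variables the logarithmic gradients have unit coefficients, so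
        \<open>l'\<close> depends on \<open>\<alpha>\<close> through \<open>s\<close>,
        \<open>t\<close>, \<open>r\<close> alone.\<close>
      define s t r where "s = \<alpha> 1 * X / G" and "t = \<alpha> 2 * Y / G" and "r = \<alpha> 3 / z"
      define A M' C where "A = G * XX / X\<^sup>2" and "M' = G * XY / (X * Y)" and "C = G * YY / Y\<^sup>2"
      have quot: "\<bar>G * w / (v * v')\<bar> \<le> K\<^sup>2 / \<delta>\<^sup>2" if "\<bar>w\<bar> \<le> K" "\<delta> < \<bar>v\<bar>" "\<delta> < \<bar>v'\<bar>" for w v v'
        unfolding abs_divide abs_mult power2_eq_square using that G \<delta> by (intro frac_le mult_mono) auto
      have "0 \<le> a\<^sup>2 * A + (1 - a\<^sup>2 - b\<^sup>2) * M' + b\<^sup>2 * C"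
      proof -
        have "0 \<le> G * (a\<^sup>2 * (XX / X\<^sup>2) + (1 - a\<^sup>2 - b\<^sup>2) * (XY / (X * Y)) + b\<^sup>2 * (YY / Y\<^sup>2))"
          using pde[OF mem(1,2)] G unfolding defs by (intro mult_nonneg_nonneg) auto
        then show ?thesis by (simp add: A_def M'_def C_def distrib_left mult_ac)
      qed
      moreover have "\<bar>A\<bar> \<le> K\<^sup>2 / \<delta>\<^sup>2" "\<bar>M'\<bar> \<le> K\<^sup>2 / \<delta>\<^sup>2" "\<bar>C\<bar> \<le> K\<^sup>2 / \<delta>\<^sup>2"
        using quot[OF XX X X] quot[OF XY X Y] quot[OF YY Y Y] by (simp_all add: A_def M'_def C_def power2_eq_square)
      ultimately have pos: "0 \<le> (R * (s * u1 + t * v1) - N * r)\<^sup>2 - R * (s * u1 + t * v1)\<^sup>2 + N * r\<^sup>2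
        + (R\<^sup>2 - R) * (s * u2 + t * v2)\<^sup>2 + R * (s\<^sup>2 * A + 2 * (u1 * v1 + u2 * v2) * (s * t) * M' + t\<^sup>2 * C)"
        unfolding N_def by (intro form[OF R])
      have comp: "d1 $ 1 = \<alpha> 1 * u1" "d1 $ 2 = \<alpha> 2 * v1" "d1 $ 3 = \<alpha> 3" "d2 $ 1 = \<alpha> 1 * u2" "d2 $ 2 = \<alpha> 2 * v2" "d2 $ 3 = 0"
        by (simp_all add: d dir_def)
      have l1: "l' p d1 = R * (s * u1 + t * v1) - N * r" and l2: "l' p d2 = R * (s * u2 + t * v2)"
        unfolding l'_def h1_def comp defs[symmetric] s_def t_def r_def by (simp_all add: algebra_simps add_divide_distrib)
      have hess: "1 / G * (XX * ((\<alpha> 1 * x) * (\<alpha> 1 * x)) + XY * ((\<alpha> 1 * x) * (\<alpha> 2 * y) + (\<alpha> 2 * y) * (\<alpha> 1 * x)) + YY * ((\<alpha> 2 * y) * (\<alpha> 2 * y)))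
        = s\<^sup>2 * x\<^sup>2 * A + 2 * (x * y) * (s * t) * M' + t\<^sup>2 * y\<^sup>2 * C" for x y
      proof -
        have e: "s\<^sup>2 * A = (\<alpha> 1)\<^sup>2 * XX / G" "s * t * M' = \<alpha> 1 * \<alpha> 2 * XY / G" "t\<^sup>2 * C = (\<alpha> 2)\<^sup>2 * YY / G"
          using nz by (simp_all add: s_def t_def A_def M'_def C_def power2_eq_square)
        have "s\<^sup>2 * x\<^sup>2 * A + 2 * (x * y) * (s * t) * M' + t\<^sup>2 * y\<^sup>2 * C
          = (s\<^sup>2 * A) * x\<^sup>2 + 2 * (x * y) * (s * t * M') + (t\<^sup>2 * C) * y\<^sup>2"
          by algebra
        also have "\<dots> = ((\<alpha> 1)\<^sup>2 * XX / G) * x\<^sup>2 + 2 * (x * y) * (\<alpha> 1 * \<alpha> 2 * XY / G) + ((\<alpha> 2)\<^sup>2 * YY / G) * y\<^sup>2"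
          unfolding e by simp
        also have "\<dots> = 1 / G * (XX * ((\<alpha> 1 * x) * (\<alpha> 1 * x)) + XY * ((\<alpha> 1 * x) * (\<alpha> 2 * y) + (\<alpha> 2 * y) * (\<alpha> 1 * x)) + YY * ((\<alpha> 2 * y) * (\<alpha> 2 * y)))"
          using nz by (simp add: field_simps power2_eq_square)
        finally show ?thesis by simp
      qed
      have grad: "- 1 / G\<^sup>2 * ((X * (\<alpha> 1 * x) + Y * (\<alpha> 2 * y)) * (X * (\<alpha> 1 * x) + Y * (\<alpha> 2 * y))) = - (s * x + t * y)\<^sup>2" for x y
        using nz by (simp add: s_def t_def power2_eq_square field_simps)
      have q1: "q' p d1 d1 = R * (- (s * u1 + t * v1)\<^sup>2 + (s\<^sup>2 * u1\<^sup>2 * A + 2 * (u1 * v1) * (s * t) * M' + t\<^sup>2 * v1\<^sup>2 * C)) + N * r\<^sup>2"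
        and q2: "q' p d2 d2 = R * (- (s * u2 + t * v2)\<^sup>2 + (s\<^sup>2 * u2\<^sup>2 * A + 2 * (u2 * v2) * (s * t) * M' + t\<^sup>2 * v2\<^sup>2 * C))"
        unfolding q'_def h1_def h2_def comp defs[symmetric] hess grad by (simp_all add: r_def power2_eq_square)
      \<comment> \<open>On adding the two directions the diagonal second-order terms get the squared
        lengths of \<open>u\<close> and \<open>v\<close>, both one, and the mixed term gets their
        inner product.\<close>
      have "l' p d1 * l' p d1 + q' p d1 d1 + (l' p d2 * l' p d2 + q' p d2 d2)
        = (R * (s * u1 + t * v1) - N * r)\<^sup>2 - R * (s * u1 + t * v1)\<^sup>2 + N * r\<^sup>2
        + (R\<^sup>2 - R) * (s * u2 + t * v2)\<^sup>2 + R * (s\<^sup>2 * A * (u1\<^sup>2 + u2\<^sup>2) + 2 * (u1 * v1 + u2 * v2) * (s * t) * M' + t\<^sup>2 * C * (v1\<^sup>2 + v2\<^sup>2))"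
        unfolding l1 l2 q1 q2 by algebra
      then have "0 \<le> l' p d1 * l' p d1 + q' p d1 d1 + (l' p d2 * l' p d2 + q' p d2 d2)"
        using pos unfolding unit by simp
      moreover have "0 \<le> ?B p"
        by (simp add: power_fun_def)
      ultimately have "0 \<le> ?B p * (l' p d1 * l' p d1 + q' p d1 d1 + (l' p d2 * l' p d2 + q' p d2 d2))"
        by (rule mult_nonneg_nonneg[rotated])
      then show ?thesis by (simp only: distrib_left)
    qed
    have "jensen_setting ?B l h g (\<lambda>p d e. ?B p * (l' p d * l' p e) + ?B p * q' p d e) dir L"
    proof
      show "continuous_on UNIV ?B" using m by (rule continuous_power_fun)
      show "?B p + g p \<bullet> (p' - p) + (?B p * (l' p (p' - p) * l' p (p' - p)) + ?B p * q' p (p' - p) (p' - p)) / 2 - L * norm (p' - p) ^ 3 \<le> ?B p'"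
        if "p \<in> cbox l h" "p' \<in> cbox l h" for p p'
        using L(5)[OF that] unfolding g[OF that(1)] by linarith
    qed (use L positive norm_dir in auto)
    then show ?thesis
      unfolding N_def l_def h_def by blast
  qed
  then show ?thesis
    using c by blast
qed

end

section \<open>Identification of the measures\<close>

text \<open>On rectangles density and indicator factorise, hence so does the integral, and
  rectangles determine a product measure.\<close>

lemma density_PiM_lborel:
  fixes \<phi> :: "nat \<Rightarrow> real \<Rightarrow> real"
  assumes "finite A" and prob: "\<And>i. prob_space (density lborel (\<lambda>t. ennreal (\<phi> i t)))"
    and meas [measurable]: "\<And>i. \<phi> i \<in> borel_measurable borel" and nonneg: "\<And>i t. 0 \<le> \<phi> i t"
  shows "density (\<Pi>\<^sub>M i\<in>A. lborel) (\<lambda>y. ennreal (\<Prod>i\<in>A. \<phi> i (y i))) = (\<Pi>\<^sub>M i\<in>A. density lborel (\<lambda>t. ennreal (\<phi> i t)))"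
proof -
  interpret N: product_sigma_finite "\<lambda>i. density lborel (\<lambda>t. ennreal (\<phi> i t))"
    using prob by (simp add: product_sigma_finite_def prob_space_imp_sigma_finite)
  interpret L: product_sigma_finite "\<lambda>_::nat. lborel :: real measure" ..
  show ?thesis
  proof (rule N.PiM_eqI[OF \<open>finite A\<close>])
    show "sets (density (\<Pi>\<^sub>M i\<in>A. lborel) (\<lambda>y. ennreal (\<Prod>i\<in>A. \<phi> i (y i)))) = sets (\<Pi>\<^sub>M i\<in>A. density lborel (\<lambda>t. ennreal (\<phi> i t)))"
      by (simp cong: sets_PiM_cong)
    fix X assume "\<And>i. i \<in> A \<Longrightarrow> X i \<in> sets (density lborel (\<lambda>t. ennreal (\<phi> i t)))"
    then have X [measurable]: "\<And>i. i \<in> A \<Longrightarrow> X i \<in> sets borel" by simp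
    have X': "Pi\<^sub>E A X \<in> sets (\<Pi>\<^sub>M i\<in>A. lborel)"
      using X \<open>finite A\<close> by (intro sets_PiM_I_finite) auto
    have "emeasure (density (\<Pi>\<^sub>M i\<in>A. lborel) (\<lambda>y. ennreal (\<Prod>i\<in>A. \<phi> i (y i)))) (Pi\<^sub>E A X)
      = (\<integral>\<^sup>+y. ennreal (\<Prod>i\<in>A. \<phi> i (y i)) * indicator (Pi\<^sub>E A X) y \<partial>(\<Pi>\<^sub>M i\<in>A. lborel))"
      by (intro emeasure_density X') measurable
    also have "\<dots> = (\<integral>\<^sup>+y. (\<Prod>i\<in>A. ennreal (\<phi> i (y i)) * indicator (X i) (y i)) \<partial>(\<Pi>\<^sub>M i\<in>A. lborel))"
    proof (rule nn_integral_cong)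
      fix y assume y: "y \<in> space (\<Pi>\<^sub>M i\<in>A. (lborel :: real measure))"
      have "indicator (Pi\<^sub>E A X) y = (\<Prod>i\<in>A. indicator (X i) (y i) :: ennreal)"
        using y \<open>finite A\<close> by (auto simp: indicator_def PiE_iff space_PiM prod_zero_iff)
      then show "ennreal (\<Prod>i\<in>A. \<phi> i (y i)) * indicator (Pi\<^sub>E A X) y = (\<Prod>i\<in>A. ennreal (\<phi> i (y i)) * indicator (X i) (y i))"
        using nonneg by (simp add: prod.distrib prod_ennreal)
    qed
    also have "\<dots> = (\<Prod>i\<in>A. \<integral>\<^sup>+t. ennreal (\<phi> i t) * indicator (X i) t \<partial>lborel)"
      using X \<open>finite A\<close> by (intro L.product_nn_integral_prod) auto
    also have "\<dots> = (\<Prod>i\<in>A. emeasure (density lborel (\<lambda>t. ennreal (\<phi> i t))) (X i))"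
      using X by (intro prod.cong refl emeasure_density[symmetric]) auto
    finally show "emeasure (density (\<Pi>\<^sub>M i\<in>A. lborel) (\<lambda>y. ennreal (\<Prod>i\<in>A. \<phi> i (y i)))) (Pi\<^sub>E A X)
      = (\<Prod>i\<in>A. emeasure (density lborel (\<lambda>t. ennreal (\<phi> i t))) (X i))" .
  qed
qed

lemma distr_std1_affine:
  assumes "0 < \<sigma>"
  shows "distr std1 borel (\<lambda>t. \<mu> + \<sigma> * t) = density lborel (\<lambda>t. ennreal (normal_density \<mu> \<sigma> t))"
proof -
  have "distributed std1 lborel (\<lambda>t. t) (\<lambda>t. ennreal (std_normal_density t))"
    by (auto simp: distributed_def intro!: distr_id2)
  then have "distributed std1 lborel (\<lambda>t. \<mu> + \<sigma> * t) (\<lambda>t. ennreal (normal_density (\<mu> + \<sigma> * 0) (\<bar>\<sigma>\<bar> * 1) t))"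
    using assms by (intro std1.normal_density_affine) auto
  then have "distr std1 lborel (\<lambda>t. \<mu> + \<sigma> * t) = density lborel (\<lambda>t. ennreal (normal_density \<mu> \<sigma> t))"
    using assms by (simp add: distributed_def)
  moreover have "distr std1 borel (\<lambda>t. \<mu> + \<sigma> * t) = distr std1 lborel (\<lambda>t. \<mu> + \<sigma> * t)"
    by (rule distr_cong) simp_all
  ultimately show ?thesis by simp
qed

lemma distr_stdP_affine:
  assumes "finite A" "0 < \<sigma>"
  shows "distr (stdP A) (\<Pi>\<^sub>M i\<in>A. lborel) (\<lambda>z. \<lambda>i\<in>A. \<mu> i + \<sigma> * z i)
    = (\<Pi>\<^sub>M i\<in>A. density lborel (\<lambda>t. ennreal (normal_density (\<mu> i) \<sigma> t)))"
proof -
  interpret N: product_sigma_finite "\<lambda>i. density lborel (\<lambda>t. ennreal (normal_density (\<mu> i) \<sigma> t))"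
    using prob_space_normal_density[OF assms(2)] by (simp add: product_sigma_finite_def prob_space_imp_sigma_finite)
  have meas: "(\<lambda>z. \<lambda>i\<in>A. \<mu> i + \<sigma> * z i) \<in> measurable (stdP A) (\<Pi>\<^sub>M i\<in>A. lborel)"
  proof (rule measurable_restrict)
    fix i assume "i \<in> A"
    then have "(\<lambda>z. z i) \<in> measurable (stdP A) std1" by (rule measurable_component_singleton)
    then have [measurable]: "(\<lambda>z. z i) \<in> borel_measurable (stdP A)" by simp
    show "(\<lambda>z. \<mu> i + \<sigma> * z i) \<in> measurable (stdP A) lborel"
      by simp
  qed
  show ?thesis
  proof (rule N.PiM_eqI[OF assms(1)])
    show "sets (distr (stdP A) (\<Pi>\<^sub>M i\<in>A. lborel) (\<lambda>z. \<lambda>i\<in>A. \<mu> i + \<sigma> * z i)) = sets (\<Pi>\<^sub>M i\<in>A. density lborel (\<lambda>t. ennreal (normal_density (\<mu> i) \<sigma> t)))"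
      by (simp cong: sets_PiM_cong)
    fix X assume "\<And>i. i \<in> A \<Longrightarrow> X i \<in> sets (density lborel (\<lambda>t. ennreal (normal_density (\<mu> i) \<sigma> t)))"
    then have X: "\<And>i. i \<in> A \<Longrightarrow> X i \<in> sets borel" by simp
    have pre: "(\<lambda>t. \<mu> i + \<sigma> * t) -` X i \<in> sets borel" if "i \<in> A" for i
    proof -
      have "(\<lambda>t. \<mu> i + \<sigma> * t) \<in> borel_measurable borel" by simp
      from measurable_sets[OF this X[OF that]] show ?thesis by simp
    qed
    have "emeasure (distr (stdP A) (\<Pi>\<^sub>M i\<in>A. lborel) (\<lambda>z. \<lambda>i\<in>A. \<mu> i + \<sigma> * z i)) (Pi\<^sub>E A X)
      = emeasure (stdP A) ((\<lambda>z. \<lambda>i\<in>A. \<mu> i + \<sigma> * z i) -` Pi\<^sub>E A X \<inter> space (stdP A))"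
      using X assms(1) by (intro emeasure_distr meas sets_PiM_I_finite) auto
    also have "(\<lambda>z. \<lambda>i\<in>A. \<mu> i + \<sigma> * z i) -` Pi\<^sub>E A X \<inter> space (stdP A) = (\<Pi>\<^sub>E i\<in>A. (\<lambda>t. \<mu> i + \<sigma> * t) -` X i)"
      by (auto simp: space_PiM PiE_iff restrict_def extensional_def)
    also have "emeasure (stdP A) \<dots> = (\<Prod>i\<in>A. emeasure std1 ((\<lambda>t. \<mu> i + \<sigma> * t) -` X i))"
      using pre assms(1) by (intro stdP.emeasure_PiM) auto
    also have "\<dots> = (\<Prod>i\<in>A. emeasure (density lborel (\<lambda>t. ennreal (normal_density (\<mu> i) \<sigma> t))) (X i))"
    proof (rule prod.cong[OF refl])
      fix i assume "i \<in> A"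
      then show "emeasure std1 ((\<lambda>t. \<mu> i + \<sigma> * t) -` X i) = emeasure (density lborel (\<lambda>t. ennreal (normal_density (\<mu> i) \<sigma> t))) (X i)"
        unfolding distr_std1_affine[OF assms(2), symmetric] using X by (subst emeasure_distr) auto
    qed
    finally show "emeasure (distr (stdP A) (\<Pi>\<^sub>M i\<in>A. lborel) (\<lambda>z. \<lambda>i\<in>A. \<mu> i + \<sigma> * z i)) (Pi\<^sub>E A X)
      = (\<Prod>i\<in>A. emeasure (density lborel (\<lambda>t. ennreal (normal_density (\<mu> i) \<sigma> t))) (X i))" .
  qed
qed

text \<open>Since \<open>p * y i + q * x i = p * (y i + (q / p) * x i)\<close>, the density is a
  product of normal densities with mean \<open>- (q / p) * x i\<close> and variance
  \<open>1 / p\<close>.\<close>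

lemma gauss_pqx_eq_PiM:
  assumes p: "0 < p"
  shows "gauss_pqx n p q x = (\<Pi>\<^sub>M i\<in>{..<n}. density lborel (\<lambda>t. ennreal (normal_density (- (q / p) * x i) (1 / sqrt p) t)))"
proof -
  have "(p / (2 * pi)) powr (real n / 2) * exp (- (\<Sum>i<n. (p * y i + q * x i)\<^sup>2) / (2 * p))
      = (\<Prod>i<n. normal_density (- (q / p) * x i) (1 / sqrt p) (y i))" for y
  proof -
    have "normal_density (- (q / p) * x i) (1 / sqrt p) (y i) = (p / (2 * pi)) powr (1 / 2) * exp (- (p * y i + q * x i)\<^sup>2 / (2 * p))" for i
    proof -
      have "(y i - - (q / p) * x i) = (p * y i + q * x i) / p"
        using p by (simp add: field_simps)
      then have "- (y i - - (q / p) * x i)\<^sup>2 / (2 * (1 / sqrt p)\<^sup>2) = - (p * y i + q * x i)\<^sup>2 / (2 * p)"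
        using p by (simp add: power_divide) (simp add: power2_eq_square)
      moreover have "1 / sqrt (2 * pi * (1 / sqrt p)\<^sup>2) = (p / (2 * pi)) powr (1 / 2)"
        using p by (simp add: powr_half_sqrt power_divide real_sqrt_divide)
      ultimately show ?thesis
        unfolding normal_density_def by simp
    qed
    then show ?thesis
      using p by (simp add: prod.distrib exp_sum[symmetric] sum_divide_distrib sum_negf powr_realpow[symmetric] powr_powr)
  qed
  then have "gauss_pqx n p q x = density (\<Pi>\<^sub>M i\<in>{..<n}. lborel) (\<lambda>y. ennreal (\<Prod>i\<in>{..<n}. normal_density (- (q / p) * x i) (1 / sqrt p) (y i)))"
    unfolding gauss_pqx_def lborel_dim_def by simp
  also have "\<dots> = (\<Pi>\<^sub>M i\<in>{..<n}. density lborel (\<lambda>t. ennreal (normal_density (- (q / p) * x i) (1 / sqrt p) t)))"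
    using p by (intro density_PiM_lborel prob_space_normal_density) auto
  finally show ?thesis .
qed

lemma gauss_eq_stdP: "gauss n = stdP {..<n}"
proof -
  have "gauss n = gauss_pqx n 1 0 undefined"
    by (simp add: gauss_def gauss_pqx_def)
  then show ?thesis
    by (simp add: gauss_pqx_eq_PiM)
qed

lemma integral_gauss_pqx:
  fixes F :: "(nat \<Rightarrow> real) \<Rightarrow> real"
  assumes p: "0 < p" and F: "F \<in> borel_measurable (lborel_dim n)"
  shows "(\<integral>y. F y \<partial>gauss_pqx n p q x) = (\<integral>z. F (\<lambda>i\<in>{..<n}. - (q / p) * x i + 1 / sqrt p * z i) \<partial>stdP {..<n})"
proof -
  have "0 < 1 / sqrt p" using p by simp
  have meas: "(\<lambda>z. \<lambda>i\<in>{..<n}. - (q / p) * x i + 1 / sqrt p * z i) \<in> measurable (stdP {..<n}) (lborel_dim n)"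
    unfolding lborel_dim_def
  proof (rule measurable_restrict)
    fix i assume "i \<in> {..<n}"
    then have "(\<lambda>z. z i) \<in> measurable (stdP {..<n}) std1" by (rule measurable_component_singleton)
    then have [measurable]: "(\<lambda>z. z i) \<in> borel_measurable (stdP {..<n})" by simp
    show "(\<lambda>z. - (q / p) * x i + 1 / sqrt p * z i) \<in> measurable (stdP {..<n}) lborel"
      by simp
  qed
  show ?thesis
    unfolding gauss_pqx_eq_PiM[OF p] distr_stdP_affine[OF finite_lessThan \<open>0 < 1 / sqrt p\<close>, symmetric]
    unfolding lborel_dim_def[symmetric] using meas F by (rule integral_distr)
qed

section \<open>From Jensen's inequality to the integral inequality\<close>

context hessian_setting
begin

lemma measurable_ext [measurable (raw)]:
  assumes [measurable]: "X \<in> borel_measurable M" "Y \<in> borel_measurable M"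
  shows "(\<lambda>\<omega>. ext (X \<omega>) (Y \<omega>)) \<in> borel_measurable M"
proof -
  have "(\<lambda>(x, y). ext x y) \<in> borel_measurable borel"
    using continuous_ext by (rule borel_measurable_continuous_onI)
  from measurable_compose[OF borel_measurable_Pair[OF assms] this] show ?thesis by simp
qed

lemma ext_bounded: obtains c0 where "0 < c0" "\<And>x y. ext x y \<le> c0"
proof -
  obtain K where K: "\<And>x y. x \<in> {i0..i1} \<Longrightarrow> y \<in> {j0..j1} \<Longrightarrow> \<bar>H x y\<bar> \<le> K \<and> \<bar>Hx x y\<bar> \<le> K \<and> \<bar>Hy x y\<bar> \<le> K
    \<and> \<bar>Hxx x y\<bar> \<le> K \<and> \<bar>Hxy x y\<bar> \<le> K \<and> \<bar>Hyy x y\<bar> \<le> K"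
    by (rule derivatives_bounded) blast
  have "ext x y \<le> K" for x y
    using K[OF clip_mem[OF i, of x] clip_mem[OF j, of y]] unfolding ext_def by linarith
  moreover have "0 < K"
    using ext_gt[of 0 0] \<delta> calculation[of 0 0] by linarith
  ultimately show thesis using that by blast
qed

text \<open>The bounds \<open>\<delta>\<close> and \<open>c0\<close> of \<open>ext\<close> carry
  over to the inner integral and its root \<open>k\<close>, which fixes the third side of the box.
  Jensen's inequality for \<open>f\<close>, \<open>g\<close>, \<open>k\<close> bounds
  \<open>K = E k\<close> from below by an expression in \<open>K\<close> itself, which is solved for
  \<open>K\<close>.\<close>

lemma power_inequality_stdP:
  assumes J: "jensen_setting (power_fun R (R - c - 1) (\<delta> powr (R / (R - c)))) (vector [i0, j0, \<delta> powr (R / (R - c))])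
      (vector [i1, j1, c0 powr (R / (R - c))]) G \<beta> dir L"
    and c0: "\<And>x y. ext x y \<le> c0" and c: "0 < c" and R: "c + 1 < R" and A: "finite A"
    and f: "f \<in> borel_measurable (stdP A)" "\<And>x. x \<in> space (stdP A) \<Longrightarrow> f x \<in> {i0..i1}"
    and g: "g \<in> borel_measurable (stdP A)" "\<And>x. x \<in> space (stdP A) \<Longrightarrow> g x \<in> {j0..j1}"
  shows "ext (\<integral>x. f x \<partial>stdP A) (\<integral>x. g x \<partial>stdP A) powr (R / (R - c))
    \<le> (\<integral>x. (\<integral>z. ext (f (lin_comb A (u1, u2) x z)) (g (lin_comb A (v1, v2) x z)) powr R \<partial>stdP A) powr (1 / (R - c)) \<partial>stdP A)"
proof -
  let ?\<kappa> = "R - c"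
  have \<kappa>: "1 < ?\<kappa>" and "0 < R" using R c by auto
  define m where "m = \<delta> powr (R / ?\<kappa>)"
  define M where "M = c0 powr (R / ?\<kappa>)"
  have m: "0 < m" using \<delta> by (simp add: m_def)
  have "0 < c0" using ext_gt[of 0 0] c0[of 0 0] \<delta> by linarith
  interpret A: prob_space "stdP A" by (rule prob_space_stdP)
  note [measurable] = f(1) g(1)
  define \<Phi> where "\<Phi> x z = ext (f (lin_comb A (u1, u2) x z)) (g (lin_comb A (v1, v2) x z)) powr R" for x z
  define W where "W x = (\<integral>z. \<Phi> x z \<partial>stdP A)" for x
  define k where "k x = W x powr (1 / ?\<kappa>)" for x
  have \<Phi>: "\<delta> powr R \<le> \<Phi> x z" "\<Phi> x z \<le> c0 powr R" "0 \<le> \<Phi> x z" for x z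
    unfolding \<Phi>_def using less_imp_le[OF ext_gt] less_imp_le[OF less_trans[OF \<delta> ext_gt]] c0 \<delta> \<open>0 < R\<close> by (auto intro!: powr_mono2)
  have \<Phi>_meas [measurable]: "(\<lambda>(x, z). \<Phi> x z) \<in> borel_measurable (stdP A \<Otimes>\<^sub>M stdP A)"
    unfolding \<Phi>_def by measurable
  have \<Phi>_int: "integrable (stdP A) (\<Phi> x)" if "x \<in> space (stdP A)" for x
    using measurable_compose[OF measurable_Pair1'[OF that] \<Phi>_meas] \<Phi>
    by (intro bounded_integrable[where K="c0 powr R"] prob_space_stdP) auto
  have W_meas [measurable]: "W \<in> borel_measurable (stdP A)"
    unfolding W_def[abs_def] by (intro A.borel_measurable_lebesgue_integral) (rule \<Phi>_meas)
  have W: "\<delta> powr R \<le> W x" "W x \<le> c0 powr R" if "x \<in> space (stdP A)" for x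
    unfolding W_def using \<Phi> by (auto intro!: A.integral_ge_const A.integral_le_const \<Phi>_int that)
  have W_pos: "0 < W x" if "x \<in> space (stdP A)" for x
  proof -
    have "0 < \<delta> powr R" using \<delta> by simp
    then show ?thesis using W(1)[OF that] by linarith
  qed
  have k_meas [measurable]: "k \<in> borel_measurable (stdP A)"
    unfolding k_def[abs_def] by measurable
  have k: "k x \<in> {m..M}" if "x \<in> space (stdP A)" for x
  proof -
    have "(\<delta> powr R) powr (1 / ?\<kappa>) \<le> k x" "k x \<le> (c0 powr R) powr (1 / ?\<kappa>)"
      unfolding k_def using W[OF that] W_pos[OF that] \<kappa> by (auto intro!: powr_mono2)
    then show ?thesis by (simp add: m_def M_def powr_powr)
  qed
  define K where "K = (\<integral>x. k x \<partial>stdP A)"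
  have k_int: "integrable (stdP A) k"
    using k m by (intro bounded_integrable[where K=M] prob_space_stdP) force+
  have "m \<le> K"
    unfolding K_def using k by (auto intro!: A.integral_ge_const k_int)
  then have "0 < K" using m by linarith
  interpret J: jensen_setting "power_fun R (?\<kappa> - 1) m" "vector [i0, j0, m]" "vector [i1, j1, M]" G \<beta> dir L
    using J unfolding m_def M_def by simp
  define F where "F i = (if i = 1 then f else if i = 2 then g else k)" for i :: 3
  have F: "F 1 = f" "F 2 = g" "F 3 = k" by (simp_all add: F_def)
  have "power_fun R (?\<kappa> - 1) m (\<chi> i. \<integral>x. F i x \<partial>stdP A)
    \<le> (\<integral>x. \<integral>z. power_fun R (?\<kappa> - 1) m (\<chi> i. F i (lin_comb A (dir i) x z)) \<partial>stdP A \<partial>stdP A)"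
  proof (rule J.jensen_stdP[OF A])
    show "F i \<in> borel_measurable (stdP A)" for i
      by (simp add: F_def)
    have "\<forall>i. F i x \<in> {vector [i0, j0, m] $ i..vector [i1, j1, M] $ i}" if "x \<in> space (stdP A)" for x
      unfolding forall_3 F using f(2)[OF that] g(2)[OF that] k[OF that] by simp
    then show "F i x \<in> {vector [i0, j0, m] $ i..vector [i1, j1, M] $ i}" if "x \<in> space (stdP A)" for x i
      using that by blast
  qed
  also have "\<dots> = (\<integral>x. k x \<partial>stdP A)"
  proof (rule Bochner_Integration.integral_cong[OF refl])
    fix x assume x: "x \<in> space (stdP A)"
    \<comment> \<open>The third direction does not involve \<open>z\<close>, so the power of
      \<open>k x\<close> leaves the inner integral, and what remains there is
      \<open>W x\<close>.\<close>
    have "lin_comb A (1, 0) x z = x" for z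
      using x by (auto simp: lin_comb_def space_PiM PiE_iff extensional_def fun_eq_iff)
    then have "power_fun R (?\<kappa> - 1) m (\<chi> i. F i (lin_comb A (dir i) x z)) = \<Phi> x z * k x powr (1 - ?\<kappa>)" for z
      using k[OF x] by (simp add: power_fun_def F dir_def \<Phi>_def max_absorb2)
    then have "(\<integral>z. power_fun R (?\<kappa> - 1) m (\<chi> i. F i (lin_comb A (dir i) x z)) \<partial>stdP A) = W x * k x powr (1 - ?\<kappa>)"
      by (simp add: W_def)
    also have "W x = k x powr ?\<kappa>"
      using W_pos[OF x] \<kappa> by (simp add: k_def powr_powr)
    also have "k x powr ?\<kappa> * k x powr (1 - ?\<kappa>) = k x"
      using k[OF x] m by (simp add: powr_add[symmetric])
    finally show "(\<integral>z. power_fun R (?\<kappa> - 1) m (\<chi> i. F i (lin_comb A (dir i) x z)) \<partial>stdP A) = k x" .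
  qed
  finally have "ext (\<integral>x. f x \<partial>stdP A) (\<integral>x. g x \<partial>stdP A) powr R * K powr (1 - ?\<kappa>) \<le> K"
    using \<open>m \<le> K\<close> by (simp add: power_fun_def F K_def[symmetric] max_absorb2)
  then have "ext (\<integral>x. f x \<partial>stdP A) (\<integral>x. g x \<partial>stdP A) powr R * K powr (1 - ?\<kappa>) * K powr (?\<kappa> - 1) \<le> K * K powr (?\<kappa> - 1)"
    by (rule mult_right_mono) simp
  then have "ext (\<integral>x. f x \<partial>stdP A) (\<integral>x. g x \<partial>stdP A) powr R \<le> K powr ?\<kappa>"
    using \<open>0 < K\<close> by (simp add: mult.assoc powr_add[symmetric] powr_mult_base)
  then have "(ext (\<integral>x. f x \<partial>stdP A) (\<integral>x. g x \<partial>stdP A) powr R) powr (1 / ?\<kappa>) \<le> (K powr ?\<kappa>) powr (1 / ?\<kappa>)"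
    using \<kappa> by (intro powr_mono2) auto
  then have "ext (\<integral>x. f x \<partial>stdP A) (\<integral>x. g x \<partial>stdP A) powr (R / ?\<kappa>) \<le> K"
    using \<open>0 < K\<close> \<kappa> by (simp add: powr_powr)
  then show ?thesis
    by (simp add: K_def k_def W_def \<Phi>_def)
qed

end

theorem lemma7:
  fixes H :: "real \<Rightarrow> real \<Rightarrow> real"
    and I J :: "real set"
    and i0 i1 j0 j1 a b \<delta> p q :: real
  assumes "i0 < i1" and "I = {i0..i1}"
    and "j0 < j1" and "J = {j0..j1}"
    and "a > 0" and "b > 0"
    and "((1 - a\<^sup>2 - b\<^sup>2) / (2 * a * b))\<^sup>2 < 1"
    and "C_k_on 3 I J H"
    and "\<delta> > 0"
    and "\<forall>x\<in>I. \<forall>y\<in>J. H x y > \<delta>"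
    and "\<forall>x\<in>I. \<forall>y\<in>J. \<bar>partial_x I H x y\<bar> > \<delta>"
    and "\<forall>x\<in>I. \<forall>y\<in>J. \<bar>partial_y J H x y\<bar> > \<delta>"
    and "\<forall>x\<in>I. \<forall>y\<in>J.
           a\<^sup>2 * (partial_x I (partial_x I H) x y / (partial_x I H x y)\<^sup>2)
         + (1 - a\<^sup>2 - b\<^sup>2) * (partial_y J (partial_x I H) x y / (partial_x I H x y * partial_y J H x y))
         + b\<^sup>2 * (partial_y J (partial_y J H) x y / (partial_y J H x y)\<^sup>2) \<ge> 0"
    and "p = 4 / ((1 - (a - b)\<^sup>2) * ((a + b)\<^sup>2 - 1))"
    and "q = 2 * (a\<^sup>2 - b\<^sup>2 - 1) / ((1 - (a - b)\<^sup>2) * ((a + b)\<^sup>2 - 1))"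
  shows "\<exists>c>0. \<exists>R0>0. \<forall>R>R0. \<forall>n\<ge>1. \<forall>f g.
           f \<in> borel_measurable (lborel_dim n) \<and> f \<in> space (lborel_dim n) \<rightarrow> I \<and>
           g \<in> borel_measurable (lborel_dim n) \<and> g \<in> space (lborel_dim n) \<rightarrow> J \<longrightarrow>
           (\<integral>x. (\<integral>y. H (f (\<lambda>i\<in>{..<n}. (x i - y i) / a)) (g (\<lambda>i\<in>{..<n}. y i / b)) powr R
                   \<partial>gauss_pqx n p q x) powr (1 / (R - c)) \<partial>gauss n)
           \<ge> H (\<integral>x. f x \<partial>gauss n) (\<integral>x. g x \<partial>gauss n) powr (R / (R - c))"
proof -
  \<comment> \<open>\<open>D\<close> is \<open>4 / p\<close>. As a difference of squares it is
    positive exactly by the strict inequality assumed for \<open>a\<close> and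
    \<open>b\<close>.\<close>
  define D where "D = (1 - (a - b)\<^sup>2) * ((a + b)\<^sup>2 - 1)"
  have "(1 - a\<^sup>2 - b\<^sup>2)\<^sup>2 < (2 * a * b)\<^sup>2"
    using assms(5-7) by (simp add: power_divide)
  moreover have D: "D = (2 * a * b)\<^sup>2 - (1 - a\<^sup>2 - b\<^sup>2)\<^sup>2"
    by (simp add: D_def power2_eq_square algebra_simps)
  ultimately have "0 < D" by simp
  have pq: "p = 4 / D" "q = 2 * (a\<^sup>2 - b\<^sup>2 - 1) / D"
    using assms(14,15) by (simp_all add: D_def)
  have p: "0 < p" and qp: "q / p = (a\<^sup>2 - b\<^sup>2 - 1) / 2"
    using \<open>0 < D\<close> by (simp_all add: pq)
  have ip: "(1 / sqrt p)\<^sup>2 = D / 4"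
    using p by (simp add: power_divide) (simp add: pq)
  \<comment> \<open>Given \<open>x\<close>, the coordinates of \<open>y\<close> are
    \<open>- \<tau> * x i + \<sigma> * z i\<close> with standard normal \<open>z\<close>;
    \<open>u\<close> and \<open>v\<close> collect the coefficients of \<open>x\<close> and
    \<open>z\<close> in \<open>(x - y) / a\<close> and \<open>y / b\<close>.\<close>
  define \<tau> where "\<tau> = q / p"
  define \<sigma> where "\<sigma> = 1 / sqrt p"
  have \<sigma>: "\<sigma> \<noteq> 0" "\<sigma>\<^sup>2 = D / 4" and \<tau>: "\<tau> = (a\<^sup>2 - b\<^sup>2 - 1) / 2"
    using p ip qp by (simp_all add: \<sigma>_def \<tau>_def)
  define u1 u2 v1 v2 where "u1 = (1 + \<tau>) / a" and "u2 = - \<sigma> / a" and "v1 = - \<tau> / b" and "v2 = \<sigma> / b"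
  note uv_defs = this
  \<comment> \<open>Unit variance of \<open>U\<close> and \<open>V\<close>. The difference of the
    two equations determines \<open>\<tau>\<close>, that is \<open>q / p\<close>, and either of them
    then gives \<open>1 / p\<close>: this is the origin of \<open>p\<close> and
    \<open>q\<close>.\<close>
  have "(1 + \<tau>)\<^sup>2 + \<sigma>\<^sup>2 = a\<^sup>2" "\<tau>\<^sup>2 + \<sigma>\<^sup>2 = b\<^sup>2"
    unfolding \<sigma>(2) \<tau> D by (simp_all add: power2_eq_square field_simps)
  then have unit: "u1\<^sup>2 + u2\<^sup>2 = 1" "v1\<^sup>2 + v2\<^sup>2 = 1"
    using assms(5,6) by (simp_all add: uv_defs power_divide add_divide_distrib[symmetric])
  interpret hessian_setting H i0 i1 j0 j1 \<delta> a b u1 u2 v1 v2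
  proof (rule hessian_setting.intro)
    show "i0 \<le> i1" "j0 \<le> j1"
      using assms(1,3) by simp_all
    show "a * u1 + b * v1 = 1" "a * u2 + b * v2 = 0" "u2 \<noteq> 0"
      using assms(5,6) \<sigma>(1) by (simp_all add: uv_defs)
  qed (fact assms(5,6,9) assms(8)[unfolded assms(2,4)] unit | rule assms(10-13)[unfolded assms(2,4), rule_format], assumption, assumption)+
  obtain c R0 where c: "0 < c" "c + 1 < R0" and J: "\<And>R m M. R0 < R \<Longrightarrow> 0 < m \<Longrightarrow>
    \<exists>g \<beta> L. jensen_setting (power_fun R (R - c - 1) m) (vector [i0, j0, m]) (vector [i1, j1, M]) g \<beta> dir L"
    using jensen_setting_power_fun by blast
  have "H (\<integral>x. f x \<partial>gauss n) (\<integral>x. g x \<partial>gauss n) powr (R / (R - c))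
      \<le> (\<integral>x. (\<integral>y. H (f (\<lambda>i\<in>{..<n}. (x i - y i) / a)) (g (\<lambda>i\<in>{..<n}. y i / b)) powr R \<partial>gauss_pqx n p q x) powr (1 / (R - c)) \<partial>gauss n)"
    if R: "R0 < R" and f: "f \<in> borel_measurable (lborel_dim n)" "f \<in> space (lborel_dim n) \<rightarrow> I"
      and g: "g \<in> borel_measurable (lborel_dim n)" "g \<in> space (lborel_dim n) \<rightarrow> J" for R n f g
  proof -
    let ?A = "{..<n}"
    have sets: "sets (lborel_dim n) = sets (stdP ?A)"
      unfolding lborel_dim_def by (rule sets_PiM_cong) simp_all
    have space: "space (lborel_dim n) = space (stdP ?A)"
      using sets by (rule sets_eq_imp_space_eq)
    have f': "f \<in> borel_measurable (stdP ?A)" "\<And>x. x \<in> space (stdP ?A) \<Longrightarrow> f x \<in> {i0..i1}"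
      using f assms(2) measurable_cong_sets[OF sets refl] unfolding space by blast+
    have g': "g \<in> borel_measurable (stdP ?A)" "\<And>x. x \<in> space (stdP ?A) \<Longrightarrow> g x \<in> {j0..j1}"
      using g assms(4) measurable_cong_sets[OF sets refl] unfolding space by blast+
    obtain B where B: "\<And>x y. ext x y \<le> B"
      by (rule ext_bounded) blast
    have "0 < \<delta> powr (R / (R - c))" using assms(9) by simp
    \<comment> \<open>The range of the third variable is chosen only here, for the given
      \<open>R\<close>; \<open>c\<close> and \<open>R0\<close> are already fixed.\<close>
    from J[OF R this, of "B powr (R / (R - c))"] obtain G \<beta> L where
      JS: "jensen_setting (power_fun R (R - c - 1) (\<delta> powr (R / (R - c)))) (vector [i0, j0, \<delta> powr (R / (R - c))])
        (vector [i1, j1, B powr (R / (R - c))]) G \<beta> dir L"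
      by blast
    have mean: "(\<integral>x. F x \<partial>stdP ?A) \<in> {l..h}" if "F \<in> borel_measurable (stdP ?A)" "\<And>x. x \<in> space (stdP ?A) \<Longrightarrow> F x \<in> {l..h}" for F and l h :: real
    proof -
      interpret A: prob_space "stdP ?A" by (rule prob_space_stdP)
      have "integrable (stdP ?A) F"
        using that by (intro bounded_integrable[where K="\<bar>l\<bar> + \<bar>h\<bar>"] prob_space_stdP) force+
      then show ?thesis
        using that(2) by (auto intro!: A.integral_ge_const A.integral_le_const)
    qed
    have inner: "(\<integral>y. H (f (\<lambda>i\<in>?A. (x i - y i) / a)) (g (\<lambda>i\<in>?A. y i / b)) powr R \<partial>gauss_pqx n p q x)
      = (\<integral>z. ext (f (lin_comb ?A (u1, u2) x z)) (g (lin_comb ?A (v1, v2) x z)) powr R \<partial>stdP ?A)" for x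
    proof -
      have sub: "(\<lambda>y. \<lambda>i\<in>?A. \<mu> i + s * y i) \<in> measurable (lborel_dim n) (stdP ?A)" for \<mu> :: "nat \<Rightarrow> real" and s
      proof (rule measurable_restrict)
        fix i assume "i \<in> ?A"
        then have "(\<lambda>y. y i) \<in> measurable (lborel_dim n) lborel"
          unfolding lborel_dim_def by (rule measurable_component_singleton)
        then have [measurable]: "(\<lambda>y. y i) \<in> borel_measurable (lborel_dim n)" by simp
        show "(\<lambda>y. \<mu> i + s * y i) \<in> measurable (lborel_dim n) std1" by simp
      qed
      have 1: "(\<lambda>i\<in>?A. (x i - y i) / a) = (\<lambda>i\<in>?A. x i / a + (- 1 / a) * y i)" "(\<lambda>i\<in>?A. y i / b) = (\<lambda>i\<in>?A. 0 + (1 / b) * y i)" for y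
        by (simp_all add: diff_divide_distrib)
      have meas: "(\<lambda>y. ext (f (\<lambda>i\<in>?A. (x i - y i) / a)) (g (\<lambda>i\<in>?A. y i / b)) powr R) \<in> borel_measurable (lborel_dim n)"
        unfolding 1 by (intro powr_real_measurable measurable_ext measurable_compose[OF sub f'(1)] measurable_compose[OF sub g'(1)]) simp
      \<comment> \<open>\<open>H\<close> is arbitrary off the rectangle, so measurability is proved
        for \<open>ext\<close>; restricted arguments are points of the space, where \<open>f\<close>
        and \<open>g\<close> take values in the rectangle's sides and both functions agree.\<close>
      have ext: "H (f (\<lambda>i\<in>?A. s i)) (g (\<lambda>i\<in>?A. t i)) = ext (f (\<lambda>i\<in>?A. s i)) (g (\<lambda>i\<in>?A. t i))" for s t
        by (rule ext_eq[symmetric]; intro f' g'; simp add: space_PiM)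
      have lc: "(\<lambda>i\<in>?A. (x i - (\<lambda>i\<in>?A. - (q / p) * x i + 1 / sqrt p * z i) i) / a) = lin_comb ?A (u1, u2) x z"
        "(\<lambda>i\<in>?A. (\<lambda>i\<in>?A. - (q / p) * x i + 1 / sqrt p * z i) i / b) = lin_comb ?A (v1, v2) x z" for z
        unfolding \<tau>_def[symmetric] \<sigma>_def[symmetric]
        using assms(5,6) by (auto simp: lin_comb_def uv_defs fun_eq_iff field_simps)
      show ?thesis
        unfolding ext integral_gauss_pqx[OF p meas] lc ..
    qed
    have R': "c + 1 < R" using R c by linarith
    have "ext (\<integral>x. f x \<partial>stdP ?A) (\<integral>x. g x \<partial>stdP ?A) = H (\<integral>x. f x \<partial>stdP ?A) (\<integral>x. g x \<partial>stdP ?A)"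
      by (intro ext_eq mean f' g')
    then show ?thesis
      using power_inequality_stdP[OF JS B c(1) R' finite_lessThan f' g'] unfolding inner gauss_eq_stdP by simp
  qed
  moreover have "0 < R0" using c by linarith
  ultimately show ?thesis
    using c(1) by blast
qed

end
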